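(* Let $q\in[0,1]$, $\hat u\in\mathbb H^{0;q}_{\omega,m}$, $\hat w\in\mathbb W^{1,1;-q}_{\omega,m}$ (spaces as in the context), and define the operators $$X_\sharp^T=-ig_\sharp(1-\tilde\chi_1)\omega,\qquad X_\sharp^\phi=ig_\sharp(1-\tilde\chi_1)m,\qquad X_\sharp^{W_+}=g_\sharp(1-\tilde\chi_1)W_+ .$$ Let $a(r,\theta),a_1(r,\theta),a_2(r,\theta)$ be nonnegative functions with $a=a_1a_2$. Then for $X_\sharp\in\{X_\sharp^T,X_\sharp^\phi,X_\sharp^{W_+}\}$ and with the compactly supported function $\chi_{\underline r^\sharp,\overline r^\sharp}$ of the context, $$\sum_{m\in\mathbb Z}\int_{\mathbb R}\int_0^\pi\int_{r_+}^\infty a^2\big|X_\sharp(\hat w*\hat u)-\hat w*(X_\sharp\hat u)\big|^2\sin\theta\,dr\,d\theta\,d\omega\lesssim\sup_{(r,\theta)}\Big(a_1^2\|\hat w\|^2_{\mathbb W^{1,1;-q}_{\omega,m}}\chi_{\underline r^\sharp,\overline r^\sharp}\Big)\int_0^\pi\int_{r_+}^\infty a_2^2\|\hat u\|^2_{\mathbb H^{0;q}_{\omega,m}}\chi_{\underline r^\sharp,\overline r^\sharp}\sin\theta\,dr\,d\theta$$ holds as long as the right hand side is finite; the implicit constant depends only on the Kerr parameters (denoted $M$ and $a$ in the context; not to be confused with the weight $a(r,\theta)$).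
   Context: **Kerr.** $0<a<M$ (standing assumption), $r_+=M+\sqrt{M^2-a^2}$, $\Delta=r^2-2Mr+a^2$, $v=\Delta^{1/2}/(r^2+a^2)$, $v_0=\sup_{r>r_+}v$; $h_0$ is the increasing function of $r$ with $h_0^2=1-v_0^{-2}v^2$; $R^\star=\frac\Delta{r^2+a^2}\partial_r$. $\mathcal R=\mathbb R_t\times(r_+,\infty)_r\times\mathbb S^2_{\theta,\phi}$. For $u$ on $\mathcal R$, $\hat u(\omega,r,\theta,m)=(2\pi)^{-1}\int_{\mathbb R}\int_0^{2\pi}e^{i(\omega t-m\phi)}u\,d\phi\,dt$, $(\omega,m)\in\mathbb R\times\mathbb Z$. Convolution: $(\hat f*\hat g)(\omega,m,r,\theta)=\sum_{m'}\int_{\mathbb R}\hat f(\omega',m',r,\theta)\hat g(\omega-\omega',m-m',r,\theta)\,d\omega'$. $\omega_r=\frac{am}{r^2+a^2}$, $\omega_+=\frac{am}{r_+^2+a^2}$. **Constants and cut-offs.** Positive constants $\xi_\ell,\xi_r,\delta^\sharp$ (suitably small) and $r_+<\underline r^\sharp<\overline r^\sharp<\infty$, with $\xi_\ell=\frac1{8\overline r^\sharp}$, are fixed depending only on the Kerr parameters. $\mathcal G=\{(\omega,m):m\omega\in(-\xi_\ell m^2,m\omega_++\xi_rm^2)\}$. On $\mathcal G$: $R^\sharp=\overline r^\sharp$ if $-\xi_\ell m^2<m\omega\le\frac{am^2}{(\overline r^\sharp)^2+a^2}$; $R^\sharp=\underline r^\sharp$ if $\frac{am^2}{(\underline r^\sharp)^2+a^2}\le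 m\omega<m\omega_++\xi_rm^2$; in between $R^\sharp$ is the radius where $\omega-\omega_r=0$. $R^{\sharp\sharp}$ is a smooth function on $\mathcal G$, homogeneous of degree $0$ in $(\omega,m)$ (a smooth function of $\omega/m$), with $R^\sharp\le R^{\sharp\sharp}<R^\sharp+\frac14\delta^\sharp$. $\tilde\chi_1=\chi_1(\omega/m)$ for $m\ne0$, $\tilde\chi_1=1$ for $m=0$, with $\chi_1$ smooth, $\chi_1(y)=1$ for $y\le-\xi_\ell$ or $y\ge\frac a{r_+^2+a^2}+\xi_r$, $\chi_1(y)=0$ for $-\frac34\xi_\ell\le y\le\frac a{r_+^2+a^2}+\frac34\xi_r$ (so $1-\tilde\chi_1$ is supported in $\mathcal G$). $g_\sharp\ge0$ is a smooth function of $r-R^{\sharp\sharp}$, equal to $1$ for $\frac14\delta^\sharp\le r-R^{\sharp\sharp}\le\frac12\delta^\sharp$ and $0$ for $r-R^{\sharp\sharp}\le\frac18\delta^\sharp$ or $\ge\frac58\delta^\sharp$. $\chi_{\overline r^\sharp}$ is a smooth nonnegative function of $r$, $=1$ for $r<\overline r^\sharp+\frac78\delta^\sharp$, $=0$ for $r>\overline r^\sharp+\delta^\sharp$; $\chi_{\underline r^\sharp,\overline r^\sharp}\le\chi_{\overline r^\sharp}$ is a smooth nonnegative function of $r$, $=1$ for $\underline r^\sharp+\frac18\delta^\sharp\le r\le\overline r^\sharp+\frac78\delta^\sharp$ and $=0$ for $r<\underline r^\sharp$ or $r>\overline r^\sharp+\delta^\sharp$. **Operators and norms.** $W_+=v^{-1}(R^\star-i(\omega-\omega_r))$,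 $W_0\hat u=v^{-1}(R^\star\hat u-ih_0(\omega-\omega_r)\hat u)$. At each $(r,\theta)$: $\|\hat w\|_{\mathbb W^{1,1;-q}_{\omega,m}}=\|\omega\hat w\|_{\ell^1_mL^1_\omega}+\|m\hat w\|_{\ell^1_mL^1_\omega}+\|v^{-q}W_0\hat w\|_{\ell^1_mL^1_\omega}$ and $\|\hat u\|_{\mathbb H^{0;q}_{\omega,m}}=\|v^q\hat u\|_{\ell^2_mL^2_\omega}+\Big\|\chi_{\overline r^\sharp}^{1/2}\frac{W_0\hat u}{\max(|m|,|\omega|,1)}\Big\|_{\ell^2_mL^2_\omega}$; the spaces are the closures of $\{\hat u:u\in C_0^\infty(\mathcal R)\}$ under these norms.
   Formalization: R^{♯♯} is taken smooth in ω/m up to the end points of the ratio interval of 𝒢 (else the bound can fail), and on the closed spaces, where ŵ*û may diverge, the commutator means its continuous extension from transforms of test functions; the weights a_1, a_2 are measurable. *)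

theory Defs
  imports "HOL-Analysis.Analysis"
begin

section \<open>Smooth functions\<close>

text \<open>Meant for open \<open>S\<close>.\<close>

primrec Ck_on :: "nat \<Rightarrow> 'a::euclidean_space set \<Rightarrow> ('a \<Rightarrow> 'b::real_normed_vector) \<Rightarrow> bool" where
  "Ck_on 0 S f = continuous_on S f"
| "Ck_on (Suc k) S f =
     ((\<forall>x\<in>S. f differentiable (at x)) \<and> (\<forall>d. Ck_on k S (\<lambda>x. frechet_derivative f (at x) d)))"

definition smooth_on :: "'a::euclidean_space set \<Rightarrow> ('a \<Rightarrow> 'b::real_normed_vector) \<Rightarrow> bool" where
  "smooth_on S f \<longleftrightarrow> (\<forall>k. Ck_on k S f)"


section \<open>Kerr background\<close>

definition rplus :: "real \<Rightarrow> real \<Rightarrow> real" where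
  "rplus M a = M + sqrt (M\<^sup>2 - a\<^sup>2)"

definition Delta :: "real \<Rightarrow> real \<Rightarrow> real \<Rightarrow> real" where
  "Delta M a r = r\<^sup>2 - 2 * M * r + a\<^sup>2"

definition vfun :: "real \<Rightarrow> real \<Rightarrow> real \<Rightarrow> real" where
  "vfun M a r = sqrt (Delta M a r) / (r\<^sup>2 + a\<^sup>2)"

definition vzero :: "real \<Rightarrow> real \<Rightarrow> real" where
  "vzero M a = (SUP r\<in>{rplus M a<..}. vfun M a r)"

text \<open>These two conditions determine \<open>h0\<close> on \<open>(r\<^sub>+, \<infinity>)\<close>: \<open>v\<close> increases up to a single
  maximum and then decreases, so \<open>h0\<close> is the negative root before the maximum and the positive
  root after it.\<close>

definition is_h0 :: "real \<Rightarrow> real \<Rightarrow> (real \<Rightarrow> real) \<Rightarrow> bool" where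
  "is_h0 M a h0 \<longleftrightarrow> mono_on {rplus M a<..} h0 \<and>
     (\<forall>r>rplus M a. (h0 r)\<^sup>2 = 1 - (vfun M a r)\<^sup>2 / (vzero M a)\<^sup>2)"

definition omega_r :: "real \<Rightarrow> int \<Rightarrow> real \<Rightarrow> real" where
  "omega_r a m r = a * of_int m / (r\<^sup>2 + a\<^sup>2)"

definition omega_plus :: "real \<Rightarrow> real \<Rightarrow> int \<Rightarrow> real" where
  "omega_plus M a m = omega_r a m (rplus M a)"

definition rtheta :: "real \<Rightarrow> real \<Rightarrow> (real \<times> real) set" where
  "rtheta M a = {rplus M a<..} \<times> {0<..<pi}"


section \<open>Functions on frequency space\<close>

text \<open>Argument order: \<open>\<omega>\<close>, \<open>m\<close>, \<open>r\<close>, \<open>\<theta>\<close>.  Only values with \<open>(r, \<theta>)\<close> in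
  \<open>rtheta M a\<close> matter.\<close>

type_synonym freqfun = "real \<Rightarrow> int \<Rightarrow> real \<Rightarrow> real \<Rightarrow> complex"

definition freq_measurable :: "real \<Rightarrow> real \<Rightarrow> freqfun \<Rightarrow> bool" where
  "freq_measurable M a f \<longleftrightarrow>
     (\<forall>m. set_borel_measurable borel (UNIV \<times> rtheta M a) (\<lambda>(\<omega>, r, \<theta>). f \<omega> m r \<theta>))"

text \<open>The polar map identifies \<open>\<real>\<^sub>t \<times> (r\<^sub>+, \<infinity>) \<times> S\<^sup>2\<close> diffeomorphically with the open set of
  \<open>(t, x, y, z)\<close> such that \<open>x\<^sup>2 + y\<^sup>2 + z\<^sup>2 > r\<^sub>+\<^sup>2\<close>; test functions are given in the latter
  coordinates, so that smoothness at the poles of the sphere has its usual meaning.\<close>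

definition test_fun :: "real \<Rightarrow> real \<Rightarrow> (real \<times> real \<times> real \<times> real \<Rightarrow> complex) \<Rightarrow> bool" where
  "test_fun M a U \<longleftrightarrow> smooth_on UNIV U \<and>
     (\<exists>K. compact K \<and> K \<subseteq> {(t, x, y, z). x\<^sup>2 + y\<^sup>2 + z\<^sup>2 > (rplus M a)\<^sup>2} \<and> (\<forall>p. p \<notin> K \<longrightarrow> U p = 0))"

definition in_polar ::
    "(real \<times> real \<times> real \<times> real \<Rightarrow> complex) \<Rightarrow> real \<Rightarrow> real \<Rightarrow> real \<Rightarrow> real \<Rightarrow> complex" where
  "in_polar U t r \<theta> \<phi> = U (t, r * sin \<theta> * cos \<phi>, r * sin \<theta> * sin \<phi>, r * cos \<theta>)"

definition hat :: "(real \<times> real \<times> real \<times> real \<Rightarrow> complex) \<Rightarrow> freqfun" where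
  "hat U \<omega> m r \<theta> = 1 / (2 * of_real pi) *
     (LBINT t. (LBINT \<phi>:{0..2*pi}.
        exp (\<i> * of_real (\<omega> * t - of_int m * \<phi>)) * in_polar U t r \<theta> \<phi>))"

definition conv :: "freqfun \<Rightarrow> freqfun \<Rightarrow> freqfun" where
  "conv f g \<omega> m r \<theta> =
     (\<Sum>\<^sub>\<infinity>m'\<in>UNIV. LBINT \<omega>'. f \<omega>' m' r \<theta> * g (\<omega> - \<omega>') (m - m') r \<theta>)"

definition Rstar :: "real \<Rightarrow> real \<Rightarrow> freqfun \<Rightarrow> freqfun" where
  "Rstar M a f \<omega> m r \<theta> = of_real (Delta M a r / (r\<^sup>2 + a\<^sup>2)) *
     vector_derivative (\<lambda>s. f \<omega> m s \<theta>) (at r)"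

definition Wplus :: "real \<Rightarrow> real \<Rightarrow> freqfun \<Rightarrow> freqfun" where
  "Wplus M a f \<omega> m r \<theta> = of_real (1 / vfun M a r) *
     (Rstar M a f \<omega> m r \<theta> - \<i> * of_real (\<omega> - omega_r a m r) * f \<omega> m r \<theta>)"

text \<open>The operator \<open>W\<^sub>0\<close> applied to a function \<open>f\<close> whose \<open>R\<^sup>\<star>\<close>-derivative is \<open>F\<close>.\<close>

definition Wzero :: "real \<Rightarrow> real \<Rightarrow> (real \<Rightarrow> real) \<Rightarrow> freqfun \<Rightarrow> freqfun \<Rightarrow> freqfun" where
  "Wzero M a h0 f F \<omega> m r \<theta> = of_real (1 / vfun M a r) *
     (F \<omega> m r \<theta> - \<i> * of_real (h0 r * (\<omega> - omega_r a m r)) * f \<omega> m r \<theta>)"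


section \<open>Constants and cut-offs\<close>

text \<open>\<open>Rss\<close> and \<open>chi1\<close> are functions of \<open>\<omega>/m\<close>, \<open>gcut\<close> is a function of \<open>r - R\<^sup>\<sharp>\<^sup>\<sharp>\<close>, and the other
  two cut-offs are functions of \<open>r\<close>.\<close>

record sharp_data =
  xi_l :: real
  xi_r :: real
  delta :: real
  r_lo :: real
  r_hi :: real
  Rss :: "real \<Rightarrow> real"
  chi1 :: "real \<Rightarrow> real"
  gcut :: "real \<Rightarrow> real"
  chi_hi :: "real \<Rightarrow> real"
  chi_lohi :: "real \<Rightarrow> real"

definition Gset :: "real \<Rightarrow> real \<Rightarrow> sharp_data \<Rightarrow> (real \<times> int) set" where
  "Gset M a D = {(\<omega>, m). - xi_l D * (of_int m)\<^sup>2 < of_int m * \<omega> \<and>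
     of_int m * \<omega> < of_int m * omega_plus M a m + xi_r D * (of_int m)\<^sup>2}"

definition Rsharp :: "real \<Rightarrow> real \<Rightarrow> sharp_data \<Rightarrow> real \<Rightarrow> int \<Rightarrow> real" where
  "Rsharp M a D \<omega> m =
     (if of_int m * \<omega> \<le> a * (of_int m)\<^sup>2 / ((r_hi D)\<^sup>2 + a\<^sup>2) then r_hi D
      else if a * (of_int m)\<^sup>2 / ((r_lo D)\<^sup>2 + a\<^sup>2) \<le> of_int m * \<omega> then r_lo D
      else (THE r. rplus M a < r \<and> \<omega> - omega_r a m r = 0))"

text \<open>Smoothness of \<open>R\<^sup>\<sharp>\<^sup>\<sharp>\<close> as a function of \<open>\<omega>/m\<close> is understood up to the end points of the
  interval of ratios cut out by \<open>Gset\<close>, i.e. it is the restriction of a smooth function on \<open>\<real>\<close>.\<close>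

definition sharp_data_ok :: "real \<Rightarrow> real \<Rightarrow> sharp_data \<Rightarrow> bool" where
  "sharp_data_ok M a D \<longleftrightarrow>
     xi_l D > 0 \<and> xi_r D > 0 \<and> delta D > 0 \<and>
     rplus M a < r_lo D \<and> r_lo D < r_hi D \<and> xi_l D = 1 / (8 * r_hi D) \<and>
     smooth_on UNIV (Rss D) \<and>
     (\<forall>(\<omega>, m)\<in>Gset M a D. Rsharp M a D \<omega> m \<le> Rss D (\<omega> / of_int m) \<and>
        Rss D (\<omega> / of_int m) < Rsharp M a D \<omega> m + delta D / 4) \<and>
     smooth_on UNIV (chi1 D) \<and>
     (\<forall>y. y \<le> - xi_l D \<or> a / ((rplus M a)\<^sup>2 + a\<^sup>2) + xi_r D \<le> y \<longrightarrow> chi1 D y = 1) \<and>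
     (\<forall>y. - (3/4) * xi_l D \<le> y \<and> y \<le> a / ((rplus M a)\<^sup>2 + a\<^sup>2) + (3/4) * xi_r D \<longrightarrow> chi1 D y = 0) \<and>
     smooth_on UNIV (gcut D) \<and> (\<forall>s. gcut D s \<ge> 0) \<and>
     (\<forall>s. delta D / 4 \<le> s \<and> s \<le> delta D / 2 \<longrightarrow> gcut D s = 1) \<and>
     (\<forall>s. s \<le> delta D / 8 \<or> (5/8) * delta D \<le> s \<longrightarrow> gcut D s = 0) \<and>
     smooth_on {rplus M a<..} (chi_hi D) \<and> smooth_on {rplus M a<..} (chi_lohi D) \<and>
     (\<forall>r>rplus M a. 0 \<le> chi_lohi D r \<and> chi_lohi D r \<le> chi_hi D r \<and>
        (r < r_hi D + (7/8) * delta D \<longrightarrow> chi_hi D r = 1) \<and>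
        (r > r_hi D + delta D \<longrightarrow> chi_hi D r = 0) \<and>
        (r_lo D + delta D / 8 \<le> r \<and> r \<le> r_hi D + (7/8) * delta D \<longrightarrow> chi_lohi D r = 1) \<and>
        (r < r_lo D \<or> r > r_hi D + delta D \<longrightarrow> chi_lohi D r = 0))"

definition chi1_tilde :: "sharp_data \<Rightarrow> real \<Rightarrow> int \<Rightarrow> real" where
  "chi1_tilde D \<omega> m = (if m = 0 then 1 else chi1 D (\<omega> / of_int m))"

text \<open>The product \<open>g\<^sub>\<sharp> (1 - \<chi>\<^sub>1)\<close>; the second factor vanishes outside \<open>Gset\<close>, so the values of
  \<open>Rss\<close> outside the interval of ratios cut out by \<open>Gset\<close> do not enter.\<close>

definition gsharp_cut :: "sharp_data \<Rightarrow> real \<Rightarrow> int \<Rightarrow> real \<Rightarrow> real" where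
  "gsharp_cut D \<omega> m r = gcut D (r - Rss D (\<omega> / of_int m)) * (1 - chi1_tilde D \<omega> m)"

definition X_T :: "sharp_data \<Rightarrow> freqfun \<Rightarrow> freqfun" where
  "X_T D f \<omega> m r \<theta> = - \<i> * of_real (gsharp_cut D \<omega> m r) * of_real \<omega> * f \<omega> m r \<theta>"

definition X_phi :: "sharp_data \<Rightarrow> freqfun \<Rightarrow> freqfun" where
  "X_phi D f \<omega> m r \<theta> = \<i> * of_real (gsharp_cut D \<omega> m r) * of_int m * f \<omega> m r \<theta>"

definition X_Wplus :: "real \<Rightarrow> real \<Rightarrow> sharp_data \<Rightarrow> freqfun \<Rightarrow> freqfun" where
  "X_Wplus M a D f \<omega> m r \<theta> = of_real (gsharp_cut D \<omega> m r) * Wplus M a f \<omega> m r \<theta>"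


section \<open>Norms and spaces\<close>

definition ennsqrt :: "ennreal \<Rightarrow> ennreal" where
  "ennsqrt x = (if x = \<infinity> then \<infinity> else ennreal (sqrt (enn2real x)))"

definition l1L1 :: "(real \<Rightarrow> int \<Rightarrow> complex) \<Rightarrow> ennreal" where
  "l1L1 f = (\<integral>\<^sup>+m. (\<integral>\<^sup>+\<omega>. ennreal (cmod (f \<omega> m)) \<partial>lborel) \<partial>count_space UNIV)"

definition l2L2 :: "(real \<Rightarrow> int \<Rightarrow> complex) \<Rightarrow> ennreal" where
  "l2L2 f = ennsqrt (\<integral>\<^sup>+m. (\<integral>\<^sup>+\<omega>. ennreal ((cmod (f \<omega> m))\<^sup>2) \<partial>lborel) \<partial>count_space UNIV)"

text \<open>As for \<open>Wzero\<close>, the norms take a function \<open>f\<close> together with its \<open>R\<^sup>\<star>\<close>-derivative \<open>F\<close>.\<close>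

definition normW ::
    "real \<Rightarrow> real \<Rightarrow> (real \<Rightarrow> real) \<Rightarrow> real \<Rightarrow> freqfun \<Rightarrow> freqfun \<Rightarrow> real \<Rightarrow> real \<Rightarrow> ennreal" where
  "normW M a h0 q f F r \<theta> =
     l1L1 (\<lambda>\<omega> m. of_real \<omega> * f \<omega> m r \<theta>) + l1L1 (\<lambda>\<omega> m. of_int m * f \<omega> m r \<theta>) +
     l1L1 (\<lambda>\<omega> m. of_real (vfun M a r powr (- q)) * Wzero M a h0 f F \<omega> m r \<theta>)"

definition normH ::
    "real \<Rightarrow> real \<Rightarrow> (real \<Rightarrow> real) \<Rightarrow> sharp_data \<Rightarrow> real \<Rightarrow> freqfun \<Rightarrow> freqfun \<Rightarrow> real \<Rightarrow> real \<Rightarrow> ennreal"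
  where
  "normH M a h0 D q f F r \<theta> =
     l2L2 (\<lambda>\<omega> m. of_real (vfun M a r powr q) * f \<omega> m r \<theta>) +
     l2L2 (\<lambda>\<omega> m. of_real (sqrt (chi_hi D r)) * Wzero M a h0 f F \<omega> m r \<theta> /
                   of_real (max (max \<bar>of_int m\<bar> \<bar>\<omega>\<bar>) 1))"

text \<open>Convergence of \<open>(hat (U n), R\<^sup>\<star> (hat (U n)))\<close> to \<open>(f, F)\<close> in a norm \<open>N\<close> that depends on
  \<open>(r, \<theta>)\<close>.\<close>

definition approximates ::
    "real \<Rightarrow> real \<Rightarrow> (freqfun \<Rightarrow> freqfun \<Rightarrow> real \<Rightarrow> real \<Rightarrow> ennreal) \<Rightarrow>
     (nat \<Rightarrow> real \<times> real \<times> real \<times> real \<Rightarrow> complex) \<Rightarrow> freqfun \<Rightarrow> freqfun \<Rightarrow> bool" where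
  "approximates M a N U f F \<longleftrightarrow> (\<forall>n. test_fun M a (U n)) \<and>
     (AE (r, \<theta>) in lborel. (r, \<theta>) \<in> rtheta M a \<longrightarrow>
        ((\<lambda>n. N (\<lambda>\<omega> m r \<theta>. hat (U n) \<omega> m r \<theta> - f \<omega> m r \<theta>)
                (\<lambda>\<omega> m r \<theta>. Rstar M a (hat (U n)) \<omega> m r \<theta> - F \<omega> m r \<theta>) r \<theta>) \<longlongrightarrow> 0) sequentially)"

text \<open>Since \<open>R\<^sup>\<star>\<close> enters the norms, an element of the closure is a limit \<open>f\<close> of transforms of test
  functions together with the limit \<open>F\<close> of their \<open>R\<^sup>\<star>\<close>-derivatives; \<open>F\<close> is \<open>R\<^sup>\<star> f\<close> for this
  element.  Convergence is required for almost every \<open>(r, \<theta>)\<close> only, so that limits in weighted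
  \<open>L\<^sup>p\<close> or uniform norms in \<open>(r, \<theta>)\<close> are included (along a subsequence).\<close>

definition closure_space ::
    "real \<Rightarrow> real \<Rightarrow> (freqfun \<Rightarrow> freqfun \<Rightarrow> real \<Rightarrow> real \<Rightarrow> ennreal) \<Rightarrow> (freqfun \<times> freqfun) set" where
  "closure_space M a N = {(f, F). freq_measurable M a f \<and> freq_measurable M a F \<and>
     (\<exists>U. approximates M a N U f F)}"

abbreviation spaceW where
  "spaceW M a h0 q \<equiv> closure_space M a (normW M a h0 q)"

abbreviation spaceH where
  "spaceH M a h0 D q \<equiv> closure_space M a (normH M a h0 D q)"


section \<open>The commutator\<close>

definition commutator :: "(freqfun \<Rightarrow> freqfun) \<Rightarrow> freqfun \<Rightarrow> freqfun \<Rightarrow> freqfun" where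
  "commutator X w u \<omega> m r \<theta> = X (conv w u) \<omega> m r \<theta> - conv w (X u) \<omega> m r \<theta>"

text \<open>The norm of \<open>w\<close> does not control \<open>w\<close> itself in \<open>L\<^sup>1\<close> near \<open>\<omega> = m = 0\<close>, so for general
  elements of the closures the integral defining \<open>conv w u\<close> may diverge, whereas the commutator
  still makes sense: it extends by continuity from transforms of test functions.  \<open>K\<close> is this
  extension if the commutators of any approximating sequences converge to it in
  \<open>\<ell>\<^sup>2\<^sub>m L\<^sup>2\<^sub>\<omega>\<close> at almost every \<open>(r, \<theta>)\<close>, which fixes \<open>K\<close> almost everywhere.  For transforms of
  test functions, constant sequences show that \<open>K\<close> is the commutator in the literal sense.\<close>

definition is_commutator ::
    "real \<Rightarrow> real \<Rightarrow> (real \<Rightarrow> real) \<Rightarrow> sharp_data \<Rightarrow> real \<Rightarrow> (freqfun \<Rightarrow> freqfun) \<Rightarrow>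
     freqfun \<times> freqfun \<Rightarrow> freqfun \<times> freqfun \<Rightarrow> freqfun \<Rightarrow> bool" where
  "is_commutator M a h0 D q X w u K \<longleftrightarrow> freq_measurable M a K \<and>
     (\<forall>V U. approximates M a (normW M a h0 q) V (fst w) (snd w) \<longrightarrow>
            approximates M a (normH M a h0 D q) U (fst u) (snd u) \<longrightarrow>
        (AE (r, \<theta>) in lborel. (r, \<theta>) \<in> rtheta M a \<longrightarrow>
           ((\<lambda>n. l2L2 (\<lambda>\<omega> m. commutator X (hat (V n)) (hat (U n)) \<omega> m r \<theta> - K \<omega> m r \<theta>))
              \<longlongrightarrow> 0) sequentially))"

end

theory Submission
  imports Defs
begin

text \<open>The multipliers \<open>g\<^sub>\<sharp> (1 - \<chi>\<^sub>1) \<omega>\<close> and \<open>g\<^sub>\<sharp> (1 - \<chi>\<^sub>1) m\<close> are homogeneous of degree one and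
  smooth in \<open>\<omega>/m\<close> with compact support, hence Lipschitz in \<open>(\<omega>, m)\<close> uniformly in \<open>r\<close>; the multiplier
  \<open>s = g\<^sub>\<sharp> (1 - \<chi>\<^sub>1)\<close> is homogeneous of degree zero, so its differences \<open>s(k) - s(k - k')\<close> gain
  \<open>\<bar>k'\<bar> / max(\<bar>m - m'\<bar>, \<bar>\<omega> - \<omega>'\<bar>, 1)\<close>.  Since \<open>W\<^sub>+\<close> obeys the product rule for convolutions, each
  commutator is a sum of convolutions with kernels of this kind, one factor \<open>\<bar>k'\<bar>\<close> or \<open>W\<^sub>+\<close> falling on
  \<open>w\<close>, and Young's inequality \<open>\<ell>\<^sup>1L\<^sup>1 * \<ell>\<^sup>2L\<^sup>2 \<subseteq> \<ell>\<^sup>2L\<^sup>2\<close> bounds it at each \<open>(r, \<theta>)\<close>.  On the support of the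
  kernels \<open>v\<close> is bounded above and below, so that \<open>W\<^sub>0\<close> and \<open>W\<^sub>+\<close> are interchangeable there.  The kernel
  formula makes sense almost everywhere on the closures, which gives the continuous extension explicitly.\<close>

section \<open>The symbols\<close>

text \<open>The norm of \<open>w\<close> controls \<open>\<omega> * w\<close> and
  \<open>m * w\<close> but not \<open>w\<close> itself at low frequency. Passing to the commutator
  cures this: the kernel is a difference of the symbol at \<open>k\<close> and \<open>k - k'\<close>
  and so supplies the missing factor of size \<open>freq_weight k'\<close>. For
  \<open>X_Wplus\<close> the differentiated function \<open>W_+ u\<close> is controlled in the norm
  of \<open>u\<close> only after division by the larger of \<open>|m|\<close>,
  \<open>|\<omega>|\<close> and 1, hence the gain demanded of the degree zero symbol. That symbol is
  homogeneous, so it is discontinuous at the origin and the gain with the entry 1 cannot come from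
  smoothness. It comes from \<open>m\<close> being an integer: the symbol vanishes for
  \<open>m = 0\<close>, so two different values involve a nonzero \<open>m\<close>, and then either
  the second \<open>m\<close> has size at least 1 or the two \<open>m\<close> differ by at least 1.
  The algebra (Fubini, product rule, splitting of integrals) is carried out for transforms of test
  functions, where every integral converges at every frequency. Only the resulting kernel formula,
  which is bilinear and bounded in the two norms, is then carried to the closures.\<close>

text \<open>The derivative is continuous, hence bounded on a compact interval. This local form
  serves \<open>Rss\<close>, which need not be constant for large arguments.\<close>

lemma smooth_on_real_Lipschitz_Icc:
  fixes f :: "real \<Rightarrow> real"
  assumes "smooth_on UNIV f"
  obtains L where "L \<ge> 0" "\<And>x y. x \<in> {a..b} \<Longrightarrow> y \<in> {a..b} \<Longrightarrow> \<bar>f x - f y\<bar> \<le> L * \<bar>x - y\<bar>"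
proof -
  define f' where "f' x = frechet_derivative f (at x) 1" for x
  have "Ck_on (Suc 0) UNIV f"
    using assms unfolding smooth_on_def by blast
  hence diff: "f differentiable (at x)" and "continuous_on UNIV f'" for x
    unfolding f'_def by auto
  hence "compact (f' ` {a..b})"
    by (intro compact_continuous_image) (auto intro: continuous_on_subset)
  then obtain L where L: "L > 0" "\<And>x. x \<in> {a..b} \<Longrightarrow> \<bar>f' x\<bar> \<le> L"
    using compact_imp_bounded bounded_pos by (metis imageI real_norm_def)
  have "(f has_real_derivative f' x) (at x)" for x
  proof -
    have "(f has_derivative frechet_derivative f (at x)) (at x)"
      using diff by (simp add: frechet_derivative_works)
    moreover have "frechet_derivative f (at x) = (*) (f' x)"
    proof
      fix h :: real
      have "linear (frechet_derivative f (at x))"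
        using diff by (rule linear_frechet_derivative)
      from linear_scale[OF this, of h 1] show "frechet_derivative f (at x) h = f' x * h"
        by (simp add: f'_def)
    qed
    ultimately show ?thesis
      by (simp add: has_field_derivative_def)
  qed
  hence "(f has_real_derivative f' x) (at x within {a..b})" for x
    by (rule has_field_derivative_at_within)
  hence "\<bar>f x - f y\<bar> \<le> L * \<bar>x - y\<bar>" if "x \<in> {a..b}" "y \<in> {a..b}" for x y
    using field_differentiable_bound[of "{a..b}" f f' L x y] L(2) that by simp
  with L show ?thesis by (intro that[of L]) auto
qed

text \<open>Clamping to \<open>{a..b}\<close> is 1-Lipschitz and \<open>f\<close> factors through
  it, since the end points already carry the value \<open>c\<close>; so the constant on the interval
  is a global one.\<close>

lemma smooth_on_real_Lipschitz_eventually_const: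
  fixes f :: "real \<Rightarrow> real"
  assumes "smooth_on UNIV f" and "a \<le> b" and "\<And>x. x \<le> a \<or> b \<le> x \<Longrightarrow> f x = c"
  obtains L B where "L \<ge> 0" "\<And>x y. \<bar>f x - f y\<bar> \<le> L * \<bar>x - y\<bar>"
    and "B \<ge> 0" "\<And>x. \<bar>f x\<bar> \<le> B"
proof -
  obtain L where L: "L \<ge> 0" "\<And>x y. x \<in> {a..b} \<Longrightarrow> y \<in> {a..b} \<Longrightarrow> \<bar>f x - f y\<bar> \<le> L * \<bar>x - y\<bar>"
    using smooth_on_real_Lipschitz_Icc[OF assms(1)] by blast
  define p where "p x = max a (min b x)" for x
  have p: "f x = f (p x)" "p x \<in> {a..b}" for x
    using assms(2) assms(3)[of x] assms(3)[of a] assms(3)[of b] by (auto simp: p_def max_def min_def)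
  have Lip: "\<bar>f x - f y\<bar> \<le> L * \<bar>x - y\<bar>" for x y
  proof -
    have "\<bar>f x - f y\<bar> \<le> L * \<bar>p x - p y\<bar>"
      using L(2)[OF p(2) p(2)] p(1) by metis
    also have "\<dots> \<le> L * \<bar>x - y\<bar>"
      by (intro mult_left_mono L(1)) (auto simp: p_def max_def min_def)
    finally show ?thesis .
  qed
  have "\<bar>f x\<bar> \<le> \<bar>c\<bar> + L * \<bar>b - a\<bar>" for x
  proof -
    have "\<bar>f x - f a\<bar> \<le> L * \<bar>p x - a\<bar>"
      using L(2)[OF p(2), of a] p(1) assms(2) by auto
    also have "\<dots> \<le> L * \<bar>b - a\<bar>"
      using p(2)[of x] by (intro mult_left_mono L(1)) auto
    finally show ?thesis using assms(3)[of a] by simp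
  qed
  with L(1) Lip show ?thesis
    by (intro that[of L "\<bar>c\<bar> + L * \<bar>b - a\<bar>"]) auto
qed

text \<open>Multiplying the difference of the ratios by \<open>m1\<close> cancels one denominator:
  \<open>m1 * (\<omega>1 / m1 - \<omega>2 / m2) = (\<omega>1 - \<omega>2) - (\<omega>2 / m2) * (m1 -
  m2)\<close>. What remains is linear in the increments as soon as one ratio is at most
  \<open>Y\<close>, and by symmetry either ratio will do. If both exceed \<open>Y\<close>, both
  symbols vanish.\<close>

lemma degree_one_symbol_Lipschitz:
  fixes \<phi> :: "real \<Rightarrow> real" and m1 m2 \<omega>1 \<omega>2 :: real
  assumes "\<And>y. \<bar>\<phi> y\<bar> \<le> B" and Lip: "\<And>x y. \<bar>\<phi> x - \<phi> y\<bar> \<le> L * \<bar>x - y\<bar>"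
    and supp: "\<And>y. \<bar>y\<bar> > Y \<Longrightarrow> \<phi> y = 0" and "L \<ge> 0" "Y \<ge> 0"
  shows "\<bar>m1 * \<phi> (\<omega>1 / m1) - m2 * \<phi> (\<omega>2 / m2)\<bar>
    \<le> (L * (1 + Y) + B) * (\<bar>\<omega>1 - \<omega>2\<bar> + \<bar>m1 - m2\<bar>)"
proof -
  have B: "B \<ge> 0" using assms(1)[of 0] by linarith
  have LY: "L * (1 + Y) \<ge> 0" using assms by simp
  have main: "\<bar>m1 * \<phi> (\<omega>1 / m1) - m2 * \<phi> (\<omega>2 / m2)\<bar>
      \<le> (L * (1 + Y) + B) * (\<bar>\<omega>1 - \<omega>2\<bar> + \<bar>m1 - m2\<bar>)"
    if "m1 \<noteq> 0" "m2 \<noteq> 0" "\<bar>\<omega>2 / m2\<bar> \<le> Y" for m1 m2 \<omega>1 \<omega>2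
  proof -
    have "m1 * \<phi> (\<omega>1 / m1) - m2 * \<phi> (\<omega>2 / m2) =
        m1 * (\<phi> (\<omega>1 / m1) - \<phi> (\<omega>2 / m2)) + (m1 - m2) * \<phi> (\<omega>2 / m2)"
      by (simp add: algebra_simps)
    hence "\<bar>m1 * \<phi> (\<omega>1 / m1) - m2 * \<phi> (\<omega>2 / m2)\<bar> \<le>
        \<bar>m1\<bar> * \<bar>\<phi> (\<omega>1 / m1) - \<phi> (\<omega>2 / m2)\<bar> + \<bar>m1 - m2\<bar> * \<bar>\<phi> (\<omega>2 / m2)\<bar>"
      by (metis abs_mult abs_triangle_ineq)
    also have "\<dots> \<le> \<bar>m1\<bar> * (L * \<bar>\<omega>1 / m1 - \<omega>2 / m2\<bar>) + \<bar>m1 - m2\<bar> * B"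
      by (intro add_mono mult_left_mono assms Lip) auto
    also have "\<bar>m1\<bar> * (L * \<bar>\<omega>1 / m1 - \<omega>2 / m2\<bar>) = L * \<bar>(\<omega>1 - \<omega>2) - (\<omega>2 / m2) * (m1 - m2)\<bar>"
    proof -
      have "m1 * (\<omega>1 / m1 - \<omega>2 / m2) = (\<omega>1 - \<omega>2) - (\<omega>2 / m2) * (m1 - m2)"
        using that by (simp add: field_simps)
      thus ?thesis by (metis abs_mult mult.left_commute)
    qed
    also have "\<bar>(\<omega>1 - \<omega>2) - (\<omega>2 / m2) * (m1 - m2)\<bar> \<le> \<bar>\<omega>1 - \<omega>2\<bar> + Y * \<bar>m1 - m2\<bar>"
      using mult_right_mono[OF that(3), of "\<bar>m1 - m2\<bar>"]
      by (metis (no_types, lifting) abs_ge_zero abs_mult abs_triangle_ineq4 add_left_mono order_trans)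
    also have "L * (\<bar>\<omega>1 - \<omega>2\<bar> + Y * \<bar>m1 - m2\<bar>) + \<bar>m1 - m2\<bar> * B
        \<le> (L * (1 + Y) + B) * (\<bar>\<omega>1 - \<omega>2\<bar> + \<bar>m1 - m2\<bar>)"
    proof -
      have "0 \<le> L * Y * \<bar>\<omega>1 - \<omega>2\<bar>" "0 \<le> L * \<bar>m1 - m2\<bar>" "0 \<le> B * \<bar>\<omega>1 - \<omega>2\<bar>"
        using assms B by auto
      thus ?thesis by (simp add: algebra_simps)
    qed
    finally show ?thesis using assms(4) by (simp add: mult_left_mono)
  qed
  \<comment> \<open>Covers a vanishing \<open>m1\<close> or \<open>m2\<close>: the factor in front
    kills that term whatever value division by 0 takes, and the other term is bounded by the
    increment in \<open>m\<close>.\<close>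
  have zero: "\<bar>m * \<phi> y\<bar> \<le> (L * (1 + Y) + B) * (w + \<bar>m\<bar>)" if "w \<ge> 0" for m y w
  proof -
    have "\<bar>m * \<phi> y\<bar> \<le> B * \<bar>m\<bar>"
      using mult_right_mono[OF assms(1)[of y], of "\<bar>m\<bar>"] by (simp add: abs_mult mult.commute)
    also have "\<dots> \<le> (L * (1 + Y) + B) * (w + \<bar>m\<bar>)"
      using LY B that by (intro mult_mono) auto
    finally show ?thesis .
  qed
  consider "m1 = 0" | "m2 = 0" | "m1 \<noteq> 0" "m2 \<noteq> 0" "\<bar>\<omega>2 / m2\<bar> \<le> Y"
    | "m1 \<noteq> 0" "m2 \<noteq> 0" "\<bar>\<omega>1 / m1\<bar> \<le> Y"
    | "\<bar>\<omega>2 / m2\<bar> > Y" "\<bar>\<omega>1 / m1\<bar> > Y" by linarith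
  then show ?thesis
  proof cases
    case 1 thus ?thesis using zero[of "\<bar>\<omega>1 - \<omega>2\<bar>" m2 "\<omega>2 / m2"] by simp
  next
    case 2 thus ?thesis using zero[of "\<bar>\<omega>1 - \<omega>2\<bar>" m1 "\<omega>1 / m1"] by simp
  next
    case 3 thus ?thesis using main by blast
  next
    case 4 thus ?thesis using main[of m2 m1 \<omega>1 \<omega>2] by (simp add: abs_minus_commute)
  next
    case 5 thus ?thesis using supp LY B by simp
  qed
qed

section \<open>The symbol as a function of the ratio of the frequencies\<close>

definition sharp_profile :: "sharp_data \<Rightarrow> real \<Rightarrow> real \<Rightarrow> real" where
  "sharp_profile D r y = gcut D (r - Rss D y) * (1 - chi1 D y)"

lemma gsharp_cut_eq:
  "gsharp_cut D \<omega> m r = (if m = 0 then 0 else sharp_profile D r (\<omega> / of_int m))"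
  by (simp add: gsharp_cut_def chi1_tilde_def sharp_profile_def)

locale sharp_setting =
  fixes M a :: real and h0 :: "real \<Rightarrow> real" and D :: sharp_data
  assumes a_pos: "0 < a" and a_less_M: "a < M"
    and h0: "is_h0 M a h0" and ok: "sharp_data_ok M a D"
begin

lemma rplus_pos: "0 < rplus M a"
proof -
  have "a\<^sup>2 \<le> M\<^sup>2" using a_pos a_less_M by (intro power_mono) auto
  thus ?thesis using a_pos a_less_M unfolding rplus_def
    by (metis add_pos_nonneg diff_ge_0_iff_ge order.strict_trans real_sqrt_ge_zero)
qed

text \<open>\<open>y_lo\<close> and \<open>y_hi\<close> are the end points of the interval of ratios
  \<open>\<omega> / m\<close> cut out by \<open>Gset\<close>; from them outwards \<open>chi1\<close>
  equals 1.\<close>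

definition "y_lo = - xi_l D"
definition "y_hi = a / ((rplus M a)\<^sup>2 + a\<^sup>2) + xi_r D"
definition "y_bd = \<bar>y_lo\<bar> + \<bar>y_hi\<bar>"

lemma y_lo_less_y_hi: "y_lo < y_hi"
  using ok a_pos unfolding sharp_data_ok_def y_lo_def y_hi_def
  by (smt (verit) divide_nonneg_nonneg zero_le_power2)

lemma chi1_eq_1: "y \<le> y_lo \<or> y_hi \<le> y \<Longrightarrow> chi1 D y = 1"
  using ok unfolding sharp_data_ok_def y_lo_def y_hi_def by blast

lemma sharp_profile_eq_0: "\<bar>y\<bar> > y_bd \<Longrightarrow> sharp_profile D r y = 0"
proof -
  assume "\<bar>y\<bar> > y_bd"
  hence "y \<le> y_lo \<or> y_hi \<le> y" using y_lo_less_y_hi unfolding y_bd_def by linarith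
  thus ?thesis by (simp add: sharp_profile_def chi1_eq_1)
qed

text \<open>The radius enters only as a translation of the argument of \<open>gcut\<close>, so the
  bounds of \<open>gcut\<close> are uniform in \<open>r\<close>. The one factor without a global
  Lipschitz bound is \<open>Rss\<close>, and it matters only for ratios in
  \<open>{y_lo..y_hi}\<close>.\<close>

lemma sharp_profile_bounds:
  obtains B L where "B \<ge> 0" "L \<ge> 0" "\<And>r y. \<bar>sharp_profile D r y\<bar> \<le> B"
    "\<And>r x y. \<bar>sharp_profile D r x - sharp_profile D r y\<bar> \<le> L * \<bar>x - y\<bar>"
proof -
  have "smooth_on UNIV (gcut D)" "delta D / 8 \<le> (5/8) * delta D"
    "\<And>s. s \<le> delta D / 8 \<or> (5/8) * delta D \<le> s \<Longrightarrow> gcut D s = 0"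
    using ok by (auto simp: sharp_data_ok_def)
  from smooth_on_real_Lipschitz_eventually_const[OF this] obtain Lg Bg where
    g: "Lg \<ge> 0" "\<And>x y. \<bar>gcut D x - gcut D y\<bar> \<le> Lg * \<bar>x - y\<bar>" "Bg \<ge> 0" "\<And>x. \<bar>gcut D x\<bar> \<le> Bg"
    by blast
  have "smooth_on UNIV (chi1 D)" using ok by (auto simp: sharp_data_ok_def)
  from smooth_on_real_Lipschitz_eventually_const[OF this _ chi1_eq_1] obtain Lc Bc where
    c: "Lc \<ge> 0" "\<And>x y. \<bar>chi1 D x - chi1 D y\<bar> \<le> Lc * \<bar>x - y\<bar>" "Bc \<ge> 0" "\<And>x. \<bar>chi1 D x\<bar> \<le> Bc"
    using y_lo_less_y_hi by (metis less_imp_le)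
  have "smooth_on UNIV (Rss D)" using ok by (auto simp: sharp_data_ok_def)
  from smooth_on_real_Lipschitz_Icc[OF this] obtain LR where
    R: "LR \<ge> 0" "\<And>x y. x \<in> {y_lo..y_hi} \<Longrightarrow> y \<in> {y_lo..y_hi} \<Longrightarrow>
      \<bar>Rss D x - Rss D y\<bar> \<le> LR * \<bar>x - y\<bar>" by blast
  define L where "L = Lg * LR * (1 + Bc) + Bg * Lc"
  have L: "L \<ge> 0" unfolding L_def using g c R by auto
  have c1: "\<bar>1 - chi1 D y\<bar> \<le> 1 + Bc" for y using c(4)[of y] by linarith
  have bound: "\<bar>sharp_profile D r y\<bar> \<le> Bg * (1 + Bc)" for r y
    unfolding sharp_profile_def abs_mult by (intro mult_mono g c1) auto
  \<comment> \<open>If one ratio lies outside the interval, the profile vanishes there and the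
    difference is a value of \<open>gcut\<close> times a difference of values of
    \<open>chi1\<close>; \<open>Rss\<close> is not compared at the two points.\<close>
  have out: "\<bar>sharp_profile D r x - sharp_profile D r y\<bar> \<le> L * \<bar>x - y\<bar>"
    if "y \<notin> {y_lo..y_hi}" for r x y
  proof -
    have y: "chi1 D y = 1" using that by (intro chi1_eq_1) auto
    hence "\<bar>sharp_profile D r x - sharp_profile D r y\<bar> =
        \<bar>gcut D (r - Rss D x)\<bar> * \<bar>chi1 D x - chi1 D y\<bar>"
      by (simp add: sharp_profile_def abs_mult abs_minus_commute)
    also have "\<dots> \<le> Bg * (Lc * \<bar>x - y\<bar>)" by (intro mult_mono g c) auto
    also have "\<dots> \<le> L * \<bar>x - y\<bar>" unfolding L_def using g c R by (simp add: distrib_right)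
    finally show ?thesis .
  qed
  have "\<bar>sharp_profile D r x - sharp_profile D r y\<bar> \<le> L * \<bar>x - y\<bar>" for r x y
  proof (cases "x \<in> {y_lo..y_hi} \<and> y \<in> {y_lo..y_hi}")
    case True
    let ?g = "\<lambda>y. gcut D (r - Rss D y)"
    have "sharp_profile D r x - sharp_profile D r y =
        (?g x - ?g y) * (1 - chi1 D x) - ?g y * (chi1 D x - chi1 D y)"
      by (simp add: sharp_profile_def algebra_simps)
    hence "\<bar>sharp_profile D r x - sharp_profile D r y\<bar> \<le>
        \<bar>?g x - ?g y\<bar> * \<bar>1 - chi1 D x\<bar> + \<bar>?g y\<bar> * \<bar>chi1 D x - chi1 D y\<bar>"
      by (metis abs_mult abs_triangle_ineq4)
    also have "\<dots> \<le> (Lg * (LR * \<bar>x - y\<bar>)) * (1 + Bc) + Bg * (Lc * \<bar>x - y\<bar>)"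
    proof (intro add_mono mult_mono c1 g c)
      have "\<bar>?g x - ?g y\<bar> \<le> Lg * \<bar>Rss D x - Rss D y\<bar>"
        using g(2)[of "r - Rss D x" "r - Rss D y"] by (simp add: abs_minus_commute)
      also have "\<dots> \<le> Lg * (LR * \<bar>x - y\<bar>)" using True by (intro mult_left_mono R g) auto
      finally show "\<bar>?g x - ?g y\<bar> \<le> Lg * (LR * \<bar>x - y\<bar>)" .
    qed (use g c R in auto)
    also have "\<dots> = L * \<bar>x - y\<bar>" by (simp add: L_def algebra_simps)
    finally show ?thesis .
  next
    case False
    thus ?thesis using out[of y r x] out[of x r y] by (auto simp: abs_minus_commute)
  qed
  moreover have "Bg * (1 + Bc) \<ge> 0" using g c by simp
  ultimately show ?thesis using bound L that by blast
qed

text \<open>The gain for the degree zero symbol follows from the two degree one bounds: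
  \<open>(g1 - g2) * m2 = (g1 * m1 - g2 * m2) + g1 * (m2 - m1)\<close>, and likewise with
  \<open>\<omega>\<close>. So no differentiation of the symbol in two variables is involved.\<close>

lemma gsharp_symbol_bounds:
  obtains C where "C \<ge> 0"
    "\<And>\<omega> m r. \<bar>gsharp_cut D \<omega> m r\<bar> \<le> C"
    "\<And>\<omega>1 \<omega>2 m1 m2 r. \<bar>gsharp_cut D \<omega>1 m1 r * \<omega>1 - gsharp_cut D \<omega>2 m2 r * \<omega>2\<bar>
       \<le> C * (\<bar>\<omega>1 - \<omega>2\<bar> + \<bar>real_of_int m1 - real_of_int m2\<bar>)"
    "\<And>\<omega>1 \<omega>2 m1 m2 r. \<bar>gsharp_cut D \<omega>1 m1 r * of_int m1 - gsharp_cut D \<omega>2 m2 r * of_int m2\<bar>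
       \<le> C * (\<bar>\<omega>1 - \<omega>2\<bar> + \<bar>real_of_int m1 - real_of_int m2\<bar>)"
    "\<And>\<omega>1 \<omega>2 m1 m2 r. \<bar>gsharp_cut D \<omega>1 m1 r - gsharp_cut D \<omega>2 m2 r\<bar> *
          max (max \<bar>of_int m2\<bar> \<bar>\<omega>2\<bar>) 1
       \<le> C * (\<bar>\<omega>1 - \<omega>2\<bar> + \<bar>real_of_int m1 - real_of_int m2\<bar>)"
proof -
  obtain B L where BL: "B \<ge> 0" "L \<ge> 0" "\<And>r y. \<bar>sharp_profile D r y\<bar> \<le> B"
    "\<And>r x y. \<bar>sharp_profile D r x - sharp_profile D r y\<bar> \<le> L * \<bar>x - y\<bar>"
    by (rule sharp_profile_bounds) blast
  have Y: "y_bd \<ge> 0" by (simp add: y_bd_def)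
  define g where "g = gsharp_cut D"
  define C1 where "C1 = L * (1 + y_bd) + B"
  define L2 where "L2 = y_bd * L + B"
  define C2 where "C2 = L2 * (1 + y_bd) + y_bd * B"
  let ?d = "\<lambda>\<omega>1 \<omega>2 m1 m2. \<bar>\<omega>1 - \<omega>2\<bar> + \<bar>real_of_int m1 - real_of_int m2\<bar>"
  have C: "C1 \<ge> 0" "C2 \<ge> 0" "L2 \<ge> 0" using BL Y by (auto simp: C1_def C2_def L2_def)
  have supp: "sharp_profile D r y = 0" if "y_bd < \<bar>y\<bar>" for r y
    using sharp_profile_eq_0 that by blast
  have gB: "\<bar>g \<omega> m r\<bar> \<le> B" for \<omega> m r
    using BL by (simp add: g_def gsharp_cut_eq)
  have gm: "g \<omega> m r * of_int m = of_int m * sharp_profile D r (\<omega> / of_int m)" for \<omega> m r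
    by (simp add: g_def gsharp_cut_eq)
  have m: "\<bar>g \<omega>1 m1 r * of_int m1 - g \<omega>2 m2 r * of_int m2\<bar> \<le> C1 * ?d \<omega>1 \<omega>2 m1 m2" for \<omega>1 \<omega>2 m1 m2 r
    unfolding gm C1_def by (rule degree_one_symbol_Lipschitz) (use BL Y supp in auto)
  \<comment> \<open>Multiplication by \<open>\<omega>\<close> is again \<open>m\<close> times a
    function of the ratio, now with the profile \<open>y * sharp_profile D r y\<close>, which is
    bounded and Lipschitz because the ratio is at most \<open>y_bd\<close> on the support.\<close>
  have g\<omega>: "g \<omega> m r * \<omega> = of_int m * (\<lambda>y. y * sharp_profile D r y) (\<omega> / of_int m)" for \<omega> m r
    by (simp add: g_def gsharp_cut_eq)
  have yB: "\<bar>y * sharp_profile D r y\<bar> \<le> y_bd * B" for r y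
  proof (cases "\<bar>y\<bar> > y_bd")
    case False
    thus ?thesis unfolding abs_mult by (intro mult_mono BL Y) auto
  qed (use supp BL Y in auto)
  have yL1: "\<bar>x * sharp_profile D r x - y * sharp_profile D r y\<bar> \<le> L2 * \<bar>x - y\<bar>"
    if "\<bar>x\<bar> \<le> y_bd" for r x y
  proof -
    have "x * sharp_profile D r x - y * sharp_profile D r y =
       x * (sharp_profile D r x - sharp_profile D r y) + (x - y) * sharp_profile D r y"
      by (simp add: algebra_simps)
    hence "\<bar>x * sharp_profile D r x - y * sharp_profile D r y\<bar> \<le>
       \<bar>x\<bar> * \<bar>sharp_profile D r x - sharp_profile D r y\<bar> + \<bar>x - y\<bar> * \<bar>sharp_profile D r y\<bar>"
      by (metis abs_mult abs_triangle_ineq)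
    also have "\<dots> \<le> y_bd * (L * \<bar>x - y\<bar>) + \<bar>x - y\<bar> * B"
      by (intro add_mono mult_mono BL that Y) auto
    finally show ?thesis by (simp add: L2_def algebra_simps)
  qed
  have yL: "\<bar>x * sharp_profile D r x - y * sharp_profile D r y\<bar> \<le> L2 * \<bar>x - y\<bar>" for r x y
  proof -
    consider "\<bar>x\<bar> \<le> y_bd" | "\<bar>y\<bar> \<le> y_bd" | "\<bar>x\<bar> > y_bd" "\<bar>y\<bar> > y_bd" by linarith
    thus ?thesis
    proof cases
      case 2 thus ?thesis using yL1[of y r x] by (simp add: abs_minus_commute)
    next
      case 3 thus ?thesis using supp C by simp
    qed (use yL1 in auto)
  qed
  have \<omega>: "\<bar>g \<omega>1 m1 r * \<omega>1 - g \<omega>2 m2 r * \<omega>2\<bar> \<le> C2 * ?d \<omega>1 \<omega>2 m1 m2" for \<omega>1 \<omega>2 m1 m2 r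
    unfolding g\<omega> C2_def by (rule degree_one_symbol_Lipschitz) (use yB yL supp C Y in auto)
  have M: "\<bar>g \<omega>1 m1 r - g \<omega>2 m2 r\<bar> * max (max \<bar>of_int m2\<bar> \<bar>\<omega>2\<bar>) 1 \<le> (C1 + C2 + B) * ?d \<omega>1 \<omega>2 m1 m2"
    for \<omega>1 \<omega>2 m1 m2 r
  proof -
    let ?g = "\<bar>g \<omega>1 m1 r - g \<omega>2 m2 r\<bar>"
    have d: "?d \<omega>1 \<omega>2 m1 m2 \<ge> 0" by simp
    have weak: "x \<le> (C1 + C2 + B) * ?d \<omega>1 \<omega>2 m1 m2"
      if "x \<le> C1 * ?d \<omega>1 \<omega>2 m1 m2 + B * ?d \<omega>1 \<omega>2 m1 m2 \<or> x \<le> C2 * ?d \<omega>1 \<omega>2 m1 m2 + B * ?d \<omega>1 \<omega>2 m1 m2" for x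
      using that mult_nonneg_nonneg[OF C(1) d] mult_nonneg_nonneg[OF C(2) d]
      by (auto simp: distrib_right simp del: mult_nonneg_nonneg)
    have 1: "?g * \<bar>of_int m2\<bar> \<le> C1 * ?d \<omega>1 \<omega>2 m1 m2 + B * ?d \<omega>1 \<omega>2 m1 m2"
    proof -
      have "(g \<omega>1 m1 r - g \<omega>2 m2 r) * of_int m2 =
         (g \<omega>1 m1 r * of_int m1 - g \<omega>2 m2 r * of_int m2) + g \<omega>1 m1 r * (of_int m2 - of_int m1)"
        by (simp add: algebra_simps)
      hence "?g * \<bar>of_int m2\<bar> \<le> \<bar>g \<omega>1 m1 r * of_int m1 - g \<omega>2 m2 r * of_int m2\<bar> + \<bar>g \<omega>1 m1 r\<bar> * \<bar>of_int m2 - of_int m1\<bar>"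
        by (metis abs_mult abs_triangle_ineq)
      also have "\<dots> \<le> C1 * ?d \<omega>1 \<omega>2 m1 m2 + B * ?d \<omega>1 \<omega>2 m1 m2"
        by (intro add_mono m mult_mono gB BL) auto
      finally show ?thesis .
    qed
    have 2: "?g * \<bar>\<omega>2\<bar> \<le> C2 * ?d \<omega>1 \<omega>2 m1 m2 + B * ?d \<omega>1 \<omega>2 m1 m2"
    proof -
      have "(g \<omega>1 m1 r - g \<omega>2 m2 r) * \<omega>2 =
         (g \<omega>1 m1 r * \<omega>1 - g \<omega>2 m2 r * \<omega>2) + g \<omega>1 m1 r * (\<omega>2 - \<omega>1)"
        by (simp add: algebra_simps)
      hence "?g * \<bar>\<omega>2\<bar> \<le> \<bar>g \<omega>1 m1 r * \<omega>1 - g \<omega>2 m2 r * \<omega>2\<bar> + \<bar>g \<omega>1 m1 r\<bar> * \<bar>\<omega>2 - \<omega>1\<bar>"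
        by (metis abs_mult abs_triangle_ineq)
      also have "\<dots> \<le> C2 * ?d \<omega>1 \<omega>2 m1 m2 + B * ?d \<omega>1 \<omega>2 m1 m2"
        by (intro add_mono \<omega> mult_mono gB BL) auto
      finally show ?thesis .
    qed
    \<comment> \<open>The entry 1 of the maximum uses that \<open>m\<close> is an integer. For
      \<open>m2\<close> nonzero, 1 is at most the size of \<open>m2\<close>. For
      \<open>m2 = 0\<close> the second symbol vanishes, and either the first one does too or the two
      \<open>m\<close> differ by at least 1.\<close>
    have 3: "?g * 1 \<le> C1 * ?d \<omega>1 \<omega>2 m1 m2 + B * ?d \<omega>1 \<omega>2 m1 m2"
    proof (cases "m2 = 0")
      case False
      hence "1 \<le> \<bar>real_of_int m2\<bar>" by linarith
      hence "?g * 1 \<le> ?g * \<bar>of_int m2\<bar>" by (intro mult_left_mono) auto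
      with 1 show ?thesis by linarith
    next
      case m2: True
      show ?thesis
      proof (cases "m1 = 0")
        case False
        hence "1 \<le> ?d \<omega>1 \<omega>2 m1 m2" using m2 by linarith
        moreover have "?g \<le> B" using gB m2 by (simp add: g_def gsharp_cut_eq[of D \<omega>2])
        ultimately show ?thesis
          using mult_mono[of ?g B 1 "?d \<omega>1 \<omega>2 m1 m2"] BL mult_nonneg_nonneg[OF C(1) d] by linarith
      qed (use m2 BL C in \<open>auto simp: g_def gsharp_cut_eq\<close>)
    qed
    let ?w = "max (max \<bar>real_of_int m2\<bar> \<bar>\<omega>2\<bar>) 1"
    consider "?w = \<bar>of_int m2\<bar>" | "?w = \<bar>\<omega>2\<bar>" | "?w = 1"
      by linarith
    thus ?thesis
    proof cases
      case a: 1 show ?thesis unfolding a by (rule weak[OF disjI1[OF 1]])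
    next
      case a: 2 show ?thesis unfolding a by (rule weak[OF disjI2[OF 2]])
    next
      case a: 3 show ?thesis unfolding a by (rule weak[OF disjI1[OF 3]])
    qed
  qed
  show ?thesis
  proof (rule that[of "C1 + C2 + B"], unfold g_def[symmetric])
    show "0 \<le> C1 + C2 + B" using C BL by simp
    show "\<bar>g \<omega> m r\<bar> \<le> C1 + C2 + B" for \<omega> m r using gB[of \<omega> m r] C by linarith
    fix \<omega>1 \<omega>2 :: real and m1 m2 :: int and r :: real
    have d: "?d \<omega>1 \<omega>2 m1 m2 \<ge> 0" by simp
    have "C1 * ?d \<omega>1 \<omega>2 m1 m2 \<le> (C1 + C2 + B) * ?d \<omega>1 \<omega>2 m1 m2"
      "C2 * ?d \<omega>1 \<omega>2 m1 m2 \<le> (C1 + C2 + B) * ?d \<omega>1 \<omega>2 m1 m2"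
      by (rule mult_right_mono[OF _ d], use C BL in simp)+
    thus "\<bar>g \<omega>1 m1 r * of_int m1 - g \<omega>2 m2 r * of_int m2\<bar> \<le> (C1 + C2 + B) * ?d \<omega>1 \<omega>2 m1 m2"
      "\<bar>g \<omega>1 m1 r * \<omega>1 - g \<omega>2 m2 r * \<omega>2\<bar> \<le> (C1 + C2 + B) * ?d \<omega>1 \<omega>2 m1 m2"
      using m[of \<omega>1 m1 r \<omega>2 m2] \<omega>[of \<omega>1 m1 r \<omega>2 m2] by linarith+
  qed (use M in auto)
qed

text \<open>In the intermediate range the radius is the positive root of
  \<open>s\<^sup>2 + a\<^sup>2 = a * m / \<omega>\<close>. The failure of the two outer cases says
  exactly that this quantity lies between the values of \<open>s\<^sup>2 + a\<^sup>2\<close> at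
  \<open>r_lo\<close> and \<open>r_hi\<close>.\<close>

lemma Rsharp_bounds:
  assumes "m \<noteq> 0"
  shows "r_lo D \<le> Rsharp M a D \<omega> m" "Rsharp M a D \<omega> m \<le> r_hi D"
proof -
  have r: "rplus M a < r_lo D" "r_lo D < r_hi D" using ok by (auto simp: sharp_data_ok_def)
  have m2: "real_of_int m * real_of_int m > 0" using assms by (metis not_real_square_gt_zero of_int_0_eq_iff)
  define P where "P s = (rplus M a < s \<and> \<omega> - omega_r a m s = 0)" for s
  have "r_lo D \<le> Rsharp M a D \<omega> m \<and> Rsharp M a D \<omega> m \<le> r_hi D"
  proof (cases "of_int m * \<omega> \<le> a * (of_int m)\<^sup>2 / ((r_hi D)\<^sup>2 + a\<^sup>2) \<or>
      a * (of_int m)\<^sup>2 / ((r_lo D)\<^sup>2 + a\<^sup>2) \<le> of_int m * \<omega>")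
    case True
    thus ?thesis using r unfolding Rsharp_def by auto
  next
    case False
    hence lt: "a * (of_int m)\<^sup>2 / ((r_hi D)\<^sup>2 + a\<^sup>2) < of_int m * \<omega>"
      "of_int m * \<omega> < a * (of_int m)\<^sup>2 / ((r_lo D)\<^sup>2 + a\<^sup>2)" by auto
    have pos: "s\<^sup>2 + a\<^sup>2 > 0" for s using a_pos by (simp add: add_nonneg_pos)
    define c where "c = a * of_int m / \<omega>"
    have \<omega>0: "of_int m * \<omega> > 0"
      using lt(1) a_pos pos by (smt (verit) divide_nonneg_pos mult_nonneg_nonneg zero_le_power2)
    have \<omega>n: "\<omega> \<noteq> 0" using \<omega>0 by auto
    have c: "a * (of_int m)\<^sup>2 = c * (of_int m * \<omega>)"
      using \<omega>n by (simp add: c_def power2_eq_square)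
    have c1: "(r_lo D)\<^sup>2 + a\<^sup>2 < c" "c < (r_hi D)\<^sup>2 + a\<^sup>2"
      using lt \<omega>0 pos[of "r_lo D"] pos[of "r_hi D"] unfolding c
      by (simp_all add: pos_divide_less_eq pos_less_divide_eq mult.commute[of _ "of_int m * \<omega>"]
          mult_less_cancel_left_pos del: mult.assoc)
    have P_iff: "P s \<longleftrightarrow> rplus M a < s \<and> s\<^sup>2 + a\<^sup>2 = c" for s
    proof -
      have "\<omega> - omega_r a m s = 0 \<longleftrightarrow> \<omega> * (s\<^sup>2 + a\<^sup>2) = a * of_int m"
        using pos[of s] by (simp add: omega_r_def eq_divide_eq a_pos[THEN less_imp_neq, symmetric])
      also have "\<dots> \<longleftrightarrow> s\<^sup>2 + a\<^sup>2 = c"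
        using \<omega>n by (simp add: c_def eq_divide_eq mult.commute)
      finally show ?thesis by (simp add: P_def)
    qed
    define s where "s = sqrt (c - a\<^sup>2)"
    have "(r_lo D)\<^sup>2 \<ge> 0" by simp
    hence "c - a\<^sup>2 \<ge> 0" using c1(1) by linarith
    hence s2: "s\<^sup>2 = c - a\<^sup>2" and s0: "s \<ge> 0" unfolding s_def by auto
    have "r_lo D < s" "s < r_hi D"
      using c1 s2 s0 rplus_pos r by (auto intro: power_less_imp_less_base[of _ 2])
    moreover have "(THE r. P r) = s"
    proof (rule the_equality)
      show "P s" unfolding P_iff using s2 \<open>r_lo D < s\<close> r by auto
      show "t = s" if "P t" for t
        using that s0 s2 rplus_pos unfolding P_iff
        by (intro power2_eq_imp_eq[of t s]) auto
    qed
    ultimately show ?thesis using False unfolding Rsharp_def P_def[symmetric] by auto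
  qed
  thus "r_lo D \<le> Rsharp M a D \<omega> m" "Rsharp M a D \<omega> m \<le> r_hi D" by auto
qed

text \<open>The support of \<open>gcut\<close> allows \<open>r - Rss\<close> between
  \<open>delta / 8\<close> and \<open>5/8 * delta\<close>, while \<open>Rss\<close> exceeds
  \<open>Rsharp\<close> by at most \<open>delta / 4\<close>; \<open>5/8 + 1/4\<close> gives the
  \<open>7/8\<close> at the upper end. On this interval \<open>chi_lohi\<close> is 1.\<close>

definition "r_supp = {r_lo D + delta D / 8 .. r_hi D + (7/8) * delta D}"

lemma gsharp_cut_support:
  assumes "r \<notin> r_supp"
  shows "gsharp_cut D \<omega> m r = 0"
proof (rule ccontr)
  assume nz: "gsharp_cut D \<omega> m r \<noteq> 0"
  hence m: "m \<noteq> 0" by (auto simp: gsharp_cut_eq)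
  define y where "y = \<omega> / of_int m"
  have "chi1 D y \<noteq> 1" and g: "gcut D (r - Rss D y) \<noteq> 0"
    using nz m by (auto simp: gsharp_cut_eq sharp_profile_def y_def)
  hence y: "y_lo < y" "y < y_hi" using chi1_eq_1[of y] by (auto simp: not_le[symmetric])
  have my: "of_int m * \<omega> = (of_int m)\<^sup>2 * y" using m by (simp add: y_def power2_eq_square)
  have m2: "(real_of_int m)\<^sup>2 > 0" using m by simp
  \<comment> \<open>Membership in \<open>Gset\<close> is what ties \<open>Rss\<close> to
    \<open>Rsharp\<close>; it follows from \<open>chi1\<close> not being 1 at the ratio.\<close>
  have "(\<omega>, m) \<in> Gset M a D"
    using mult_strict_left_mono[OF y(1) m2] mult_strict_left_mono[OF y(2) m2]
    unfolding Gset_def omega_plus_def omega_r_def y_lo_def y_hi_def mem_Collect_eq prod.case my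
    by (simp add: power2_eq_square algebra_simps)
  hence "Rsharp M a D \<omega> m \<le> Rss D y" "Rss D y < Rsharp M a D \<omega> m + delta D / 4"
    using ok unfolding sharp_data_ok_def y_def by auto
  moreover have "delta D / 8 < r - Rss D y" "r - Rss D y < (5/8) * delta D"
    using ok g unfolding sharp_data_ok_def by (meson linorder_not_le)+
  ultimately have "r \<in> r_supp" using Rsharp_bounds[OF m, of \<omega>] unfolding r_supp_def by auto
  with assms show False by blast
qed

end

section \<open>Convolutions on frequency space\<close>

text \<open>The frequencies form one measure space, so that sum and integral become a single
  integral over the group of pairs \<open>(m, \<omega>)\<close>. The discrete variable comes first,
  which reduces measurability to each fixed \<open>m\<close>.\<close>

definition freq_space :: "(int \<times> real) measure" where
  "freq_space = count_space UNIV \<Otimes>\<^sub>M lborel"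

lemma space_freq_space [simp]: "space freq_space = UNIV"
  by (simp add: freq_space_def space_pair_measure)

lemma measurable_int_diff [measurable (raw)]:
  fixes f g :: "'a \<Rightarrow> int"
  assumes [measurable]: "f \<in> measurable N (count_space UNIV)" "g \<in> measurable N (count_space UNIV)"
  shows "(\<lambda>x. f x - g x) \<in> measurable N (count_space UNIV)"
  by (rule measurable_compose_countable[OF _ assms(1)],
      rule measurable_compose_countable[OF _ assms(2)]) simp

lemma measurable_freq_space_fst [measurable]: "fst \<in> measurable freq_space (count_space UNIV)"
  and measurable_freq_space_snd [measurable]: "snd \<in> measurable freq_space borel"
  by (auto simp: freq_space_def measurable_lborel2[symmetric] simp del: measurable_lborel2)

lemma measurable_freq_space_iff:
  "f \<in> borel_measurable freq_space \<longleftrightarrow> (\<forall>m. (\<lambda>\<omega>. f (m, \<omega>)) \<in> borel_measurable borel)"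
proof
  assume [measurable]: "f \<in> borel_measurable freq_space"
  have [measurable]: "Pair m \<in> measurable borel freq_space" for m
    unfolding freq_space_def by measurable
  show "\<forall>m. (\<lambda>\<omega>. f (m, \<omega>)) \<in> borel_measurable borel" by measurable
next
  assume "\<forall>m. (\<lambda>\<omega>. f (m, \<omega>)) \<in> borel_measurable borel"
  thus "f \<in> borel_measurable freq_space"
    unfolding freq_space_def by (intro measurable_pair_measure_countable1) auto
qed

lemma measurable_freq_diff [measurable (raw)]:
  assumes [measurable]: "f \<in> measurable N freq_space" "g \<in> measurable N freq_space"
  shows "(\<lambda>x. f x - g x) \<in> measurable N freq_space"
proof -
  have "(\<lambda>x. (fst (f x) - fst (g x), snd (f x) - snd (g x))) \<in>
      measurable N (count_space UNIV \<Otimes>\<^sub>M lborel)"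
    by measurable
  thus ?thesis by (simp add: freq_space_def minus_prod_def)
qed

interpretation freq: pair_sigma_finite "count_space (UNIV :: int set)" "lborel :: real measure"
  by (intro pair_sigma_finite.intro sigma_finite_measure_count_space lborel.sigma_finite_measure_axioms)

lemma sigma_finite_freq_space: "sigma_finite_measure freq_space"
  unfolding freq_space_def by (rule freq.P.sigma_finite_measure_axioms)

interpretation freq2: pair_sigma_finite freq_space freq_space
  by (intro pair_sigma_finite.intro sigma_finite_freq_space)

lemma nn_integral_freq_space:
  "f \<in> borel_measurable freq_space \<Longrightarrow>
    (\<integral>\<^sup>+k. f k \<partial>freq_space) = (\<integral>\<^sup>+m. (\<integral>\<^sup>+\<omega>. f (m, \<omega>) \<partial>lborel) \<partial>count_space UNIV)"
  unfolding freq_space_def by (subst lborel.nn_integral_fst[symmetric]) auto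

text \<open>Invariance under translation: a change of variable in \<open>\<omega>\<close> and a
  reindexing of the integers.\<close>

lemma nn_integral_freq_space_shift:
  assumes [measurable]: "f \<in> borel_measurable freq_space"
  shows "(\<integral>\<^sup>+k. f (k - k') \<partial>freq_space) = (\<integral>\<^sup>+k. f k \<partial>freq_space)"
proof -
  obtain m' \<omega>' where k': "k' = (m', \<omega>')" by (cases k')
  have [measurable]: "(\<lambda>\<omega>. f (m, \<omega>)) \<in> borel_measurable borel" for m
    using assms by (simp add: measurable_freq_space_iff)
  have "(\<integral>\<^sup>+k. f (k - k') \<partial>freq_space) =
      (\<integral>\<^sup>+m. (\<integral>\<^sup>+\<omega>. f (m - m', \<omega> - \<omega>') \<partial>lborel) \<partial>count_space UNIV)"
    by (subst nn_integral_freq_space) (auto simp: k')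
  also have "\<dots> = (\<integral>\<^sup>+m. (\<integral>\<^sup>+\<omega>. f (m - m', \<omega>) \<partial>lborel) \<partial>count_space UNIV)"
  proof (rule nn_integral_cong)
    fix m
    show "(\<integral>\<^sup>+\<omega>. f (m - m', \<omega> - \<omega>') \<partial>lborel) = (\<integral>\<^sup>+\<omega>. f (m - m', \<omega>) \<partial>lborel)"
      using nn_integral_real_affine[of "\<lambda>\<omega>. f (m - m', \<omega>)" 1 "- \<omega>'"] by (simp add: algebra_simps)
  qed
  also have "\<dots> = (\<integral>\<^sup>+m. (\<integral>\<^sup>+\<omega>. f (m, \<omega>) \<partial>lborel) \<partial>count_space UNIV)"
    by (rule nn_integral_bij_count_space[of "\<lambda>m. m - m'" UNIV UNIV
        "\<lambda>m. \<integral>\<^sup>+\<omega>. f (m, \<omega>) \<partial>lborel"])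
      (auto intro!: bij_betwI[of _ _ _ "\<lambda>m. m + m'"])
  also have "\<dots> = (\<integral>\<^sup>+k. f k \<partial>freq_space)"
    by (simp add: nn_integral_freq_space)
  finally show ?thesis .
qed

text \<open>The Cauchy-Schwarz inequality with respect to the weight \<open>\<alpha>\<close> leaves
  one factor of its integral and the integral of
  \<open>\<alpha> k' * (\<beta> (k - k'))\<^sup>2\<close>; Tonelli and translation invariance
  evaluate the latter after integration in \<open>k\<close>.\<close>

lemma Young_freq_space:
  fixes \<alpha> \<beta> :: "int \<times> real \<Rightarrow> real"
  assumes [measurable]: "\<alpha> \<in> borel_measurable freq_space" "\<beta> \<in> borel_measurable freq_space"
    and nonneg: "\<And>k. 0 \<le> \<alpha> k" "\<And>k. 0 \<le> \<beta> k"
  shows "(\<integral>\<^sup>+k. (\<integral>\<^sup>+k'. ennreal (\<alpha> k' * \<beta> (k - k')) \<partial>freq_space)\<^sup>2 \<partial>freq_space)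
    \<le> (\<integral>\<^sup>+k. ennreal (\<alpha> k) \<partial>freq_space)\<^sup>2 * (\<integral>\<^sup>+k. ennreal ((\<beta> k)\<^sup>2) \<partial>freq_space)"
proof -
  let ?A = "\<integral>\<^sup>+k. ennreal (\<alpha> k) \<partial>freq_space"
  have "(\<integral>\<^sup>+k'. ennreal (\<alpha> k' * \<beta> (k - k')) \<partial>freq_space)\<^sup>2
      \<le> ?A * (\<integral>\<^sup>+k'. ennreal (\<alpha> k' * (\<beta> (k - k'))\<^sup>2) \<partial>freq_space)" for k
  proof -
    \<comment> \<open>Half of \<open>\<alpha>\<close> goes to each factor, so that squaring them
      restores \<open>\<alpha>\<close> in both integrals.\<close>
    have "ennreal (\<alpha> k' * \<beta> (k - k')) = ennreal (sqrt (\<alpha> k')) * ennreal (sqrt (\<alpha> k') * \<beta> (k - k'))" for k'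
      using nonneg by (simp add: ennreal_mult[symmetric] mult.assoc[symmetric])
    hence "(\<integral>\<^sup>+k'. ennreal (\<alpha> k' * \<beta> (k - k')) \<partial>freq_space)\<^sup>2 =
      (\<integral>\<^sup>+k'. ennreal (sqrt (\<alpha> k')) * ennreal (sqrt (\<alpha> k') * \<beta> (k - k')) \<partial>freq_space)\<^sup>2"
      by simp
    also have "\<dots> \<le> (\<integral>\<^sup>+k'. ennreal (sqrt (\<alpha> k')) ^ 2 \<partial>freq_space) *
        (\<integral>\<^sup>+k'. ennreal (sqrt (\<alpha> k') * \<beta> (k - k')) ^ 2 \<partial>freq_space)"
      by (intro Cauchy_Schwarz_nn_integral) measurable
    also have "\<dots> = ?A * (\<integral>\<^sup>+k'. ennreal (\<alpha> k' * (\<beta> (k - k'))\<^sup>2) \<partial>freq_space)"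
      using nonneg by (simp add: ennreal_power power_mult_distrib)
    finally show ?thesis .
  qed
  hence "(\<integral>\<^sup>+k. (\<integral>\<^sup>+k'. ennreal (\<alpha> k' * \<beta> (k - k')) \<partial>freq_space)\<^sup>2 \<partial>freq_space)
      \<le> (\<integral>\<^sup>+k. ?A * (\<integral>\<^sup>+k'. ennreal (\<alpha> k' * (\<beta> (k - k'))\<^sup>2) \<partial>freq_space) \<partial>freq_space)"
    by (intro nn_integral_mono)
  also have "\<dots> = ?A * (\<integral>\<^sup>+k. (\<integral>\<^sup>+k'. ennreal (\<alpha> k' * (\<beta> (k - k'))\<^sup>2) \<partial>freq_space) \<partial>freq_space)"
    by (intro nn_integral_cmult) measurable
  also have "(\<integral>\<^sup>+k. (\<integral>\<^sup>+k'. ennreal (\<alpha> k' * (\<beta> (k - k'))\<^sup>2) \<partial>freq_space) \<partial>freq_space) =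
      (\<integral>\<^sup>+k'. (\<integral>\<^sup>+k. ennreal (\<alpha> k' * (\<beta> (k - k'))\<^sup>2) \<partial>freq_space) \<partial>freq_space)"
    by (rule freq2.Fubini'[symmetric]) measurable
  also have "\<dots> = (\<integral>\<^sup>+k'. ennreal (\<alpha> k') * (\<integral>\<^sup>+k. ennreal ((\<beta> k)\<^sup>2) \<partial>freq_space) \<partial>freq_space)"
  proof (intro nn_integral_cong)
    fix k'
    have "(\<integral>\<^sup>+k. ennreal (\<alpha> k' * (\<beta> (k - k'))\<^sup>2) \<partial>freq_space) =
       ennreal (\<alpha> k') * (\<integral>\<^sup>+k. ennreal ((\<beta> (k - k'))\<^sup>2) \<partial>freq_space)"
      using nonneg by (simp add: ennreal_mult nn_integral_cmult)
    thus "(\<integral>\<^sup>+k. ennreal (\<alpha> k' * (\<beta> (k - k'))\<^sup>2) \<partial>freq_space) =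
       ennreal (\<alpha> k') * (\<integral>\<^sup>+k. ennreal ((\<beta> k)\<^sup>2) \<partial>freq_space)"
      by (subst (asm) nn_integral_freq_space_shift) auto
  qed
  also have "\<dots> = ?A * (\<integral>\<^sup>+k. ennreal ((\<beta> k)\<^sup>2) \<partial>freq_space)"
    by (intro nn_integral_multc) measurable
  finally show ?thesis by (simp add: power2_eq_square mult.assoc)
qed

section \<open>Weighted norms and kernel operators\<close>

definition wL1 :: "(int \<times> real \<Rightarrow> real) \<Rightarrow> (int \<times> real \<Rightarrow> complex) \<Rightarrow> ennreal" where
  "wL1 p A = (\<integral>\<^sup>+k. ennreal (p k * cmod (A k)) \<partial>freq_space)"

definition wL2sq :: "(int \<times> real \<Rightarrow> real) \<Rightarrow> (int \<times> real \<Rightarrow> complex) \<Rightarrow> ennreal" where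
  "wL2sq \<rho> B = (\<integral>\<^sup>+k. ennreal ((\<rho> k * cmod (B k))\<^sup>2) \<partial>freq_space)"

text \<open>The kernel sees the output frequency \<open>k\<close> and the frequency
  \<open>k'\<close> of the first factor. The kernel 1 is plain convolution, and
  \<open>s k - s (k - k')\<close> is its commutator with multiplication by \<open>s\<close>.\<close>

definition kconv :: "(int \<times> real \<Rightarrow> int \<times> real \<Rightarrow> complex) \<Rightarrow> (int \<times> real \<Rightarrow> complex) \<Rightarrow>
    (int \<times> real \<Rightarrow> complex) \<Rightarrow> int \<times> real \<Rightarrow> complex" where
  "kconv \<kappa> A B k = (\<integral>k'. \<kappa> k k' * (A k' * B (k - k')) \<partial>freq_space)"

lemma wL2sq_add_le:
  assumes [measurable]: "\<rho> \<in> borel_measurable freq_space" "A \<in> borel_measurable freq_space"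
    "B \<in> borel_measurable freq_space"
  shows "wL2sq \<rho> (\<lambda>k. A k + B k) \<le> 2 * (wL2sq \<rho> A + wL2sq \<rho> B)"
proof -
  have "(\<rho> k * cmod (A k + B k))\<^sup>2 \<le> 2 * ((\<rho> k * cmod (A k))\<^sup>2 + (\<rho> k * cmod (B k))\<^sup>2)" for k
  proof -
    have "(cmod (A k + B k))\<^sup>2 \<le> (cmod (A k) + cmod (B k))\<^sup>2"
      by (intro power_mono norm_triangle_ineq) auto
    also have "\<dots> \<le> 2 * ((cmod (A k))\<^sup>2 + (cmod (B k))\<^sup>2)"
      using sum_squares_bound[of "cmod (A k)" "cmod (B k)"] by (simp add: power2_sum)
    finally have "(\<rho> k)\<^sup>2 * (cmod (A k + B k))\<^sup>2 \<le> (\<rho> k)\<^sup>2 * (2 * ((cmod (A k))\<^sup>2 + (cmod (B k))\<^sup>2))"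
      by (rule mult_left_mono) auto
    thus ?thesis by (simp add: power_mult_distrib algebra_simps)
  qed
  hence "wL2sq \<rho> (\<lambda>k. A k + B k) \<le>
      (\<integral>\<^sup>+k. ennreal (2 * ((\<rho> k * cmod (A k))\<^sup>2 + (\<rho> k * cmod (B k))\<^sup>2)) \<partial>freq_space)"
    unfolding wL2sq_def by (intro nn_integral_mono ennreal_leI)
  also have "\<dots> = (\<integral>\<^sup>+k. 2 * (ennreal ((\<rho> k * cmod (A k))\<^sup>2) + ennreal ((\<rho> k * cmod (B k))\<^sup>2)) \<partial>freq_space)"
  proof (intro nn_integral_cong)
    have "ennreal (2 * (x + y)) = 2 * (ennreal x + ennreal y)" if "0 \<le> x" "0 \<le> y" for x y :: real
      using that by (subst ennreal_mult) auto
    thus "ennreal (2 * ((\<rho> k * cmod (A k))\<^sup>2 + (\<rho> k * cmod (B k))\<^sup>2)) =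
        2 * (ennreal ((\<rho> k * cmod (A k))\<^sup>2) + ennreal ((\<rho> k * cmod (B k))\<^sup>2))" for k
      by simp
  qed
  also have "\<dots> = 2 * (wL2sq \<rho> A + wL2sq \<rho> B)"
    unfolding wL2sq_def by (simp add: nn_integral_cmult nn_integral_add del: distrib_left_numeral)
  finally show ?thesis .
qed

text \<open>A bound by a product of a weight in \<open>k'\<close> and a weight in
  \<open>k - k'\<close> lets each weight be absorbed into its own factor, after which Young's
  inequality applies.\<close>

locale freq_kernel =
  fixes \<kappa> :: "int \<times> real \<Rightarrow> int \<times> real \<Rightarrow> complex" and p \<rho> :: "int \<times> real \<Rightarrow> real"
  assumes kernel_measurable: "(\<lambda>(k, k'). \<kappa> k k') \<in> borel_measurable (freq_space \<Otimes>\<^sub>M freq_space)"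
    and weights_measurable [measurable]: "p \<in> borel_measurable freq_space" "\<rho> \<in> borel_measurable freq_space"
    and weights_nonneg: "\<And>k. 0 \<le> p k" "\<And>k. 0 \<le> \<rho> k"
    and kernel_le: "\<And>k k'. cmod (\<kappa> k k') \<le> p k' * \<rho> (k - k')"
begin

lemma kernel_measurable' [measurable (raw)]:
  assumes [measurable]: "f \<in> measurable N freq_space" "g \<in> measurable N freq_space"
  shows "(\<lambda>x. \<kappa> (f x) (g x)) \<in> borel_measurable N"
  using measurable_compose[OF measurable_Pair[OF assms] kernel_measurable] by simp

lemma kconv_measurable [measurable]:
  assumes [measurable]: "A \<in> borel_measurable freq_space" "B \<in> borel_measurable freq_space"
  shows "kconv \<kappa> A B \<in> borel_measurable freq_space"
  unfolding kconv_def
  by (rule sigma_finite_measure.borel_measurable_lebesgue_integral[OF sigma_finite_freq_space]) measurable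

lemma nn_kconv_bound:
  assumes [measurable]: "A \<in> borel_measurable freq_space" "B \<in> borel_measurable freq_space"
  shows "(\<integral>\<^sup>+k. (\<integral>\<^sup>+k'. ennreal (cmod (\<kappa> k k' * (A k' * B (k - k')))) \<partial>freq_space)\<^sup>2 \<partial>freq_space)
    \<le> (wL1 p A)\<^sup>2 * wL2sq \<rho> B"
proof -
  have "cmod (\<kappa> k k' * (A k' * B (k - k'))) \<le> (p k' * cmod (A k')) * (\<rho> (k - k') * cmod (B (k - k')))" for k k'
    using mult_right_mono[OF kernel_le[of k k'], of "cmod (A k') * cmod (B (k - k'))"]
    by (simp add: norm_mult mult_ac)
  hence "(\<integral>\<^sup>+k. (\<integral>\<^sup>+k'. ennreal (cmod (\<kappa> k k' * (A k' * B (k - k')))) \<partial>freq_space)\<^sup>2 \<partial>freq_space) \<le>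
    (\<integral>\<^sup>+k. (\<integral>\<^sup>+k'. ennreal ((p k' * cmod (A k')) * (\<rho> (k - k') * cmod (B (k - k')))) \<partial>freq_space)\<^sup>2 \<partial>freq_space)"
    by (intro nn_integral_mono power_mono ennreal_leI) auto
  also have "\<dots> \<le> (wL1 p A)\<^sup>2 * wL2sq \<rho> B"
    unfolding wL1_def wL2sq_def by (rule Young_freq_space) (auto simp: weights_nonneg)
  finally show ?thesis .
qed

lemma kconv_bound:
  assumes [measurable]: "A \<in> borel_measurable freq_space" "B \<in> borel_measurable freq_space"
  shows "wL2sq (\<lambda>_. 1) (kconv \<kappa> A B) \<le> (wL1 p A)\<^sup>2 * wL2sq \<rho> B"
proof -
  have "wL2sq (\<lambda>_. 1) (kconv \<kappa> A B) \<le>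
     (\<integral>\<^sup>+k. (\<integral>\<^sup>+k'. ennreal (cmod (\<kappa> k k' * (A k' * B (k - k')))) \<partial>freq_space)\<^sup>2 \<partial>freq_space)"
    unfolding wL2sq_def
  proof (intro nn_integral_mono)
    fix k
    have "ennreal (cmod (kconv \<kappa> A B k)) \<le> (\<integral>\<^sup>+k'. ennreal (cmod (\<kappa> k k' * (A k' * B (k - k')))) \<partial>freq_space)"
    proof (cases "integrable freq_space (\<lambda>k'. \<kappa> k k' * (A k' * B (k - k')))")
      case True
      thus ?thesis unfolding kconv_def by (rule integral_norm_bound_ennreal)
    next
      \<comment> \<open>Here the Bochner integral has the default value 0, so the bound holds at
        every \<open>k\<close> and not only where the integrand is integrable.\<close>
      case False
      thus ?thesis by (simp add: kconv_def not_integrable_integral_eq)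
    qed
    hence "(ennreal (cmod (kconv \<kappa> A B k)))\<^sup>2 \<le>
        (\<integral>\<^sup>+k'. ennreal (cmod (\<kappa> k k' * (A k' * B (k - k')))) \<partial>freq_space)\<^sup>2"
      by (intro power_mono) auto
    thus "ennreal ((1 * cmod (kconv \<kappa> A B k))\<^sup>2) \<le>
        (\<integral>\<^sup>+k'. ennreal (cmod (\<kappa> k k' * (A k' * B (k - k')))) \<partial>freq_space)\<^sup>2"
      by (simp add: ennreal_power)
  qed
  also have "\<dots> \<le> (wL1 p A)\<^sup>2 * wL2sq \<rho> B" by (rule nn_kconv_bound) measurable
  finally show ?thesis .
qed

text \<open>The integral of the absolute value is square integrable in \<open>k\<close>, hence
  finite almost everywhere. This gives the kernel formula a meaning for factors of finite weighted
  norm for which the plain convolution may diverge.\<close>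

lemma AE_kconv_integrable:
  assumes [measurable]: "A \<in> borel_measurable freq_space" "B \<in> borel_measurable freq_space"
    and fin: "wL1 p A < \<infinity>" "wL2sq \<rho> B < \<infinity>"
  shows "AE k in freq_space. integrable freq_space (\<lambda>k'. \<kappa> k k' * (A k' * B (k - k')))"
proof -
  let ?I = "\<lambda>k. (\<integral>\<^sup>+k'. ennreal (cmod (\<kappa> k k' * (A k' * B (k - k')))) \<partial>freq_space)"
  have [measurable]: "?I \<in> borel_measurable freq_space"
    by (rule sigma_finite_measure.borel_measurable_nn_integral[OF sigma_finite_freq_space]) measurable
  have "(\<integral>\<^sup>+k. (?I k)\<^sup>2 \<partial>freq_space) < \<infinity>"
    using nn_kconv_bound[of A B] fin
    by (simp add: ennreal_mult_less_top power_less_top_ennreal order.strict_trans1)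
  hence "AE k in freq_space. (?I k)\<^sup>2 \<noteq> \<infinity>"
    by (intro nn_integral_PInf_AE) auto
  thus ?thesis
  proof eventually_elim
    case (elim k)
    hence "?I k < \<infinity>" by (auto simp: top.not_eq_extremum power_less_top_ennreal)
    thus ?case by (intro integrableI_bounded) auto
  qed
qed

text \<open>Bilinearity: the difference of the two values is the sum of the operator on the two
  increments and on each increment paired with the limit of the other factor. Each piece is bounded
  by a product in which at least one factor tends to 0.\<close>

lemma kconv_tendsto:
  assumes [measurable]: "\<And>n. A n \<in> borel_measurable freq_space" "\<And>n. B n \<in> borel_measurable freq_space"
      "A' \<in> borel_measurable freq_space" "B' \<in> borel_measurable freq_space"
    and fin: "wL1 p A' < \<infinity>" "wL2sq \<rho> B' < \<infinity>"
    and lim: "(\<lambda>n. wL1 p (\<lambda>k. A n k - A' k)) \<longlonglongrightarrow> 0" "(\<lambda>n. wL2sq \<rho> (\<lambda>k. B n k - B' k)) \<longlonglongrightarrow> 0"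
  shows "(\<lambda>n. wL2sq (\<lambda>_. 1) (\<lambda>k. kconv \<kappa> (A n) (B n) k - kconv \<kappa> A' B' k)) \<longlonglongrightarrow> 0"
proof -
  let ?a = "\<lambda>n. wL1 p (\<lambda>k. A n k - A' k)" and ?b = "\<lambda>n. wL2sq \<rho> (\<lambda>k. B n k - B' k)"
  let ?R = "\<lambda>n. 2 * ((?a n)\<^sup>2 * ?b n + 2 * ((?a n)\<^sup>2 * wL2sq \<rho> B' + (wL1 p A')\<^sup>2 * ?b n))"
  have "?R \<longlonglongrightarrow> 2 * (0\<^sup>2 * 0 + 2 * (0\<^sup>2 * wL2sq \<rho> B' + (wL1 p A')\<^sup>2 * 0))"
    using fin unfolding power2_eq_square
    by (intro tendsto_add tendsto_mult_ennreal tendsto_const lim)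
       (auto simp: ennreal_mult_eq_top_iff less_top[symmetric])
  hence R: "?R \<longlonglongrightarrow> 0" by simp
  \<comment> \<open>The bound 1 only serves to make the increments finite, so that they satisfy the
    hypotheses of \<open>AE_kconv_integrable\<close>.\<close>
  have "eventually (\<lambda>n. ?a n < 1) sequentially" "eventually (\<lambda>n. ?b n < 1) sequentially"
    using lim by (auto intro!: order_tendstoD(2))
  hence le: "eventually (\<lambda>n. wL2sq (\<lambda>_. 1) (\<lambda>k. kconv \<kappa> (A n) (B n) k - kconv \<kappa> A' B' k) \<le> ?R n) sequentially"
  proof eventually_elim
    case (elim n)
    let ?dA = "\<lambda>k. A n k - A' k" and ?dB = "\<lambda>k. B n k - B' k"
    have f: "?a n < \<infinity>" "?b n < \<infinity>" using elim by (auto simp: order.strict_trans)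
    \<comment> \<open>Additivity of the Bochner integral requires all four integrals to converge, so
      the bilinear identity is available almost everywhere, which suffices inside
      \<open>wL2sq\<close>.\<close>
    have "AE k in freq_space. kconv \<kappa> (A n) (B n) k - kconv \<kappa> A' B' k =
        kconv \<kappa> ?dA ?dB k + (kconv \<kappa> ?dA B' k + kconv \<kappa> A' ?dB k)"
    proof -
      have "AE k in freq_space. integrable freq_space (\<lambda>k'. \<kappa> k k' * (?dA k' * ?dB (k - k')))"
        "AE k in freq_space. integrable freq_space (\<lambda>k'. \<kappa> k k' * (?dA k' * B' (k - k')))"
        "AE k in freq_space. integrable freq_space (\<lambda>k'. \<kappa> k k' * (A' k' * ?dB (k - k')))"
        "AE k in freq_space. integrable freq_space (\<lambda>k'. \<kappa> k k' * (A' k' * B' (k - k')))"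
        by (intro AE_kconv_integrable f fin; measurable)+
      thus ?thesis
      proof eventually_elim
        case int: (elim k)
        have "kconv \<kappa> (A n) (B n) k = (\<integral>k'. (\<kappa> k k' * (?dA k' * ?dB (k - k')) + \<kappa> k k' * (?dA k' * B' (k - k'))) +
           (\<kappa> k k' * (A' k' * ?dB (k - k')) + \<kappa> k k' * (A' k' * B' (k - k'))) \<partial>freq_space)"
          unfolding kconv_def by (intro Bochner_Integration.integral_cong) (auto simp: algebra_simps)
        also have "\<dots> = (kconv \<kappa> ?dA ?dB k + kconv \<kappa> ?dA B' k) + (kconv \<kappa> A' ?dB k + kconv \<kappa> A' B' k)"
          unfolding kconv_def using int by simp
        finally show ?case by simp
      qed
    qed
    hence "wL2sq (\<lambda>_. 1) (\<lambda>k. kconv \<kappa> (A n) (B n) k - kconv \<kappa> A' B' k) =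
      wL2sq (\<lambda>_. 1) (\<lambda>k. kconv \<kappa> ?dA ?dB k + (kconv \<kappa> ?dA B' k + kconv \<kappa> A' ?dB k))"
      unfolding wL2sq_def by (intro nn_integral_cong_AE) auto
    also have "\<dots> \<le> 2 * (wL2sq (\<lambda>_. 1) (kconv \<kappa> ?dA ?dB) +
        wL2sq (\<lambda>_. 1) (\<lambda>k. kconv \<kappa> ?dA B' k + kconv \<kappa> A' ?dB k))"
      by (intro wL2sq_add_le) measurable
    also have "\<dots> \<le> 2 * (wL2sq (\<lambda>_. 1) (kconv \<kappa> ?dA ?dB) +
        2 * (wL2sq (\<lambda>_. 1) (kconv \<kappa> ?dA B') + wL2sq (\<lambda>_. 1) (kconv \<kappa> A' ?dB)))"
    proof -
      have "wL2sq (\<lambda>_. 1) (\<lambda>k. kconv \<kappa> ?dA B' k + kconv \<kappa> A' ?dB k) \<le>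
          2 * (wL2sq (\<lambda>_. 1) (kconv \<kappa> ?dA B') + wL2sq (\<lambda>_. 1) (kconv \<kappa> A' ?dB))"
        by (intro wL2sq_add_le) measurable
      thus ?thesis by (rule mult_left_mono[OF add_left_mono]) simp
    qed
    also have "\<dots> \<le> ?R n"
      by (intro mult_left_mono add_mono kconv_bound) auto
    finally show ?case .
  qed
  show ?thesis
    by (rule tendsto_sandwich[OF _ le tendsto_const R]) auto
qed

end

section \<open>Transforms of test functions\<close>

lemma frechet_derivative_eqI:
  "(f has_derivative f') (at x) \<Longrightarrow> frechet_derivative f (at x) = f'"
  by (rule frechet_derivative_at[symmetric])

text \<open>The recursion for \<open>Suc k\<close> asks for differentiability and for the class of
  the derivative, not for \<open>Ck_on k\<close> itself; this is recovered by induction, with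
  continuity from differentiability at the bottom.\<close>

lemma Ck_on_UNIV_pred: "Ck_on (Suc k) UNIV f \<Longrightarrow> Ck_on k UNIV f"
proof (induction k arbitrary: f)
  case 0
  thus ?case by (auto intro!: continuous_at_imp_continuous_on differentiable_imp_continuous_within)
next
  case (Suc k)
  from Suc.prems have "Ck_on (Suc k) UNIV (\<lambda>x. frechet_derivative f (at x) d)" for d
    by simp
  with Suc.IH have "Ck_on k UNIV (\<lambda>x. frechet_derivative f (at x) d)" for d by blast
  with Suc.prems show ?case by (simp only: Ck_on.simps) blast
qed

lemma Ck_on_UNIV_linear_combination:
  "Ck_on k UNIV f \<Longrightarrow> Ck_on k UNIV g \<Longrightarrow> Ck_on k UNIV (\<lambda>x. b *\<^sub>R f x + c *\<^sub>R g x)"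
proof (induction k arbitrary: f g)
  case (Suc k)
  have d: "((\<lambda>x. b *\<^sub>R f x + c *\<^sub>R g x) has_derivative
      (\<lambda>d. b *\<^sub>R frechet_derivative f (at x) d + c *\<^sub>R frechet_derivative g (at x) d)) (at x)" for x
    using Suc.prems by (auto intro!: derivative_intros simp: frechet_derivative_works)
  show ?case
    unfolding Ck_on.simps(2) frechet_derivative_eqI[OF d]
    using d Suc by (auto intro!: differentiableI)
qed (auto intro!: continuous_intros)

text \<open>The coefficients of the vector fields below are coordinates. Differentiating a linear
  coefficient leaves a constant, so the induction stays within linear combinations.\<close>

lemma Ck_on_UNIV_linear_mult:
  assumes L: "bounded_linear (L :: _ \<Rightarrow> real)"
  shows "Ck_on k UNIV f \<Longrightarrow> Ck_on k UNIV (\<lambda>x. L x *\<^sub>R f x)"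
proof (induction k arbitrary: f)
  case 0
  thus ?case by (auto intro!: continuous_intros bounded_linear.continuous_on[OF L])
next
  case (Suc k)
  have d: "((\<lambda>x. L x *\<^sub>R f x) has_derivative
      (\<lambda>d. L x *\<^sub>R frechet_derivative f (at x) d + L d *\<^sub>R f x)) (at x)" for x
    using Suc.prems
    by (auto intro!: has_derivative_scaleR bounded_linear_imp_has_derivative L simp: frechet_derivative_works)
  have "Ck_on k UNIV (\<lambda>x. 1 *\<^sub>R (L x *\<^sub>R frechet_derivative f (at x) d) + L d *\<^sub>R f x)" for d
    using Suc.prems by (intro Ck_on_UNIV_linear_combination Suc.IH Ck_on_UNIV_pred[OF Suc.prems]) auto
  thus ?case
    unfolding Ck_on.simps(2) frechet_derivative_eqI[OF d]
    using d by (auto intro!: differentiableI)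
qed

section \<open>Smooth functions of bounded support and vector fields acting on them\<close>

type_synonym spacetime_fun = "real \<times> real \<times> real \<times> real \<Rightarrow> complex"

text \<open>A class containing the test functions and closed under the derivations below; smoothness
  and bounded support are what the decay of the transforms rests on.\<close>

definition smooth_supp :: "spacetime_fun \<Rightarrow> bool" where
  "smooth_supp U \<longleftrightarrow> smooth_on UNIV U \<and> (\<exists>T. \<forall>p. norm p > T \<longrightarrow> U p = 0)"

lemma test_fun_smooth_supp: "test_fun M a U \<Longrightarrow> smooth_supp U"
  unfolding test_fun_def smooth_supp_def
  by (metis bounded_iff compact_imp_bounded linorder_not_le)

definition dir_deriv :: "real \<times> real \<times> real \<times> real \<Rightarrow> spacetime_fun \<Rightarrow> spacetime_fun" where
  "dir_deriv d U p = frechet_derivative U (at p) d"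

lemma smooth_supp_has_derivative:
  assumes "smooth_supp U"
  shows "(U has_derivative frechet_derivative U (at p)) (at p)"
proof -
  have "Ck_on (Suc 0) UNIV U" using assms unfolding smooth_supp_def smooth_on_def by blast
  thus ?thesis unfolding Ck_on.simps frechet_derivative_works by blast
qed

lemma smooth_supp_dir_deriv:
  assumes "smooth_supp U"
  shows "smooth_supp (dir_deriv d U)"
proof -
  have "Ck_on (Suc k) UNIV U" for k using assms unfolding smooth_supp_def smooth_on_def by blast
  hence "smooth_on UNIV (dir_deriv d U)" unfolding smooth_on_def dir_deriv_def Ck_on.simps by blast
  moreover obtain T where T: "\<And>p. norm p > T \<Longrightarrow> U p = 0"
    using assms unfolding smooth_supp_def by blast
  have "dir_deriv d U p = 0" if "norm p > T" for p
  proof -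
    have "open {p :: real \<times> real \<times> real \<times> real. T < norm p}"
      by (intro open_Collect_less continuous_intros)
    hence "(U has_derivative (\<lambda>_. 0)) (at p)"
      using has_derivative_transform_within_open[of "\<lambda>_. 0" "\<lambda>_. 0" p UNIV "{p. T < norm p}" U] that T
      by auto
    thus ?thesis by (simp add: dir_deriv_def frechet_derivative_eqI)
  qed
  ultimately show ?thesis unfolding smooth_supp_def by blast
qed

lemma smooth_supp_linear_combination:
  assumes "smooth_supp U" "smooth_supp V"
  shows "smooth_supp (\<lambda>p. b *\<^sub>R U p + c *\<^sub>R V p)"
proof -
  obtain T T' where "\<And>p. norm p > T \<Longrightarrow> U p = 0" "\<And>p. norm p > T' \<Longrightarrow> V p = 0"
    using assms unfolding smooth_supp_def by blast
  hence "\<forall>p. norm p > max T T' \<longrightarrow> b *\<^sub>R U p + c *\<^sub>R V p = 0" by auto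
  moreover have "smooth_on UNIV (\<lambda>p. b *\<^sub>R U p + c *\<^sub>R V p)"
    using assms unfolding smooth_supp_def smooth_on_def by (blast intro: Ck_on_UNIV_linear_combination)
  ultimately show ?thesis unfolding smooth_supp_def by blast
qed

lemma smooth_supp_linear_mult:
  assumes "smooth_supp U" "bounded_linear L"
  shows "smooth_supp (\<lambda>p. L p *\<^sub>R U p)"
proof -
  have "smooth_on UNIV (\<lambda>p. L p *\<^sub>R U p)"
    using assms unfolding smooth_supp_def smooth_on_def by (blast intro: Ck_on_UNIV_linear_mult)
  thus ?thesis using assms unfolding smooth_supp_def by (metis scaleR_zero_right)
qed

lemma smooth_supp_continuous:
  assumes "smooth_supp U" shows "continuous_on UNIV U"
proof -
  have "Ck_on 0 UNIV U" using assms unfolding smooth_supp_def smooth_on_def by blast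
  thus ?thesis by simp
qed

lemma smooth_supp_bounded:
  assumes "smooth_supp U"
  obtains B where "B \<ge> 0" "\<And>p. cmod (U p) \<le> B"
proof -
  obtain T where T: "\<And>p. norm p > T \<Longrightarrow> U p = 0"
    using assms unfolding smooth_supp_def by blast
  have "compact (U ` cball 0 T)"
    by (intro compact_continuous_image continuous_on_subset[OF smooth_supp_continuous[OF assms]]) auto
  then obtain B where B: "B > 0" "\<And>z. z \<in> U ` cball 0 T \<Longrightarrow> cmod z \<le> B"
    using compact_imp_bounded bounded_pos by metis
  show ?thesis
  proof (rule that[of B])
    show "cmod (U p) \<le> B" for p
      using B T[of p] by (cases "norm p > T") auto
  qed (use B in auto)
qed

definition time_deriv :: "spacetime_fun \<Rightarrow> spacetime_fun" where
  "time_deriv = dir_deriv (1, 0, 0, 0)"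

text \<open>In polar coordinates these two vector fields are \<open>\<partial>\<^sub>\<phi>\<close> and \<open>r \<partial>\<^sub>r\<close>.  In Cartesian form they visibly
  preserve the class of smooth functions with bounded support, so that decay of \<open>hat U\<close> and of its
  \<open>r\<close>-derivative follows from the mere boundedness of transforms.\<close>

definition angular_deriv :: "spacetime_fun \<Rightarrow> spacetime_fun" where
  "angular_deriv U = (\<lambda>p. fst (snd p) *\<^sub>R dir_deriv (0, 0, 1, 0) U p - fst (snd (snd p)) *\<^sub>R dir_deriv (0, 1, 0, 0) U p)"

definition euler_deriv :: "spacetime_fun \<Rightarrow> spacetime_fun" where
  "euler_deriv U = (\<lambda>p. fst (snd p) *\<^sub>R dir_deriv (0, 1, 0, 0) U p +
     (fst (snd (snd p)) *\<^sub>R dir_deriv (0, 0, 1, 0) U p + snd (snd (snd p)) *\<^sub>R dir_deriv (0, 0, 0, 1) U p))"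

lemma smooth_supp_time_deriv: "smooth_supp U \<Longrightarrow> smooth_supp (time_deriv U)"
  unfolding time_deriv_def by (rule smooth_supp_dir_deriv)

lemma bounded_linear_coordinates:
  "bounded_linear (\<lambda>p :: real \<times> real \<times> real \<times> real. fst (snd p))"
  "bounded_linear (\<lambda>p :: real \<times> real \<times> real \<times> real. fst (snd (snd p)))"
  "bounded_linear (\<lambda>p :: real \<times> real \<times> real \<times> real. snd (snd (snd p)))"
  by (intro bounded_linear_intros)+

lemma smooth_supp_angular_deriv:
  assumes "smooth_supp U" shows "smooth_supp (angular_deriv U)"
proof -
  have "smooth_supp (\<lambda>p. 1 *\<^sub>R (fst (snd p) *\<^sub>R dir_deriv (0, 0, 1, 0) U p) +
      (-1) *\<^sub>R (fst (snd (snd p)) *\<^sub>R dir_deriv (0, 1, 0, 0) U p))"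
    by (intro smooth_supp_linear_combination smooth_supp_linear_mult bounded_linear_coordinates
        smooth_supp_dir_deriv assms)
  thus ?thesis by (simp add: angular_deriv_def)
qed

lemma smooth_supp_euler_deriv:
  assumes "smooth_supp U" shows "smooth_supp (euler_deriv U)"
proof -
  have "smooth_supp (\<lambda>p. 1 *\<^sub>R (fst (snd p) *\<^sub>R dir_deriv (0, 1, 0, 0) U p) +
      1 *\<^sub>R (1 *\<^sub>R (fst (snd (snd p)) *\<^sub>R dir_deriv (0, 0, 1, 0) U p) +
        1 *\<^sub>R (snd (snd (snd p)) *\<^sub>R dir_deriv (0, 0, 0, 1) U p)))"
    by (intro smooth_supp_linear_combination smooth_supp_linear_mult bounded_linear_coordinates
        smooth_supp_dir_deriv assms)
  thus ?thesis by (simp add: euler_deriv_def)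
qed

lemma has_vector_derivative_along_path:
  assumes U: "smooth_supp U" and "((\<lambda>s. \<gamma> s) has_vector_derivative (d1, d2, d3, d4)) (at s)"
  shows "((\<lambda>s. U (\<gamma> s)) has_vector_derivative
    d1 *\<^sub>R dir_deriv (1, 0, 0, 0) U (\<gamma> s) + d2 *\<^sub>R dir_deriv (0, 1, 0, 0) U (\<gamma> s) +
    d3 *\<^sub>R dir_deriv (0, 0, 1, 0) U (\<gamma> s) + d4 *\<^sub>R dir_deriv (0, 0, 0, 1) U (\<gamma> s)) (at s)"
proof -
  let ?D = "frechet_derivative U (at (\<gamma> s))"
  note U' = smooth_supp_has_derivative[OF U, of "\<gamma> s"]
  have lin: "linear ?D" using U' by (rule has_derivative_linear)
  have "((\<lambda>s. U (\<gamma> s)) has_vector_derivative ?D (d1, d2, d3, d4)) (at s)"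
  proof -
    have "((\<lambda>s. U (\<gamma> s)) has_derivative (\<lambda>h. ?D (h *\<^sub>R (d1, d2, d3, d4)))) (at s)"
      by (rule has_derivative_compose[OF assms(2)[unfolded has_vector_derivative_def] U'])
    thus ?thesis unfolding has_vector_derivative_def linear_scale[OF lin] .
  qed
  moreover have "(d1, d2, d3, d4) = d1 *\<^sub>R (1, 0, 0, 0) + d2 *\<^sub>R (0, 1, 0, 0) + d3 *\<^sub>R (0, 0, 1, 0) + d4 *\<^sub>R (0, 0, 0, 1)"
    by simp
  ultimately show ?thesis
    by (simp only: linear_add[OF lin] linear_scale[OF lin] dir_deriv_def)
qed

lemma has_vector_derivative_Pair:
  "(f has_vector_derivative f') (at x within S) \<Longrightarrow> (g has_vector_derivative g') (at x within S) \<Longrightarrow>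
    ((\<lambda>x. (f x, g x)) has_vector_derivative (f', g')) (at x within S)"
  unfolding has_vector_derivative_def scaleR_Pair by (rule has_derivative_Pair)

lemma in_polar_deriv_t:
  assumes "smooth_supp U"
  shows "((\<lambda>t. in_polar U t r \<theta> \<phi>) has_vector_derivative in_polar (time_deriv U) t r \<theta> \<phi>) (at t)"
proof -
  have "((\<lambda>t. (t, r * sin \<theta> * cos \<phi>, r * sin \<theta> * sin \<phi>, r * cos \<theta>)) has_vector_derivative (1, 0, 0, 0)) (at t)"
    by (intro has_vector_derivative_Pair has_vector_derivative_const has_vector_derivative_id)
  from has_vector_derivative_along_path[OF assms this] show ?thesis
    by (simp add: in_polar_def time_deriv_def)
qed

lemma in_polar_deriv_phi:
  assumes "smooth_supp U"
  shows "((\<lambda>\<phi>. in_polar U t r \<theta> \<phi>) has_vector_derivative in_polar (angular_deriv U) t r \<theta> \<phi>) (at \<phi>)"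
proof -
  have "((\<lambda>\<phi>. (t, r * sin \<theta> * cos \<phi>, r * sin \<theta> * sin \<phi>, r * cos \<theta>)) has_vector_derivative
      (0, - (r * sin \<theta> * sin \<phi>), r * sin \<theta> * cos \<phi>, 0)) (at \<phi>)"
    by (intro has_vector_derivative_Pair)
      (auto simp: has_real_derivative_iff_has_vector_derivative[symmetric] intro!: derivative_eq_intros)
  from has_vector_derivative_along_path[OF assms this] show ?thesis
    by (simp add: in_polar_def angular_deriv_def)
qed

lemma in_polar_deriv_r:
  assumes "smooth_supp U" "r \<noteq> 0"
  shows "((\<lambda>r. in_polar U t r \<theta> \<phi>) has_vector_derivative (1 / r) *\<^sub>R in_polar (euler_deriv U) t r \<theta> \<phi>) (at r)"
proof -
  have "((\<lambda>r. (t, r * sin \<theta> * cos \<phi>, r * sin \<theta> * sin \<phi>, r * cos \<theta>)) has_vector_derivative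
      (0, sin \<theta> * cos \<phi>, sin \<theta> * sin \<phi>, cos \<theta>)) (at r)"
    by (intro has_vector_derivative_Pair)
      (auto simp: has_real_derivative_iff_has_vector_derivative[symmetric] intro!: derivative_eq_intros)
  from has_vector_derivative_along_path[OF assms(1) this] assms(2) show ?thesis
    by (simp add: in_polar_def euler_deriv_def scaleR_add_right add.assoc)
qed

section \<open>Differentiation under the integral sign\<close>

lemma has_vector_derivative_iff_quotient:
  "(F has_vector_derivative F') (at r) \<longleftrightarrow> ((\<lambda>s. (F s - F r) /\<^sub>R (s - r)) \<longlongrightarrow> F') (at r)"
proof -
  have "(F has_vector_derivative F') (at r) \<longleftrightarrow>
      ((\<lambda>s. norm ((F s - F r) - (s - r) *\<^sub>R F') / norm (s - r)) \<longlongrightarrow> 0) (at r)"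
    by (simp add: has_vector_derivative_def has_derivative_iff_norm bounded_linear_scaleR_left)
  also have "\<dots> \<longleftrightarrow> ((\<lambda>s. norm ((F s - F r) /\<^sub>R (s - r) - F')) \<longlongrightarrow> 0) (at r)"
  proof (rule filterlim_cong[OF refl refl])
    have "norm ((F s - F r) - (s - r) *\<^sub>R F') / norm (s - r) = norm ((F s - F r) /\<^sub>R (s - r) - F')"
      if "s \<noteq> r" for s
    proof -
      have "(F s - F r) /\<^sub>R (s - r) - F' = ((F s - F r) - (s - r) *\<^sub>R F') /\<^sub>R (s - r)"
        using that by (simp add: scaleR_diff_right)
      thus ?thesis by (simp add: divide_inverse mult.commute)
    qed
    thus "eventually (\<lambda>s. norm ((F s - F r) - (s - r) *\<^sub>R F') / norm (s - r) =
        norm ((F s - F r) /\<^sub>R (s - r) - F')) (at r)"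
      by (auto simp: eventually_at_filter)
  qed
  also have "\<dots> \<longleftrightarrow> ((\<lambda>s. (F s - F r) /\<^sub>R (s - r)) \<longlongrightarrow> F') (at r)"
    by (simp add: tendsto_norm_zero_iff LIM_zero_iff)
  finally show ?thesis .
qed

text \<open>The mean value inequality bounds the difference quotients by the same \<open>g\<close>
  that bounds the derivative, so dominated convergence applies along every sequence tending to
  \<open>r\<close>.\<close>

lemma has_vector_derivative_lebesgue_integral:
  fixes f f' :: "real \<Rightarrow> 'a \<Rightarrow> 'b :: {banach, second_countable_topology}"
  assumes "e > 0"
    and int: "\<And>s. \<bar>s - r\<bar> < e \<Longrightarrow> integrable M (f s)"
    and deriv: "\<And>s x. \<bar>s - r\<bar> < e \<Longrightarrow> x \<in> space M \<Longrightarrow> ((\<lambda>s. f s x) has_vector_derivative f' s x) (at s)"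
    and bound: "\<And>s x. \<bar>s - r\<bar> < e \<Longrightarrow> x \<in> space M \<Longrightarrow> norm (f' s x) \<le> g x"
    and g: "integrable M g" and meas: "f' r \<in> borel_measurable M"
  shows "((\<lambda>s. \<integral>x. f s x \<partial>M) has_vector_derivative (\<integral>x. f' r x \<partial>M)) (at r)"
proof -
  let ?q = "\<lambda>s x. (f s x - f r x) /\<^sub>R (s - r)"
  note vd = has_vector_derivative_iff_quotient
  have "((\<lambda>s. ((\<integral>x. f s x \<partial>M) - (\<integral>x. f r x \<partial>M)) /\<^sub>R (s - r)) \<longlongrightarrow> (\<integral>x. f' r x \<partial>M)) (at r)"
    unfolding tendsto_at_iff_sequentially
  proof (intro allI impI)
    fix X assume X: "\<forall>i. X i \<in> UNIV - {r}" "X \<longlonglongrightarrow> r"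
    have "eventually (\<lambda>i. dist (X i) r < e) sequentially" using X(2) \<open>e > 0\<close> by (rule tendstoD)
    then obtain N where N: "\<And>i. i \<ge> N \<Longrightarrow> \<bar>X i - r\<bar> < e"
      by (auto simp: eventually_sequentially dist_real_def)
    \<comment> \<open>Dropping finitely many terms puts the whole sequence into the ball where the
      derivative is controlled; \<open>LIMSEQ_offset\<close> restores them at the end.\<close>
    define Y where "Y i = X (i + N)" for i
    have Y: "\<bar>Y i - r\<bar> < e" "Y i \<noteq> r" for i using X N by (auto simp: Y_def)
    have Yr: "Y \<longlonglongrightarrow> r" unfolding Y_def using X(2) by (rule LIMSEQ_ignore_initial_segment)
    have "(\<lambda>i. \<integral>x. ?q (Y i) x \<partial>M) \<longlonglongrightarrow> (\<integral>x. f' r x \<partial>M)"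
    proof (rule integral_dominated_convergence[OF meas _ g])
      show "?q (Y i) \<in> borel_measurable M" for i
        using int[of r] int[OF Y(1)[of i]] \<open>e > 0\<close> by (auto intro!: borel_measurable_integrable)
      show "AE x in M. (\<lambda>i. ?q (Y i) x) \<longlonglongrightarrow> f' r x"
      proof (rule AE_I2)
        fix x assume "x \<in> space M"
        with deriv[of r x] \<open>e > 0\<close> have "((\<lambda>s. ?q s x) \<longlongrightarrow> f' r x) (at r)" by (simp add: vd)
        thus "(\<lambda>i. ?q (Y i) x) \<longlonglongrightarrow> f' r x"
          using Y(2) Yr unfolding tendsto_at_iff_sequentially by (auto simp: o_def)
      qed
      show "AE x in M. norm (?q (Y i) x) \<le> g x" for i
      proof (rule AE_I2)
        fix x assume x: "x \<in> space M"
        have "norm (f (Y i) x - f r x) \<le> g x * norm (Y i - r)"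
        proof (rule differentiable_bound[where S = "ball r e" and f' = "\<lambda>s h. h *\<^sub>R f' s x"])
          show "((\<lambda>s. f s x) has_derivative (\<lambda>h. h *\<^sub>R f' s x)) (at s within ball r e)" if "s \<in> ball r e" for s
            using deriv[OF _ x, of s] that
            by (auto simp: has_vector_derivative_def dist_real_def abs_minus_commute intro: has_derivative_at_withinI)
          show "onorm (\<lambda>h. h *\<^sub>R f' s x) \<le> g x" if "s \<in> ball r e" for s
          proof (rule onorm_le)
            show "norm (h *\<^sub>R f' s x) \<le> g x * norm h" for h
              using mult_right_mono[OF bound[OF _ x, of s], of "\<bar>h\<bar>"] that
              by (auto simp: dist_real_def abs_minus_commute mult.commute)
          qed
        qed (use Y(1)[of i] \<open>e > 0\<close> in \<open>auto simp: dist_real_def abs_minus_commute\<close>)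
        thus "norm (?q (Y i) x) \<le> g x"
          using Y(2)[of i] by (simp add: divide_simps mult.commute)
      qed
    qed
    also have "(\<lambda>i. \<integral>x. ?q (Y i) x \<partial>M) = (\<lambda>i. ((\<integral>x. f (Y i) x \<partial>M) - (\<integral>x. f r x \<partial>M)) /\<^sub>R (Y i - r))"
      using int[OF Y(1)] int[of r] \<open>e > 0\<close>
      by (simp only: integral_scaleR_right Bochner_Integration.integral_diff abs_zero diff_self)
    finally have "(\<lambda>i. ((\<lambda>s. ((\<integral>x. f s x \<partial>M) - (\<integral>x. f r x \<partial>M)) /\<^sub>R (s - r)) \<circ> X) (i + N)) \<longlonglongrightarrow> (\<integral>x. f' r x \<partial>M)"
      by (simp add: Y_def)
    thus "((\<lambda>s. ((\<integral>x. f s x \<partial>M) - (\<integral>x. f r x \<partial>M)) /\<^sub>R (s - r)) \<circ> X) \<longlonglongrightarrow> (\<integral>x. f' r x \<partial>M)"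
      by (rule LIMSEQ_offset)
  qed
  thus ?thesis by (simp only: vd)
qed

lemma smooth_supp_in_polar_bounded:
  assumes "smooth_supp U"
  obtains B T where "B \<ge> 0" "T \<ge> 0" "\<And>t r \<theta> \<phi>. cmod (in_polar U t r \<theta> \<phi>) \<le> B"
    "\<And>t r \<theta> \<phi>. \<bar>t\<bar> > T \<Longrightarrow> in_polar U t r \<theta> \<phi> = 0"
proof -
  obtain B where B: "B \<ge> 0" "\<And>p. cmod (U p) \<le> B" using smooth_supp_bounded[OF assms] by blast
  obtain T where T: "\<And>p. norm p > T \<Longrightarrow> U p = 0" using assms unfolding smooth_supp_def by blast
  have "in_polar U t r \<theta> \<phi> = 0" if "\<bar>t\<bar> > max T 0" for t r \<theta> \<phi>
    unfolding in_polar_def using that norm_fst_le[of t "(r * sin \<theta> * cos \<phi>, r * sin \<theta> * sin \<phi>, r * cos \<theta>)"]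
    by (intro T) auto
  thus ?thesis using B by (intro that[of B "max T 0"]) (auto simp: in_polar_def)
qed

lemma continuous_on_in_polar:
  fixes f :: "_ :: t2_space \<Rightarrow> real"
  assumes "smooth_supp U" "continuous_on S f" "continuous_on S g" "continuous_on S h" "continuous_on S k"
  shows "continuous_on S (\<lambda>x. in_polar U (f x) (g x) (h x) (k x))"
  unfolding in_polar_def
  by (rule continuous_on_compose2[OF smooth_supp_continuous[OF assms(1)]])
    (auto intro!: continuous_on_Pair continuous_on_mult continuous_on_sin continuous_on_cos assms(2-))

section \<open>The Fourier transform in angle and time\<close>

abbreviation e_ang :: "int \<Rightarrow> real \<Rightarrow> complex" where
  "e_ang m \<phi> \<equiv> exp (- (\<i> * (of_int m * of_real \<phi>)))"

abbreviation e_time :: "real \<Rightarrow> real \<Rightarrow> complex" where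
  "e_time \<omega> t \<equiv> exp (\<i> * (of_real \<omega> * of_real t))"

text \<open>The inner integral of \<open>hat\<close> with the time exponential taken out, so that
  the integrations by parts in the angle and in time can be done one after the other.\<close>

definition angular_coeff :: "spacetime_fun \<Rightarrow> int \<Rightarrow> real \<Rightarrow> real \<Rightarrow> real \<Rightarrow> complex" where
  "angular_coeff U m t r \<theta> =
     (LINT \<phi>|lborel. indicator {0..2*pi} \<phi> *\<^sub>R (e_ang m \<phi> * in_polar U t r \<theta> \<phi>))"

lemma norm_e_ang [simp]: "cmod (e_ang m \<phi>) = 1"
  by (simp add: norm_exp_eq_Re)

lemma norm_e_time [simp]: "cmod (e_time \<omega> t) = 1"
  by (simp add: norm_exp_eq_Re)

lemma hat_eq_angular_coeff:
  "hat U \<omega> m r \<theta> = 1 / (2 * of_real pi) *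
     (LINT t|lborel. e_time \<omega> t * angular_coeff U m t r \<theta>)"
proof -
  have "exp (\<i> * of_real (\<omega> * t - of_int m * \<phi>)) =
      e_time \<omega> t * e_ang m \<phi>" for t \<phi>
    by (simp add: exp_add[symmetric] algebra_simps)
  thus ?thesis
    unfolding hat_def angular_coeff_def set_lebesgue_integral_def
    by (simp add: mult.assoc scaleR_conv_of_real mult.left_commute[of "of_real _"]
        flip: integral_mult_right_zero)
qed

lemma integrable_angular_coeff:
  assumes "smooth_supp U"
  shows "integrable lborel (\<lambda>\<phi>. indicator {0..2*pi} \<phi> *\<^sub>R (e_ang m \<phi> * in_polar U t r \<theta> \<phi>))"
  by (rule borel_integrable_atLeastAtMost'[unfolded set_integrable_def])
    (intro continuous_intros continuous_on_in_polar assms)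

lemma integrable_indicator_Icc_const: "integrable lborel (\<lambda>x::real. indicator {b..c} x * (B::real))"
  by (intro integrable_mult_left) (auto intro!: integrable_real_indicator simp: emeasure_lborel_Icc_eq)

lemma angular_coeff_bounded:
  assumes "smooth_supp U"
  obtains B T where "B \<ge> 0" "T \<ge> 0" "\<And>m t r \<theta>. cmod (angular_coeff U m t r \<theta>) \<le> B"
    "\<And>m t r \<theta>. \<bar>t\<bar> > T \<Longrightarrow> angular_coeff U m t r \<theta> = 0"
proof -
  obtain B T where BT: "B \<ge> 0" "T \<ge> 0" "\<And>t r \<theta> \<phi>. cmod (in_polar U t r \<theta> \<phi>) \<le> B"
    "\<And>t r \<theta> \<phi>. \<bar>t\<bar> > T \<Longrightarrow> in_polar U t r \<theta> \<phi> = 0"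
    by (rule smooth_supp_in_polar_bounded[OF assms]) (rule that, assumption+)
  have "cmod (angular_coeff U m t r \<theta>) \<le> (LINT \<phi>|lborel. indicator {0..2*pi} \<phi> * B)" for m t r \<theta>
    unfolding angular_coeff_def
    by (intro Bochner_Integration.integral_norm_bound_integral integrable_angular_coeff assms integrable_indicator_Icc_const)
      (use BT in \<open>auto simp: indicator_def norm_mult\<close>)
  hence "cmod (angular_coeff U m t r \<theta>) \<le> 2 * pi * B" for m t r \<theta> by simp
  moreover have "angular_coeff U m t r \<theta> = 0" if "\<bar>t\<bar> > T" for m t r \<theta>
    using BT(4)[OF that] by (simp add: angular_coeff_def)
  ultimately show ?thesis using BT(1,2) by (intro that[of "2 * pi * B" T]) simp_all
qed

lemma angular_coeff_deriv_t:
  assumes U: "smooth_supp U"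
  shows "((\<lambda>t. angular_coeff U m t r \<theta>) has_vector_derivative angular_coeff (time_deriv U) m t r \<theta>) (at t)"
proof -
  note U' = smooth_supp_time_deriv[OF U]
  obtain B T where BT: "B \<ge> 0" "T \<ge> 0" "\<And>t r \<theta> \<phi>. cmod (in_polar (time_deriv U) t r \<theta> \<phi>) \<le> B"
    "\<And>t r \<theta> \<phi>. \<bar>t\<bar> > T \<Longrightarrow> in_polar (time_deriv U) t r \<theta> \<phi> = 0"
    by (rule smooth_supp_in_polar_bounded[OF U']) (rule that, assumption+)
  show ?thesis
    unfolding angular_coeff_def
  proof (rule has_vector_derivative_lebesgue_integral[where e = 1 and g = "\<lambda>\<phi>. indicator {0..2*pi} \<phi> * B"])
    show "((\<lambda>t. indicator {0..2*pi} \<phi> *\<^sub>R (e_ang m \<phi> * in_polar U t r \<theta> \<phi>))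
      has_vector_derivative indicator {0..2*pi} \<phi> *\<^sub>R (e_ang m \<phi> * in_polar (time_deriv U) s r \<theta> \<phi>)) (at s)" for s \<phi>
      by (intro bounded_linear.has_vector_derivative[OF bounded_linear_scaleR_right]
          has_vector_derivative_mult_right in_polar_deriv_t U)
    show "norm (indicator {0..2*pi} \<phi> *\<^sub>R (e_ang m \<phi> * in_polar (time_deriv U) s r \<theta> \<phi>))
        \<le> indicator {0..2*pi} \<phi> * B" for s \<phi>
      using BT by (auto simp: indicator_def norm_mult)
  qed (use borel_measurable_integrable[OF integrable_angular_coeff[OF U', of m t r \<theta>]] in
      \<open>auto intro!: integrable_angular_coeff U integrable_indicator_Icc_const\<close>)
qed

lemma angular_coeff_deriv_r:
  assumes U: "smooth_supp U" and "r > 0"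
  shows "((\<lambda>r. angular_coeff U m t r \<theta>) has_vector_derivative (1 / r) *\<^sub>R angular_coeff (euler_deriv U) m t r \<theta>) (at r)"
proof -
  note U' = smooth_supp_euler_deriv[OF U]
  obtain B T where BT: "B \<ge> 0" "T \<ge> 0" "\<And>t r \<theta> \<phi>. cmod (in_polar (euler_deriv U) t r \<theta> \<phi>) \<le> B"
    "\<And>t r \<theta> \<phi>. \<bar>t\<bar> > T \<Longrightarrow> in_polar (euler_deriv U) t r \<theta> \<phi> = 0"
    by (rule smooth_supp_in_polar_bounded[OF U']) (rule that, assumption+)
  let ?E = "\<lambda>s \<phi>. indicator {0..2*pi} \<phi> *\<^sub>R (e_ang m \<phi> * in_polar (euler_deriv U) t s \<theta> \<phi>)"
  have "((\<lambda>r. angular_coeff U m t r \<theta>) has_vector_derivative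
      (LINT \<phi>|lborel. (1 / r) *\<^sub>R ?E r \<phi>)) (at r)"
    unfolding angular_coeff_def
  \<comment> \<open>On the ball of radius \<open>r / 2\<close> around \<open>r\<close> the factor
    \<open>1 / s\<close> from the Euler field is at most \<open>2 / r\<close>, which gives the
    dominating function.\<close>
  proof (rule has_vector_derivative_lebesgue_integral[where e = "r / 2" and g = "\<lambda>\<phi>. indicator {0..2*pi} \<phi> * (2 / r * B)"
        and f' = "\<lambda>s \<phi>. (1 / s) *\<^sub>R ?E s \<phi>"])
    fix s \<phi> assume s: "\<bar>s - r\<bar> < r / 2"
    hence s': "s > 0" "1 / s \<le> 2 / r" using \<open>r > 0\<close> by (auto simp: field_simps abs_if split: if_splits)
    have "((\<lambda>s. indicator {0..2*pi} \<phi> *\<^sub>R (e_ang m \<phi> * in_polar U t s \<theta> \<phi>))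
      has_vector_derivative indicator {0..2*pi} \<phi> *\<^sub>R (e_ang m \<phi> *
        ((1 / s) *\<^sub>R in_polar (euler_deriv U) t s \<theta> \<phi>))) (at s)"
      using s' by (intro bounded_linear.has_vector_derivative[OF bounded_linear_scaleR_right]
          has_vector_derivative_mult_right in_polar_deriv_r U) auto
    thus "((\<lambda>s. indicator {0..2*pi} \<phi> *\<^sub>R (e_ang m \<phi> * in_polar U t s \<theta> \<phi>))
      has_vector_derivative (1 / s) *\<^sub>R ?E s \<phi>) (at s)"
      by (simp add: mult.commute)
    have "norm ((1 / s) *\<^sub>R ?E s \<phi>) = (1 / s) * (indicator {0..2*pi} \<phi> * cmod (in_polar (euler_deriv U) t s \<theta> \<phi>))"
      using s' by (simp add: norm_mult)
    also have "\<dots> \<le> (2 / r) * (indicator {0..2*pi} \<phi> * B)"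
      using s' BT \<open>r > 0\<close> by (intro mult_mono) auto
    finally show "norm ((1 / s) *\<^sub>R ?E s \<phi>) \<le> indicator {0..2*pi} \<phi> * (2 / r * B)"
      by (simp add: mult_ac)
  qed (use \<open>r > 0\<close> borel_measurable_scaleR[OF borel_measurable_const
        borel_measurable_integrable[OF integrable_angular_coeff[OF U', of m t r \<theta>]], of "1 / r"] in
      \<open>auto intro!: integrable_angular_coeff U integrable_indicator_Icc_const simp del: scaleR_scaleR\<close>)
  thus ?thesis by (simp only: integral_scaleR_right angular_coeff_def)
qed

text \<open>Integration by parts over a full period; derivatives in the angle become factors
  \<open>m\<close>.\<close>

lemma angular_coeff_angular_deriv:
  assumes U: "smooth_supp U"
  shows "angular_coeff (angular_deriv U) m t r \<theta> = \<i> * of_int m * angular_coeff U m t r \<theta>"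
proof -
  note U' = smooth_supp_angular_deriv[OF U]
  let ?e = "\<lambda>\<phi>. e_ang m \<phi>"
  let ?F = "\<lambda>\<phi>. ?e \<phi> * in_polar U t r \<theta> \<phi>"
  let ?f = "\<lambda>\<phi>. ?e \<phi> * in_polar (angular_deriv U) t r \<theta> \<phi> - \<i> * of_int m * (?e \<phi> * in_polar U t r \<theta> \<phi>)"
  have e: "(?e has_vector_derivative - (\<i> * of_int m) * ?e \<phi>) (at \<phi>)" for \<phi>
    by (auto intro!: derivative_eq_intros has_vector_derivative_real_field simp: mult_ac)
  have "(?F has_vector_derivative ?f \<phi>) (at \<phi>)" for \<phi>
    using has_vector_derivative_mult[OF e[of \<phi>] in_polar_deriv_phi[OF U, of t r \<theta> \<phi>]] by (simp add: algebra_simps)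
  hence "(?F has_vector_derivative ?f \<phi>) (at \<phi> within {0..2*pi})" for \<phi>
    by (rule has_vector_derivative_at_within)
  moreover have "continuous_on {0..2*pi} ?f"
    by (intro continuous_intros continuous_on_in_polar U U')
  ultimately have "(LINT \<phi>|lborel. indicator {0..2*pi} \<phi> *\<^sub>R ?f \<phi>) = ?F (2 * pi) - ?F 0"
    by (intro integral_FTC_atLeastAtMost) simp_all
  \<comment> \<open>No boundary term survives: \<open>in_polar\<close> is periodic in the angle, and
    so is the exponential because \<open>m\<close> is an integer.\<close>
  also have "?F (2 * pi) = ?F 0"
  proof -
    have "exp (- (\<i> * (of_int m * of_real (2 * pi)))) = 1"
      using exp_integer_2pi[of "of_int (- m)"] by (simp add: mult_ac)
    thus ?thesis by (simp add: in_polar_def)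
  qed
  finally have "(LINT \<phi>|lborel. indicator {0..2*pi} \<phi> *\<^sub>R ?f \<phi>) = 0" by simp
  moreover have "(LINT \<phi>|lborel. indicator {0..2*pi} \<phi> *\<^sub>R ?f \<phi>) =
     (LINT \<phi>|lborel. indicator {0..2*pi} \<phi> *\<^sub>R (?e \<phi> * in_polar (angular_deriv U) t r \<theta> \<phi>) -
        \<i> * of_int m * (indicator {0..2*pi} \<phi> *\<^sub>R (?e \<phi> * in_polar U t r \<theta> \<phi>)))"
    by (intro Bochner_Integration.integral_cong) (auto simp: indicator_def)
  moreover have "\<dots> = angular_coeff (angular_deriv U) m t r \<theta> - \<i> * of_int m * angular_coeff U m t r \<theta>"
    unfolding angular_coeff_def
    by (subst Bochner_Integration.integral_diff, (intro integrable_angular_coeff U U' integrable_mult_right)+,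
        simp only: integral_mult_right_zero)
  ultimately show ?thesis by simp
qed

lemma hat_angular_deriv:
  "smooth_supp U \<Longrightarrow> hat (angular_deriv U) \<omega> m r \<theta> = \<i> * of_int m * hat U \<omega> m r \<theta>"
  unfolding hat_eq_angular_coeff
  by (simp add: angular_coeff_angular_deriv mult.left_commute[of _ "\<i> * of_int m"])

lemma continuous_angular_coeff:
  assumes "smooth_supp U" shows "continuous_on S (\<lambda>t. angular_coeff U m t r \<theta>)"
  by (intro continuous_at_imp_continuous_on ballI has_vector_derivative_continuous[OF angular_coeff_deriv_t] assms)

lemma integrable_hat:
  assumes U: "smooth_supp U"
  shows "integrable lborel (\<lambda>t. e_time \<omega> t * angular_coeff U m t r \<theta>)"
proof -
  obtain B T where BT: "B \<ge> 0" "T \<ge> 0" "\<And>m t r \<theta>. cmod (angular_coeff U m t r \<theta>) \<le> B"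
    "\<And>m t r \<theta>. \<bar>t\<bar> > T \<Longrightarrow> angular_coeff U m t r \<theta> = 0"
    by (rule angular_coeff_bounded[OF U]) (rule that, assumption+)
  show ?thesis
  proof (rule Bochner_Integration.integrable_bound[OF integrable_indicator_Icc_const[of "-T" T B]])
    show "AE t in lborel. norm (e_time \<omega> t * angular_coeff U m t r \<theta>) \<le> norm (indicator {-T..T} t * B)"
      using BT by (intro AE_I2) (auto simp: norm_mult indicator_def abs_le_iff not_le)
    show "(\<lambda>t. e_time \<omega> t * angular_coeff U m t r \<theta>) \<in> borel_measurable lborel"
      by (auto intro!: borel_measurable_continuous_onI continuous_intros continuous_angular_coeff U)
  qed
qed

lemma hat_bounded:
  assumes U: "smooth_supp U"
  obtains B where "B \<ge> 0" "\<And>\<omega> m r \<theta>. cmod (hat U \<omega> m r \<theta>) \<le> B"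
proof -
  obtain B T where BT: "B \<ge> 0" "T \<ge> 0" "\<And>m t r \<theta>. cmod (angular_coeff U m t r \<theta>) \<le> B"
    "\<And>m t r \<theta>. \<bar>t\<bar> > T \<Longrightarrow> angular_coeff U m t r \<theta> = 0"
    by (rule angular_coeff_bounded[OF U]) (rule that, assumption+)
  have "cmod (LINT t|lborel. e_time \<omega> t * angular_coeff U m t r \<theta>)
      \<le> (LINT t|lborel. indicator {-T..T} t * B)" for \<omega> m r \<theta>
    using BT by (intro Bochner_Integration.integral_norm_bound_integral integrable_hat U integrable_indicator_Icc_const)
      (auto simp: norm_mult indicator_def abs_le_iff not_le)
  hence le: "cmod (LINT t|lborel. e_time \<omega> t * angular_coeff U m t r \<theta>) \<le> 2 * T * B" for \<omega> m r \<theta>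
    using BT by simp
  have "cmod (hat U \<omega> m r \<theta>) \<le> 1 / (2 * pi) * (2 * T * B)" for \<omega> m r \<theta>
    unfolding hat_eq_angular_coeff using divide_right_mono[OF le[of \<omega> m r \<theta>], of "2 * pi"]
    by (simp add: norm_mult norm_divide)
  thus ?thesis using BT by (intro that[of "1 / (2 * pi) * (2 * T * B)"]) auto
qed

text \<open>Integration by parts in time. The transform carries the exponent with the positive sign,
  whence the minus sign in front of \<open>\<omega>\<close>.\<close>

lemma hat_time_deriv:
  assumes U: "smooth_supp U"
  shows "hat (time_deriv U) \<omega> m r \<theta> = - (\<i> * of_real \<omega>) * hat U \<omega> m r \<theta>"
proof -
  note U' = smooth_supp_time_deriv[OF U]
  obtain T where T: "T \<ge> 0" "\<And>m t r \<theta>. \<bar>t\<bar> > T \<Longrightarrow> angular_coeff U m t r \<theta> = 0"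
    by (rule angular_coeff_bounded[OF U]) (rule that, assumption+)
  obtain T' where T': "T' \<ge> 0" "\<And>m t r \<theta>. \<bar>t\<bar> > T' \<Longrightarrow> angular_coeff (time_deriv U) m t r \<theta> = 0"
    by (rule angular_coeff_bounded[OF U']) (rule that, assumption+)
  \<comment> \<open>Beyond both supports: the boundary terms vanish, and the integral over
    \<open>{-R..R}\<close> is the integral over the line.\<close>
  define R where "R = max T T' + 1"
  let ?e = "\<lambda>t. e_time \<omega> t"
  let ?F = "\<lambda>t. ?e t * angular_coeff U m t r \<theta>"
  let ?f = "\<lambda>t. ?e t * angular_coeff (time_deriv U) m t r \<theta> + \<i> * of_real \<omega> * (?e t * angular_coeff U m t r \<theta>)"
  have e: "(?e has_vector_derivative (\<i> * of_real \<omega>) * ?e t) (at t)" for t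
    by (auto intro!: derivative_eq_intros has_vector_derivative_real_field simp: mult_ac)
  have "(?F has_vector_derivative ?f t) (at t)" for t
    using has_vector_derivative_mult[OF e[of t] angular_coeff_deriv_t[OF U, of m r \<theta> t]] by (simp add: algebra_simps)
  hence "(?F has_vector_derivative ?f t) (at t within {-R..R})" for t
    by (rule has_vector_derivative_at_within)
  moreover have "continuous_on {-R..R} ?f"
    by (intro continuous_intros continuous_angular_coeff U U')
  moreover have "-R \<le> R" using T(1) by (simp add: R_def)
  ultimately have "(LINT t|lborel. indicator {-R..R} t *\<^sub>R ?f t) = ?F R - ?F (-R)"
    by (intro integral_FTC_atLeastAtMost) simp_all
  also have "\<dots> = 0" using T by (simp add: R_def)
  also have "(LINT t|lborel. indicator {-R..R} t *\<^sub>R ?f t) = (LINT t|lborel. ?f t)"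
  proof (intro Bochner_Integration.integral_cong refl)
    fix t
    show "indicator {-R..R} t *\<^sub>R ?f t = ?f t"
      using T(2)[of t] T'(2)[of t] by (cases "t \<in> {-R..R}") (auto simp: R_def)
  qed
  also have "\<dots> = (LINT t|lborel. ?e t * angular_coeff (time_deriv U) m t r \<theta>) +
      \<i> * of_real \<omega> * (LINT t|lborel. ?e t * angular_coeff U m t r \<theta>)"
    by (subst Bochner_Integration.integral_add) (auto intro!: integrable_hat U U' integrable_mult_right)
  finally have "(LINT t|lborel. ?e t * angular_coeff (time_deriv U) m t r \<theta>) =
      - (\<i> * of_real \<omega>) * (LINT t|lborel. ?e t * angular_coeff U m t r \<theta>)"
    by (simp add: add_eq_0_iff)
  thus ?thesis unfolding hat_eq_angular_coeff by simp
qed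

lemma hat_has_vector_derivative_r:
  assumes U: "smooth_supp U" and "r > 0"
  shows "((\<lambda>r. hat U \<omega> m r \<theta>) has_vector_derivative (1 / r) *\<^sub>R hat (euler_deriv U) \<omega> m r \<theta>) (at r)"
proof -
  note U' = smooth_supp_euler_deriv[OF U]
  obtain B T where BT: "B \<ge> 0" "T \<ge> 0" "\<And>m t r \<theta>. cmod (angular_coeff (euler_deriv U) m t r \<theta>) \<le> B"
    "\<And>m t r \<theta>. \<bar>t\<bar> > T \<Longrightarrow> angular_coeff (euler_deriv U) m t r \<theta> = 0"
    by (rule angular_coeff_bounded[OF U']) (rule that, assumption+)
  let ?e = "\<lambda>t. e_time \<omega> t"
  have "((\<lambda>r. LINT t|lborel. ?e t * angular_coeff U m t r \<theta>) has_vector_derivative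
     (LINT t|lborel. (1 / r) *\<^sub>R (?e t * angular_coeff (euler_deriv U) m t r \<theta>))) (at r)"
  proof (rule has_vector_derivative_lebesgue_integral[where e = "r / 2" and g = "\<lambda>t. indicator {-T..T} t * (2 / r * B)"
        and f' = "\<lambda>s t. (1 / s) *\<^sub>R (?e t * angular_coeff (euler_deriv U) m t s \<theta>)"])
    fix s t assume s: "\<bar>s - r\<bar> < r / 2"
    hence s': "s > 0" "1 / s \<le> 2 / r" using \<open>r > 0\<close> by (auto simp: field_simps abs_if split: if_splits)
    have "((\<lambda>s. ?e t * angular_coeff U m t s \<theta>) has_vector_derivative
        ?e t * ((1 / s) *\<^sub>R angular_coeff (euler_deriv U) m t s \<theta>)) (at s)"
      using s' by (intro has_vector_derivative_mult_right angular_coeff_deriv_r U)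
    thus "((\<lambda>s. ?e t * angular_coeff U m t s \<theta>) has_vector_derivative
        (1 / s) *\<^sub>R (?e t * angular_coeff (euler_deriv U) m t s \<theta>)) (at s)" by simp
    have "norm ((1 / s) *\<^sub>R (?e t * angular_coeff (euler_deriv U) m t s \<theta>)) = (1 / s) * cmod (angular_coeff (euler_deriv U) m t s \<theta>)"
      using s' by (simp add: norm_mult)
    also have "\<dots> \<le> (2 / r) * (indicator {-T..T} t * B)"
      using s' BT \<open>r > 0\<close> by (intro mult_mono) (auto simp: indicator_def abs_le_iff not_le)
    finally show "norm ((1 / s) *\<^sub>R (?e t * angular_coeff (euler_deriv U) m t s \<theta>)) \<le> indicator {-T..T} t * (2 / r * B)"
      by (simp add: mult_ac)
  qed (use \<open>r > 0\<close> borel_measurable_integrable[OF integrable_hat[OF U', of \<omega> m r \<theta>]] in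
      \<open>auto intro!: integrable_hat U integrable_indicator_Icc_const\<close>)
  hence "((\<lambda>r. 1 / (2 * of_real pi) * (LINT t|lborel. ?e t * angular_coeff U m t r \<theta>)) has_vector_derivative
     1 / (2 * of_real pi) * ((1 / r) *\<^sub>R (LINT t|lborel. ?e t * angular_coeff (euler_deriv U) m t r \<theta>))) (at r)"
    unfolding integral_scaleR_right by (intro has_vector_derivative_mult_right)
  thus ?thesis unfolding hat_eq_angular_coeff by simp
qed

lemma borel_measurable_hat [measurable]:
  assumes U: "smooth_supp U"
  shows "(\<lambda>\<omega>. hat U \<omega> m r \<theta>) \<in> borel_measurable borel"
proof -
  have [measurable]: "(\<lambda>t. angular_coeff U m t r \<theta>) \<in> borel_measurable borel"
    by (intro borel_measurable_continuous_onI continuous_angular_coeff U)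
  show ?thesis unfolding hat_eq_angular_coeff by measurable
qed

text \<open>The product form separates the sum over \<open>m\<close> from the integral over
  \<open>\<omega>\<close>; the squares correspond to two derivatives in each variable and make both
  converge.\<close>

definition decay :: "int \<times> real \<Rightarrow> real" where
  "decay k = 1 / ((1 + (of_int (fst k))\<^sup>2) * (1 + (snd k)\<^sup>2))"

lemma decay_pos: "decay k > 0"
  unfolding decay_def by (intro divide_pos_pos mult_pos_pos) (auto simp: add_pos_nonneg)

lemma decay_le_1: "decay k \<le> 1"
proof -
  have "1 * 1 \<le> (1 + (real_of_int (fst k))\<^sup>2) * (1 + (snd k)\<^sup>2)"
    by (rule mult_mono) auto
  thus ?thesis unfolding decay_def by simp
qed

text \<open>Expanding \<open>(1 + m\<^sup>2) * (1 + \<omega>\<^sup>2)\<close> yields four terms,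
  each the modulus of the transform of a derivative of \<open>U\<close>, and transforms are bounded.
  The bound is uniform in \<open>r\<close> and \<open>\<theta>\<close>, as differentiation in
  \<open>r\<close> under the convolution will demand.\<close>

lemma hat_decay:
  assumes U: "smooth_supp U"
  obtains B where "B \<ge> 0" "\<And>\<omega> m r \<theta>. cmod (hat U \<omega> m r \<theta>) \<le> B * decay (m, \<omega>)"
proof -
  let ?T = "\<lambda>U. time_deriv (time_deriv U)" and ?A = "\<lambda>U. angular_deriv (angular_deriv U)"
  note S = smooth_supp_time_deriv smooth_supp_angular_deriv
  obtain B1 where B1: "\<And>\<omega> m r \<theta>. cmod (hat U \<omega> m r \<theta>) \<le> B1" by (rule hat_bounded[OF U]) (rule that, assumption+)
  obtain B2 where B2: "\<And>\<omega> m r \<theta>. cmod (hat (?T U) \<omega> m r \<theta>) \<le> B2"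
    by (rule hat_bounded[OF S(1)[OF S(1)[OF U]]]) (rule that, assumption+)
  obtain B3 where B3: "\<And>\<omega> m r \<theta>. cmod (hat (?A U) \<omega> m r \<theta>) \<le> B3"
    by (rule hat_bounded[OF S(2)[OF S(2)[OF U]]]) (rule that, assumption+)
  obtain B4 where B4: "\<And>\<omega> m r \<theta>. cmod (hat (?A (?T U)) \<omega> m r \<theta>) \<le> B4"
    by (rule hat_bounded[OF S(2)[OF S(2)[OF S(1)[OF S(1)[OF U]]]]]) (rule that, assumption+)
  have le: "cmod (hat U \<omega> m r \<theta>) \<le> (B1 + B2 + B3 + B4) * decay (m, \<omega>)" for \<omega> m r \<theta>
  proof -
    let ?h = "cmod (hat U \<omega> m r \<theta>)"
    have 2: "\<omega>\<^sup>2 * ?h \<le> B2"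
      using B2[of \<omega> m r \<theta>] by (simp add: hat_time_deriv S U norm_mult power2_eq_square mult.assoc)
    have 3: "(of_int m)\<^sup>2 * ?h \<le> B3"
      using B3[of \<omega> m r \<theta>] by (simp add: hat_angular_deriv S U norm_mult power2_eq_square mult.assoc)
    have 4: "(of_int m)\<^sup>2 * \<omega>\<^sup>2 * ?h \<le> B4"
      using B4[of \<omega> m r \<theta>]
      by (simp add: hat_angular_deriv hat_time_deriv S U norm_mult power2_eq_square mult.assoc)
    have "?h * ((1 + (of_int m)\<^sup>2) * (1 + \<omega>\<^sup>2)) = ?h + \<omega>\<^sup>2 * ?h + (of_int m)\<^sup>2 * ?h + (of_int m)\<^sup>2 * \<omega>\<^sup>2 * ?h"
      by (simp add: algebra_simps)
    also have "\<dots> \<le> B1 + B2 + B3 + B4" using B1[of \<omega> m r \<theta>] 2 3 4 by linarith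
    finally show ?thesis
      using decay_pos[of "(m, \<omega>)"] by (simp add: decay_def pos_le_divide_eq)
  qed
  have "0 \<le> B1 + B2 + B3 + B4"
    using le[of 0 0 0 0] decay_pos[of "(0, 0)"] by (meson norm_ge_zero order_trans zero_le_mult_iff not_less)
  with le show ?thesis by (intro that)
qed

section \<open>Convolutions of transforms\<close>

text \<open>On the half line the primitive \<open>arctan\<close> is bounded; reflection gives the
  other half, and at 0, where the two overlap, domination is enough.\<close>

lemma integrable_inverse_one_plus_square: "integrable lborel (\<lambda>x::real. 1 / (1 + x\<^sup>2))"
proof -
  have pos: "1 + x\<^sup>2 > 0" for x :: real by (simp add: add_pos_nonneg)
  let ?g = "\<lambda>x::real. indicator {0..} x * (1 / (1 + x\<^sup>2))"
  have "(\<integral>\<^sup>+x. ennreal (1 / (1 + x\<^sup>2)) * indicator {0::real..} x \<partial>lborel) = ennreal (pi / 2 - arctan 0)"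
  proof (rule nn_integral_FTC_atLeast[OF _ _ _ tendsto_arctan_at_top])
    show "DERIV arctan x :> 1 / (1 + x\<^sup>2)" for x :: real
      using DERIV_arctan[of x] by (simp add: inverse_eq_divide)
    show "0 \<le> 1 / (1 + x\<^sup>2)" for x :: real using pos[of x] by simp
  qed measurable
  hence "(\<integral>\<^sup>+x. ennreal (norm (?g x)) \<partial>lborel) < \<infinity>"
    by (subst nn_integral_cong[where v = "\<lambda>x. ennreal (1 / (1 + x\<^sup>2)) * indicator {0::real..} x"])
      (auto simp: indicator_def)
  hence g: "integrable lborel ?g" by (intro integrableI_bounded) auto
  have "integrable lborel (\<lambda>x. ?g x + ?g (0 + (-1) * x))"
    by (intro Bochner_Integration.integrable_add g lborel_integrable_real_affine) simp
  thus ?thesis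
    by (rule Bochner_Integration.integrable_bound) (auto simp: indicator_def)
qed

text \<open>The notion of \<open>Infinite_Set_Sum\<close> is integrability over
  \<open>count_space\<close>, the form in which Fubini on \<open>freq_space\<close> asks for
  summability.\<close>

lemma abs_summable_on_inverse_one_plus_square_int:
  "Infinite_Set_Sum.abs_summable_on (\<lambda>m::int. 1 / (1 + (real_of_int m)\<^sup>2)) UNIV"
proof -
  let ?f = "\<lambda>m::int. 1 / (1 + (real_of_int m)\<^sup>2)"
  have "summable (\<lambda>n. norm (?f (int n)))"
  proof (rule summable_comparison_test[OF _ inverse_power_summable[of 2]])
    show "\<exists>N. \<forall>n\<ge>N. norm (norm (?f (int n))) \<le> inverse (real n ^ 2)"
      by (intro exI[of _ 1] allI impI) (auto simp: inverse_eq_divide intro!: divide_left_mono mult_pos_pos add_pos_nonneg)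
  qed simp
  hence nat: "Infinite_Set_Sum.abs_summable_on (\<lambda>n::nat. ?f (int n)) UNIV" by (simp only: abs_summable_on_nat_iff')
  have "Infinite_Set_Sum.abs_summable_on ?f (range int)"
    using nat by (subst (asm) abs_summable_on_reindex_iff) auto
  moreover have "Infinite_Set_Sum.abs_summable_on ?f (range (\<lambda>n. - int n))"
    using nat abs_summable_on_reindex_iff[of "\<lambda>n. - int n" UNIV ?f] by (auto simp: inj_on_def)
  ultimately have "Infinite_Set_Sum.abs_summable_on ?f (range int \<union> range (\<lambda>n. - int n))" by (rule abs_summable_on_union)
  also have "range int \<union> range (\<lambda>n. - int n) = UNIV"
  proof (intro equalityI subset_UNIV subsetI)
    fix m :: int
    have "m = int (nat m) \<or> m = - int (nat (- m))" by auto
    thus "m \<in> range int \<union> range (\<lambda>n. - int n)" by blast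
  qed
  finally show ?thesis .
qed

lemma borel_measurable_decay [measurable]: "decay \<in> borel_measurable freq_space"
  unfolding decay_def[abs_def] measurable_freq_space_iff by auto

lemma integrable_decay: "integrable freq_space decay"
  unfolding freq_space_def
proof (rule freq.Fubini_integrable)
  show "decay \<in> borel_measurable (count_space UNIV \<Otimes>\<^sub>M lborel)"
    using borel_measurable_decay by (simp add: freq_space_def)
  have d: "decay (m, \<omega>) = (1 / (1 + (of_int m)\<^sup>2)) * (1 / (1 + \<omega>\<^sup>2))" for m \<omega>
    by (simp add: decay_def)
  show "AE m in count_space UNIV. integrable lborel (\<lambda>\<omega>. decay (m, \<omega>))"
    unfolding d by (intro AE_I2 integrable_mult_right integrable_inverse_one_plus_square)
  have "(\<lambda>m. LINT \<omega>|lborel. norm (decay (m, \<omega>))) = 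
      (\<lambda>m. (1 / (1 + (of_int m)\<^sup>2)) * (LINT \<omega>|lborel. 1 / (1 + \<omega>\<^sup>2)))"
    by (intro ext) (simp only: real_norm_def abs_of_pos[OF decay_pos], simp only: d integral_mult_right_zero)
  thus "integrable (count_space UNIV) (\<lambda>m. LINT \<omega>|lborel. norm (decay (m, \<omega>)))"
    using abs_summable_on_inverse_one_plus_square_int by (simp only: abs_summable_on_def integrable_mult_left)
qed

text \<open>The slice at one \<open>(r, \<theta>)\<close> as a function on
  \<open>freq_space\<close>; all estimates on frequency space are made slice by slice.\<close>

definition fiber :: "freqfun \<Rightarrow> real \<Rightarrow> real \<Rightarrow> int \<times> real \<Rightarrow> complex" where
  "fiber f r \<theta> k = f (snd k) (fst k) r \<theta>"

text \<open>Fubini. Integrability of the product is assumed because \<open>infsum\<close> is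
  identified with the Bochner integral over \<open>count_space\<close> for absolutely summable
  families.\<close>

lemma conv_eq_kconv:
  assumes "integrable freq_space (\<lambda>k'. fiber f r \<theta> k' * fiber g r \<theta> ((m, \<omega>) - k'))"
  shows "conv f g \<omega> m r \<theta> = kconv (\<lambda>_ _. 1) (fiber f r \<theta>) (fiber g r \<theta>) (m, \<omega>)"
proof -
  let ?h = "\<lambda>k'. fiber f r \<theta> k' * fiber g r \<theta> ((m, \<omega>) - k')"
  have int: "integrable (count_space UNIV \<Otimes>\<^sub>M lborel) ?h" using assms by (simp add: freq_space_def)
  have "kconv (\<lambda>_ _. 1) (fiber f r \<theta>) (fiber g r \<theta>) (m, \<omega>) =
      (LINT m'|count_space UNIV. LINT \<omega>'|lborel. ?h (m', \<omega>'))"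
    unfolding kconv_def freq_space_def using freq.integral_fst'[OF int] by simp
  also have "\<dots> = (\<Sum>\<^sub>\<infinity>m'\<in>UNIV. LINT \<omega>'|lborel. ?h (m', \<omega>'))"
    unfolding infsetsum_def[symmetric]
    by (rule infsetsum_infsum) (use freq.integrable_fst'[OF int] in \<open>simp add: abs_summable_on_def\<close>)
  finally show ?thesis by (simp add: conv_def fiber_def)
qed

section \<open>Decaying functions on frequency space\<close>

definition decaying :: "(int \<times> real \<Rightarrow> complex) \<Rightarrow> bool" where
  "decaying A \<longleftrightarrow> A \<in> borel_measurable freq_space \<and> (\<exists>B. \<forall>k. cmod (A k) \<le> B * decay k)"

lemma decaying_add:
  assumes "decaying A" "decaying B"
  shows "decaying (\<lambda>k. A k + B k)"
proof -
  obtain b c where bc: "\<And>k. cmod (A k) \<le> b * decay k" "\<And>k. cmod (B k) \<le> c * decay k"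
    using assms unfolding decaying_def by blast
  have "cmod (A k + B k) \<le> (b + c) * decay k" for k
    unfolding distrib_right by (rule norm_triangle_le[OF add_mono[OF bc]])
  thus ?thesis using assms unfolding decaying_def by auto
qed

lemma decaying_bounded_mult:
  assumes A: "decaying A" and [measurable]: "s \<in> borel_measurable freq_space"
    and C: "\<And>k. cmod (s k) \<le> C"
  shows "decaying (\<lambda>k. s k * A k)"
proof -
  obtain B where B: "\<And>k. cmod (A k) \<le> B * decay k" and [measurable]: "A \<in> borel_measurable freq_space"
    using A unfolding decaying_def by blast
  have "cmod (s k * A k) \<le> (C * B) * decay k" for k
    using mult_mono[OF C[of k] B[of k]] order_trans[OF norm_ge_zero C[of k]] by (simp add: norm_mult mult.assoc)
  thus ?thesis unfolding decaying_def by auto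
qed

lemma decaying_cmult: "decaying A \<Longrightarrow> decaying (\<lambda>k. c * A k)"
  by (rule decaying_bounded_mult) auto

lemma decayingE:
  assumes "decaying A"
  obtains B where "B \<ge> 0" "\<And>k. cmod (A k) \<le> B * decay k" "\<And>k. cmod (A k) \<le> B" 
    "A \<in> borel_measurable freq_space"
proof -
  obtain B where B: "\<And>k. cmod (A k) \<le> B * decay k" and m: "A \<in> borel_measurable freq_space"
    using assms unfolding decaying_def by blast
  have B0: "B \<ge> 0" using order_trans[OF norm_ge_zero B[of "(0,0)"]] decay_pos[of "(0,0)"]
    by (simp add: zero_le_mult_iff not_le[symmetric])
  have "cmod (A k) \<le> B" for k
    using B[of k] mult_left_mono[OF decay_le_1[of k] B0] by simp
  thus ?thesis using B0 B m by (intro that)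
qed

lemma decaying_integrable:
  assumes "decaying A" shows "integrable freq_space A"
proof -
  obtain B where B: "B \<ge> 0" "\<And>k. cmod (A k) \<le> B * decay k" "\<And>k. cmod (A k) \<le> B"
    and [measurable]: "A \<in> borel_measurable freq_space" using assms by (rule decayingE) (rule that, assumption+)
  show ?thesis
    by (rule Bochner_Integration.integrable_bound[OF integrable_mult_right[OF integrable_decay, of B]])
      (use B decay_pos in \<open>auto simp: abs_mult less_imp_le intro!: AE_I2\<close>)
qed

lemma decaying_wL1_finite: "decaying A \<Longrightarrow> wL1 (\<lambda>_. 1) A < \<infinity>"
  using decaying_integrable[of A] by (simp add: wL1_def integrable_iff_bounded)

lemma decaying_wL2sq_finite:
  assumes "decaying A" shows "wL2sq (\<lambda>_. 1) A < \<infinity>"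
proof -
  obtain B where B: "B \<ge> 0" "\<And>k. cmod (A k) \<le> B * decay k" "\<And>k. cmod (A k) \<le> B"
    and [measurable]: "A \<in> borel_measurable freq_space" using assms by (rule decayingE) (rule that, assumption+)
  have "integrable freq_space (\<lambda>k. A k * A k)"
    using decaying_integrable[OF decaying_bounded_mult[OF assms _ B(3)]] by simp
  thus ?thesis by (simp add: wL2sq_def integrable_iff_bounded norm_mult power2_eq_square)
qed

text \<open>One factor is integrable and the other is bounded, so the integral converges at every
  \<open>k\<close>; this makes the algebra of the commutators exact on transforms.\<close>

lemma integrable_kconv_decaying:
  assumes "decaying A" "decaying B" and [measurable]: "s \<in> borel_measurable freq_space" and "\<And>k. cmod (s k) \<le> C"
  shows "integrable freq_space (\<lambda>k'. s k' * (A k' * B (k - k')))"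
proof -
  obtain b where b: "b \<ge> 0" "\<And>k. cmod (B k) \<le> b * decay k" "\<And>k. cmod (B k) \<le> b"
    and [measurable]: "B \<in> borel_measurable freq_space" using assms(2) by (rule decayingE) (rule that, assumption+)
  have "decaying (\<lambda>k'. (s k' * B (k - k')) * A k')"
    by (rule decaying_bounded_mult[OF assms(1), where C = "C * b"])
      (use order_trans[OF norm_ge_zero assms(4)] in \<open>auto simp: norm_mult intro!: mult_mono assms(4) b\<close>)
  from decaying_integrable[OF this] show ?thesis by (simp add: mult_ac)
qed

lemma decaying_fiber_hat:
  assumes "smooth_supp U" shows "decaying (fiber (hat U) r \<theta>)"
proof -
  obtain B where B: "B \<ge> 0" "\<And>\<omega> m r \<theta>. cmod (hat U \<omega> m r \<theta>) \<le> B * decay (m, \<omega>)"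
    by (rule hat_decay[OF assms]) (rule that, assumption+)
  have "fiber (hat U) r \<theta> \<in> borel_measurable freq_space"
    unfolding measurable_freq_space_iff fiber_def using borel_measurable_hat[OF assms] by simp
  moreover have "\<forall>k. cmod (fiber (hat U) r \<theta> k) \<le> B * decay k"
    by (simp add: fiber_def B(2))
  ultimately show ?thesis unfolding decaying_def by blast
qed

lemma Rstar_hat:
  assumes "smooth_supp U" "r > 0"
  shows "Rstar M a (hat U) \<omega> m r \<theta> = of_real (Delta M a r / (r\<^sup>2 + a\<^sup>2) / r) * hat (euler_deriv U) \<omega> m r \<theta>"
  unfolding Rstar_def vector_derivative_at[OF hat_has_vector_derivative_r[OF assms]]
  by (simp add: scaleR_conv_of_real)

lemma decaying_fiber_Rstar_hat:
  assumes "smooth_supp U" "r > 0"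
  shows "decaying (fiber (Rstar M a (hat U)) r \<theta>)"
  using decaying_cmult[OF decaying_fiber_hat[OF smooth_supp_euler_deriv[OF assms(1)], of r \<theta>]]
  unfolding fiber_def[abs_def] Rstar_hat[OF assms] .

text \<open>The multiplier is unbounded, but the product is up to a constant the transform of a time
  derivative and decays as such.\<close>

lemma decaying_times_omega:
  assumes "smooth_supp U" shows "decaying (\<lambda>k. of_real (snd k) * fiber (hat U) r \<theta> k)"
proof -
  have "of_real (snd k) * fiber (hat U) r \<theta> k = \<i> * fiber (hat (time_deriv U)) r \<theta> k" for k
    by (simp add: fiber_def hat_time_deriv[OF assms] flip: mult.assoc)
  thus ?thesis using decaying_cmult[OF decaying_fiber_hat[OF smooth_supp_time_deriv[OF assms]]] by simp
qed

lemma decaying_times_m: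
  assumes "smooth_supp U" shows "decaying (\<lambda>k. of_int (fst k) * fiber (hat U) r \<theta> k)"
proof -
  have "of_int (fst k) * fiber (hat U) r \<theta> k = - \<i> * fiber (hat (angular_deriv U)) r \<theta> k" for k
    by (simp add: fiber_def hat_angular_deriv[OF assms] flip: mult.assoc)
  thus ?thesis
    using decaying_cmult[OF decaying_fiber_hat[OF smooth_supp_angular_deriv[OF assms]], of "- \<i>"] by presburger
qed

text \<open>As with \<open>Wzero\<close>, the derivative is a separate argument, since an element of
  the closures is a limit together with the limit of the derivatives.\<close>

definition Wplus_pair :: "real \<Rightarrow> real \<Rightarrow> freqfun \<Rightarrow> freqfun \<Rightarrow> freqfun" where
  "Wplus_pair M a f F \<omega> m r \<theta> = of_real (1 / vfun M a r) *
     (F \<omega> m r \<theta> - \<i> * of_real (\<omega> - omega_r a m r) * f \<omega> m r \<theta>)"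

lemma Wplus_eq_Wplus_pair: "Wplus M a f = Wplus_pair M a f (Rstar M a f)"
  by (intro ext) (simp add: Wplus_def Wplus_pair_def)

lemma decaying_symbol_combination:
  assumes "smooth_supp U" "r > 0"
  shows "decaying (\<lambda>k. of_real b * (fiber (Rstar M a (hat U)) r \<theta> k -
      \<i> * of_real (c * (snd k - omega_r a (fst k) r)) * fiber (hat U) r \<theta> k))"
proof -
  have "decaying (\<lambda>k. of_real b * (fiber (Rstar M a (hat U)) r \<theta> k +
      ((- \<i> * of_real c) * (of_real (snd k) * fiber (hat U) r \<theta> k) +
       (\<i> * of_real c * of_real (a / (r\<^sup>2 + a\<^sup>2))) * (of_int (fst k) * fiber (hat U) r \<theta> k))))"
    by (intro decaying_add decaying_cmult decaying_fiber_Rstar_hat decaying_times_omega decaying_times_m assms)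
  thus ?thesis by (simp add: omega_r_def algebra_simps)
qed

lemma decaying_fiber_Wplus_hat:
  assumes "smooth_supp U" "r > 0"
  shows "decaying (fiber (Wplus M a (hat U)) r \<theta>)"
  using decaying_symbol_combination[OF assms, of "1 / vfun M a r" M a \<theta> 1]
  by (simp add: fiber_def[abs_def] Wplus_def[abs_def])

text \<open>The product rule under the integral sign, dominated by a multiple of
  \<open>decay k'\<close>: the factor in \<open>k'\<close> decays uniformly in \<open>r\<close> and
  the one in \<open>k - k'\<close> is bounded.\<close>

lemma conv_hat_has_vector_derivative:
  assumes U: "smooth_supp U" and V: "smooth_supp V" and r: "r > 0"
  shows "((\<lambda>r. kconv (\<lambda>_ _. 1) (fiber (hat V) r \<theta>) (fiber (hat U) r \<theta>) k) has_vector_derivative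
    (1 / r) *\<^sub>R (kconv (\<lambda>_ _. 1) (fiber (hat (euler_deriv V)) r \<theta>) (fiber (hat U) r \<theta>) k +
      kconv (\<lambda>_ _. 1) (fiber (hat V) r \<theta>) (fiber (hat (euler_deriv U)) r \<theta>) k)) (at r)"
proof -
  note U' = smooth_supp_euler_deriv[OF U] and V' = smooth_supp_euler_deriv[OF V]
  let ?v = "\<lambda>r. fiber (hat V) r \<theta>" and ?u = "\<lambda>r. fiber (hat U) r \<theta>"
  let ?v' = "\<lambda>r. fiber (hat (euler_deriv V)) r \<theta>" and ?u' = "\<lambda>r. fiber (hat (euler_deriv U)) r \<theta>"
  obtain B1 where B1: "B1 \<ge> 0" "\<And>\<omega> m r \<theta>. cmod (hat V \<omega> m r \<theta>) \<le> B1 * decay (m, \<omega>)"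
    by (rule hat_decay[OF V]) (rule that, assumption+)
  obtain B2 where B2: "B2 \<ge> 0" "\<And>\<omega> m r \<theta>. cmod (hat (euler_deriv V) \<omega> m r \<theta>) \<le> B2 * decay (m, \<omega>)"
    by (rule hat_decay[OF V']) (rule that, assumption+)
  obtain B3 where B3: "B3 \<ge> 0" "\<And>\<omega> m r \<theta>. cmod (hat U \<omega> m r \<theta>) \<le> B3"
    by (rule hat_bounded[OF U]) (rule that, assumption+)
  obtain B4 where B4: "B4 \<ge> 0" "\<And>\<omega> m r \<theta>. cmod (hat (euler_deriv U) \<omega> m r \<theta>) \<le> B4"
    by (rule hat_bounded[OF U']) (rule that, assumption+)
  have int: "integrable freq_space (\<lambda>k'. 1 * (fiber (hat V) r \<theta> k' * fiber (hat U) r \<theta> (k - k')))"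
    if "smooth_supp U" "smooth_supp V" for U V r
    by (intro integrable_kconv_decaying[where C = 1] decaying_fiber_hat that) auto
  let ?f' = "\<lambda>s k'. (1 / s) *\<^sub>R (?v' s k' * ?u s (k - k') + ?v s k' * ?u' s (k - k'))"
  have "((\<lambda>r. kconv (\<lambda>_ _. 1) (?v r) (?u r) k) has_vector_derivative (LINT k'|freq_space. ?f' r k')) (at r)"
    unfolding kconv_def
  proof (rule has_vector_derivative_lebesgue_integral[where e = "r / 2" and
        g = "\<lambda>k'. (2 / r * (B2 * B3 + B1 * B4)) * decay k'" and f' = ?f'])
    show "r / 2 > 0" using r by simp
    show "integrable freq_space (\<lambda>k'. 1 * (?v s k' * ?u s (k - k')))" for s by (rule int[OF U V])
    show "integrable freq_space (\<lambda>k'. (2 / r * (B2 * B3 + B1 * B4)) * decay k')"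
      by (intro integrable_mult_right integrable_decay)
    have "integrable freq_space (\<lambda>k'. ?f' r k')"
      using int[OF U V'] int[OF U' V] by (intro integrable_scaleR_right Bochner_Integration.integrable_add) auto
    thus "?f' r \<in> borel_measurable freq_space" by (rule borel_measurable_integrable)
    fix s k' assume s: "\<bar>s - r\<bar> < r / 2"
    hence s': "s > 0" "1 / s \<le> 2 / r" using r by (auto simp: field_simps abs_if split: if_splits)
    have dv: "((\<lambda>s. ?v s k') has_vector_derivative (1 / s) *\<^sub>R ?v' s k') (at s)"
      unfolding fiber_def by (rule hat_has_vector_derivative_r[OF V s'(1)])
    have du: "((\<lambda>s. ?u s (k - k')) has_vector_derivative (1 / s) *\<^sub>R ?u' s (k - k')) (at s)"
      unfolding fiber_def by (rule hat_has_vector_derivative_r[OF U s'(1)])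
    show "((\<lambda>s. 1 * (?v s k' * ?u s (k - k'))) has_vector_derivative ?f' s k') (at s)"
      using has_vector_derivative_mult[OF dv du] by (simp add: scaleR_add_right add.commute)
    have "cmod (?v' s k' * ?u s (k - k') + ?v s k' * ?u' s (k - k')) \<le>
        cmod (?v' s k') * cmod (?u s (k - k')) + cmod (?v s k') * cmod (?u' s (k - k'))"
      by (metis norm_mult norm_triangle_ineq)
    also have "\<dots> \<le> (B2 * decay k') * B3 + (B1 * decay k') * B4"
      unfolding fiber_def
      using B1(2)[of "snd k'" "fst k'"] B2(2)[of "snd k'" "fst k'"] B1(1) B2(1) B3 B4 decay_pos[of k']
      by (intro add_mono mult_mono) auto
    finally have le: "cmod (?v' s k' * ?u s (k - k') + ?v s k' * ?u' s (k - k')) \<le> (B2 * B3 + B1 * B4) * decay k'"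
      by (simp add: algebra_simps)
    have "cmod (?f' s k') = (1 / s) * cmod (?v' s k' * ?u s (k - k') + ?v s k' * ?u' s (k - k'))"
      using s' by simp
    also have "\<dots> \<le> (2 / r) * ((B2 * B3 + B1 * B4) * decay k')"
      using le s' r by (intro mult_mono) auto
    finally show "norm (?f' s k') \<le> (2 / r * (B2 * B3 + B1 * B4)) * decay k'" by (simp only: mult.assoc)
  qed
  also have "(LINT k'|freq_space. ?f' r k') = (1 / r) *\<^sub>R (kconv (\<lambda>_ _. 1) (?v' r) (?u r) k + kconv (\<lambda>_ _. 1) (?v r) (?u' r) k)"
    using int[OF U V'] int[OF U' V] unfolding kconv_def
    by (simp only: integral_scaleR_right mult_1 Bochner_Integration.integral_add)
  finally show ?thesis .
qed

lemma kconv_cmult_left: "kconv \<kappa> (\<lambda>k. c * A k) B k = c * kconv \<kappa> A B k"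
  unfolding kconv_def by (simp add: mult.assoc mult.left_commute[of _ c] flip: integral_mult_right_zero)

lemma kconv_cmult_right: "kconv \<kappa> A (\<lambda>k. c * B k) k = c * kconv \<kappa> A B k"
  unfolding kconv_def by (simp add: mult.left_commute[of _ c] flip: integral_mult_right_zero)

lemma conv_decaying:
  assumes "decaying (fiber f r \<theta>)" "decaying (fiber g r \<theta>)"
  shows "conv f g \<omega> m r \<theta> = kconv (\<lambda>_ _. 1) (fiber f r \<theta>) (fiber g r \<theta>) (m, \<omega>)"
  using integrable_kconv_decaying[OF assms, where s = "\<lambda>_. 1" and C = 1 and k = "(m, \<omega>)"]
  by (intro conv_eq_kconv) simp

lemma conv_hat:
  assumes "smooth_supp U" "smooth_supp V"
  shows "conv (hat V) (hat U) \<omega> m r \<theta> = kconv (\<lambda>_ _. 1) (fiber (hat V) r \<theta>) (fiber (hat U) r \<theta>) (m, \<omega>)"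
  by (intro conv_decaying decaying_fiber_hat assms)

text \<open>\<open>Wplus\<close> is a derivation for the convolution: the derivative in
  \<open>r\<close> obeys the product rule, and the multiplier
  \<open>\<omega> - omega_r a m r\<close> is linear in the frequency, so its value at
  \<open>k\<close> is the sum of its values at \<open>k'\<close> and \<open>k - k'\<close>.\<close>

lemma Wplus_conv_hat:
  assumes U: "smooth_supp U" and V: "smooth_supp V" and r: "r > 0"
  shows "Wplus M a (conv (hat V) (hat U)) \<omega> m r \<theta> =
    kconv (\<lambda>_ _. 1) (fiber (Wplus M a (hat V)) r \<theta>) (fiber (hat U) r \<theta>) (m, \<omega>) +
    kconv (\<lambda>_ _. 1) (fiber (hat V) r \<theta>) (fiber (Wplus M a (hat U)) r \<theta>) (m, \<omega>)"
proof -
  let ?A = "fiber (hat V) r \<theta>" and ?B = "fiber (hat U) r \<theta>"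
  let ?A' = "fiber (Rstar M a (hat V)) r \<theta>" and ?B' = "fiber (Rstar M a (hat U)) r \<theta>"
  let ?W = "fiber (Wplus M a (hat V)) r \<theta>" and ?X = "fiber (Wplus M a (hat U)) r \<theta>"
  let ?k = "(m, \<omega>)" and ?c = "of_real (Delta M a r / (r\<^sup>2 + a\<^sup>2) / r) :: complex"
  note dec = decaying_fiber_hat[OF U, of r \<theta>] decaying_fiber_hat[OF V, of r \<theta>]
    decaying_fiber_Rstar_hat[OF U r, of M a \<theta>] decaying_fiber_Rstar_hat[OF V r, of M a \<theta>]
    decaying_fiber_Wplus_hat[OF U r, of M a \<theta>] decaying_fiber_Wplus_hat[OF V r, of M a \<theta>]
  have int: "integrable freq_space (\<lambda>k'. A k' * B (?k - k'))" if "decaying A" "decaying B" for A B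
    using integrable_kconv_decaying[OF that, where s = "\<lambda>_. 1" and C = 1 and k = ?k] by simp
  have R: "Rstar M a (conv (hat V) (hat U)) \<omega> m r \<theta> =
      kconv (\<lambda>_ _. 1) ?A' ?B ?k + kconv (\<lambda>_ _. 1) ?A ?B' ?k"
  proof -
    have eq: "?A' = (\<lambda>k. ?c * fiber (hat (euler_deriv V)) r \<theta> k)"
      "?B' = (\<lambda>k. ?c * fiber (hat (euler_deriv U)) r \<theta> k)"
      by (auto simp: fiber_def Rstar_hat[OF V r] Rstar_hat[OF U r])
    have "Rstar M a (conv (hat V) (hat U)) \<omega> m r \<theta> =
        ?c * (kconv (\<lambda>_ _. 1) (fiber (hat (euler_deriv V)) r \<theta>) ?B ?k +
          kconv (\<lambda>_ _. 1) ?A (fiber (hat (euler_deriv U)) r \<theta>) ?k)"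
      unfolding Rstar_def conv_hat[OF U V] vector_derivative_at[OF conv_hat_has_vector_derivative[OF U V r]]
      by (simp add: scaleR_conv_of_real)
    thus ?thesis unfolding eq kconv_cmult_left kconv_cmult_right by (simp only: distrib_left)
  qed
  let ?b = "of_real (1 / vfun M a r) :: complex" and ?s = "\<i> * of_real (\<omega> - omega_r a m r) :: complex"
  have "kconv (\<lambda>_ _. 1) ?W ?B ?k + kconv (\<lambda>_ _. 1) ?A ?X ?k =
      (LINT k'|freq_space. ?W k' * ?B (?k - k') + ?A k' * ?X (?k - k'))"
    unfolding kconv_def mult_1 by (rule Bochner_Integration.integral_add[symmetric]; intro int dec)
  also have "\<dots> = (LINT k'|freq_space. ?b * ((?A' k' * ?B (?k - k') + ?A k' * ?B' (?k - k')) -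
       ?s * (?A k' * ?B (?k - k'))))"
  proof (intro Bochner_Integration.integral_cong refl)
    fix k' :: "int \<times> real"
    \<comment> \<open>Additivity of the multiplier along \<open>k = k' + (k - k')\<close>.\<close>
    have "of_real (\<omega> - omega_r a m r) = of_real (snd k' - omega_r a (fst k') r) +
       (of_real (snd (?k - k') - omega_r a (fst (?k - k')) r) :: complex)"
      by (simp add: omega_r_def diff_divide_distrib right_diff_distrib)
    thus "?W k' * ?B (?k - k') + ?A k' * ?X (?k - k') =
        ?b * ((?A' k' * ?B (?k - k') + ?A k' * ?B' (?k - k')) - ?s * (?A k' * ?B (?k - k')))"
      unfolding Wplus_def fiber_def by (simp only:) (simp only: ring_distribs mult_ac add_ac diff_conv_add_uminus minus_add_distrib mult_minus_left mult_minus_right)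
  qed
  also have "\<dots> = ?b * ((LINT k'|freq_space. ?A' k' * ?B (?k - k') + ?A k' * ?B' (?k - k')) -
       (LINT k'|freq_space. ?s * (?A k' * ?B (?k - k'))))"
    unfolding integral_mult_right_zero[of _ ?b]
    by (subst Bochner_Integration.integral_diff;
        intro refl Bochner_Integration.integrable_add integrable_mult_right int dec)
  also have "\<dots> = Wplus M a (conv (hat V) (hat U)) \<omega> m r \<theta>"
    unfolding Wplus_def R conv_hat[OF U V] kconv_def mult_1 integral_mult_right_zero
    by (subst Bochner_Integration.integral_add; intro refl int dec)
  finally show ?thesis by simp
qed

section \<open>The commutators as kernel operators\<close>

text \<open>For decaying factors both terms converge separately and may be merged. The merged kernel
  is the form that still converges on the closures.\<close>

lemma kconv_multiplier_commutator:
  assumes "decaying A" "decaying B" "decaying (\<lambda>k. s k * B k)"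
  shows "s k * kconv (\<lambda>_ _. 1) A B k - kconv (\<lambda>_ _. 1) A (\<lambda>k. s k * B k) k =
    kconv (\<lambda>k k'. s k - s (k - k')) A B k"
proof -
  have int: "integrable freq_space (\<lambda>k'. A k' * B (k - k'))" if "decaying A" "decaying B" for A B
    using integrable_kconv_decaying[OF that, where s = "\<lambda>_. 1" and C = 1 and k = k] by simp
  have "s k * kconv (\<lambda>_ _. 1) A B k - kconv (\<lambda>_ _. 1) A (\<lambda>k. s k * B k) k =
      (LINT k'|freq_space. s k * (A k' * B (k - k')) - A k' * (s (k - k') * B (k - k')))"
    unfolding kconv_def mult_1
    by (subst Bochner_Integration.integral_diff, intro integrable_mult_right int assms,
        rule int[OF assms(1) assms(3)], simp only: integral_mult_right_zero)
  also have "\<dots> = kconv (\<lambda>k k'. s k - s (k - k')) A B k"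
    unfolding kconv_def by (intro Bochner_Integration.integral_cong) (auto simp: algebra_simps)
  finally show ?thesis .
qed

lemma kconv_multiplier: "kconv (\<lambda>k _. s k) A B k = s k * kconv (\<lambda>_ _. 1) A B k"
  unfolding kconv_def mult_1 by (rule integral_mult_right_zero)

text \<open>The discrete variable is countable, so joint measurability reduces to each fixed
  \<open>m\<close>.\<close>

lemma measurable_pair_freq_space:
  assumes "\<And>m. (\<lambda>(x, \<omega>). f (x, (m, \<omega>))) \<in> borel_measurable (N \<Otimes>\<^sub>M borel)"
  shows "f \<in> borel_measurable (N \<Otimes>\<^sub>M freq_space)"
proof -
  have "(\<lambda>(m, x, \<omega>). f (x, (m, \<omega>))) \<in> borel_measurable (count_space UNIV \<Otimes>\<^sub>M (N \<Otimes>\<^sub>M borel))"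
    by (rule measurable_pair_measure_countable1) (use assms in \<open>auto simp: split_def\<close>)
  moreover have "(\<lambda>(x, k). (fst k, x, snd k)) \<in> measurable (N \<Otimes>\<^sub>M freq_space) (count_space UNIV \<Otimes>\<^sub>M (N \<Otimes>\<^sub>M borel))"
    by measurable
  ultimately have "(\<lambda>z. (\<lambda>(m, x, \<omega>). f (x, (m, \<omega>))) ((\<lambda>(x, k). (fst k, x, snd k)) z)) \<in>
      borel_measurable (N \<Otimes>\<^sub>M freq_space)"
    by (rule measurable_compose[rotated])
  thus ?thesis by (simp add: split_def)
qed

context sharp_setting begin

abbreviation gsym :: "real \<Rightarrow> int \<times> real \<Rightarrow> complex" where
  "gsym r k \<equiv> of_real (gsharp_cut D (snd k) (fst k) r)"

lemma gsharp_cut_measurable: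
  "(\<lambda>(r, k). gsharp_cut D (snd k) (fst k) r) \<in> borel_measurable (borel \<Otimes>\<^sub>M freq_space)"
proof (rule measurable_pair_freq_space)
  fix m
  have "continuous_on UNIV f" if "smooth_on UNIV f" for f :: "real \<Rightarrow> real"
    using that unfolding smooth_on_def by (metis Ck_on.simps(1))
  hence [measurable]: "gcut D \<in> borel_measurable borel" "Rss D \<in> borel_measurable borel"
    "chi1 D \<in> borel_measurable borel"
    using ok unfolding sharp_data_ok_def by (auto intro: borel_measurable_continuous_onI)
  show "(\<lambda>(r, \<omega>). case (r, (m, \<omega>)) of (r, k) \<Rightarrow> gsharp_cut D (snd k) (fst k) r) \<in> borel_measurable (borel \<Otimes>\<^sub>M borel)"
    by (cases "m = 0") (simp_all add: gsharp_cut_eq sharp_profile_def)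
qed

lemma gsharp_cut_measurable' [measurable (raw)]:
  assumes "f \<in> borel_measurable N" "g \<in> measurable N freq_space"
  shows "(\<lambda>x. gsharp_cut D (snd (g x)) (fst (g x)) (f x)) \<in> borel_measurable N"
  using measurable_compose[OF measurable_Pair[OF assms] gsharp_cut_measurable] by simp

lemma decaying_gsym:
  assumes "decaying A" shows "decaying (\<lambda>k. gsym r k * A k)"
proof -
  obtain C where "C \<ge> 0" "\<And>\<omega> m r. \<bar>gsharp_cut D \<omega> m r\<bar> \<le> C"
    by (rule gsharp_symbol_bounds) (rule that, assumption+)
  thus ?thesis by (intro decaying_bounded_mult[OF assms, where C = C]) auto
qed

lemma commutator_multiplier_hat:
  assumes X: "\<And>f \<omega> m. X f \<omega> m r \<theta> = s (m, \<omega>) * f \<omega> m r \<theta>"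
    and U: "smooth_supp U" and V: "smooth_supp V"
    and dec: "decaying (\<lambda>k. s k * fiber (hat U) r \<theta> k)"
  shows "commutator X (hat V) (hat U) \<omega> m r \<theta> =
    kconv (\<lambda>k k'. s k - s (k - k')) (fiber (hat V) r \<theta>) (fiber (hat U) r \<theta>) (m, \<omega>)"
proof -
  have fX: "fiber (X (hat U)) r \<theta> = (\<lambda>k. s k * fiber (hat U) r \<theta> k)"
    by (rule ext) (simp add: fiber_def X)
  have "conv (hat V) (X (hat U)) \<omega> m r \<theta> =
      kconv (\<lambda>_ _. 1) (fiber (hat V) r \<theta>) (fiber (X (hat U)) r \<theta>) (m, \<omega>)"
    by (intro conv_decaying decaying_fiber_hat V) (simp add: fX dec)
  thus ?thesis
    unfolding commutator_def X conv_hat[OF U V] fX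
    using kconv_multiplier_commutator[OF decaying_fiber_hat[OF V] decaying_fiber_hat[OF U] dec] by simp
qed

text \<open>By the product rule the symbol times \<open>Wplus\<close> of the convolution splits in
  two. The term with \<open>Wplus\<close> on the first factor stays as it is; the other one combines
  with the subtracted term to the commutator of the symbol alone, applied to \<open>Wplus\<close> of
  the second factor.\<close>

lemma commutator_X_Wplus_hat:
  assumes U: "smooth_supp U" and V: "smooth_supp V" and r: "r > 0"
  shows "commutator (X_Wplus M a D) (hat V) (hat U) \<omega> m r \<theta> =
    kconv (\<lambda>k _. gsym r k) (fiber (Wplus M a (hat V)) r \<theta>) (fiber (hat U) r \<theta>) (m, \<omega>) +
    kconv (\<lambda>k k'. gsym r k - gsym r (k - k')) (fiber (hat V) r \<theta>) (fiber (Wplus M a (hat U)) r \<theta>) (m, \<omega>)"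
proof -
  let ?k = "(m, \<omega>)" and ?A = "fiber (hat V) r \<theta>" and ?B = "fiber (hat U) r \<theta>"
  let ?W = "fiber (Wplus M a (hat V)) r \<theta>" and ?Y = "fiber (Wplus M a (hat U)) r \<theta>"
  have fX: "fiber (X_Wplus M a D (hat U)) r \<theta> = (\<lambda>k. gsym r k * ?Y k)"
    by (rule ext) (simp add: fiber_def X_Wplus_def)
  note dec = decaying_fiber_hat[OF V, of r \<theta>] decaying_fiber_Wplus_hat[OF U r, of M a \<theta>]
    decaying_gsym[OF decaying_fiber_Wplus_hat[OF U r, of M a \<theta>]]
  have "conv (hat V) (X_Wplus M a D (hat U)) \<omega> m r \<theta> = kconv (\<lambda>_ _. 1) ?A (\<lambda>k. gsym r k * ?Y k) ?k"
    by (subst conv_decaying) (simp_all add: fX dec)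
  hence "commutator (X_Wplus M a D) (hat V) (hat U) \<omega> m r \<theta> =
      gsym r ?k * kconv (\<lambda>_ _. 1) ?W ?B ?k +
      (gsym r ?k * kconv (\<lambda>_ _. 1) ?A ?Y ?k - kconv (\<lambda>_ _. 1) ?A (\<lambda>k. gsym r k * ?Y k) ?k)"
    unfolding commutator_def X_Wplus_def[of M a D "conv _ _"] Wplus_conv_hat[OF U V r]
    by (simp add: distrib_left)
  thus ?thesis
    unfolding kconv_multiplier_commutator[OF dec] kconv_multiplier[of "\<lambda>k. gsym r k"] .
qed

end

section \<open>The norms as integrals over frequency space\<close>

lemma ennsqrt_power2 [simp]: "(ennsqrt x)\<^sup>2 = x"
  by (cases x) (simp_all add: ennsqrt_def ennreal_power)

lemma measurable_ennsqrt [measurable]: "ennsqrt \<in> borel_measurable borel"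
  unfolding ennsqrt_def[abs_def] by measurable

lemma l1L1_eq:
  assumes "(\<lambda>k. f (snd k) (fst k)) \<in> borel_measurable freq_space"
  shows "l1L1 f = (\<integral>\<^sup>+k. ennreal (cmod (f (snd k) (fst k))) \<partial>freq_space)"
  unfolding l1L1_def by (subst nn_integral_freq_space) (use assms in auto)

lemma l2L2_eq:
  assumes "(\<lambda>k. f (snd k) (fst k)) \<in> borel_measurable freq_space"
  shows "l2L2 f = ennsqrt (wL2sq (\<lambda>_. 1) (\<lambda>k. f (snd k) (fst k)))"
  unfolding l2L2_def wL2sq_def by (subst nn_integral_freq_space) (use assms in auto)

lemma tendsto_ennsqrt_zero:
  assumes "(x \<longlongrightarrow> 0) F" shows "((\<lambda>n. ennsqrt (x n)) \<longlongrightarrow> 0) F"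
proof (rule order_tendstoI)
  fix e :: ennreal assume "0 < e"
  hence "0 < e\<^sup>2" by (simp add: zero_less_iff_neq_zero)
  with assms have "eventually (\<lambda>n. x n < e\<^sup>2) F" by (rule order_tendstoD(2))
  thus "eventually (\<lambda>n. ennsqrt (x n) < e) F"
  proof eventually_elim
    case (elim n)
    show ?case
    proof (rule ccontr)
      assume "\<not> ennsqrt (x n) < e"
      hence "e\<^sup>2 \<le> (ennsqrt (x n))\<^sup>2" by (intro power_mono) auto
      with elim show False by simp
    qed
  qed
qed simp

lemma wL1_triangle:
  assumes [measurable]: "p \<in> borel_measurable freq_space" "A \<in> borel_measurable freq_space" "B \<in> borel_measurable freq_space"
    and "\<And>k. 0 \<le> p k"
  shows "wL1 p B \<le> wL1 p A + wL1 p (\<lambda>k. A k - B k)"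
proof -
  have "p k * cmod (B k) \<le> p k * cmod (A k) + p k * cmod (A k - B k)" for k
    using mult_left_mono[OF norm_triangle_ineq4[of "A k" "A k - B k"] assms(4)] by (simp add: distrib_left)
  hence "wL1 p B \<le> (\<integral>\<^sup>+k. ennreal (p k * cmod (A k) + p k * cmod (A k - B k)) \<partial>freq_space)"
    unfolding wL1_def by (intro nn_integral_mono ennreal_leI)
  also have "\<dots> = (\<integral>\<^sup>+k. ennreal (p k * cmod (A k)) + ennreal (p k * cmod (A k - B k)) \<partial>freq_space)"
    using assms(4) by (intro nn_integral_cong ennreal_plus) auto
  also have "\<dots> = wL1 p A + wL1 p (\<lambda>k. A k - B k)"
    unfolding wL1_def by (intro nn_integral_add) measurable
  finally show ?thesis .
qed

lemma wL2sq_triangle: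
  assumes [measurable]: "\<rho> \<in> borel_measurable freq_space" "A \<in> borel_measurable freq_space" "B \<in> borel_measurable freq_space"
  shows "wL2sq \<rho> B \<le> 2 * (wL2sq \<rho> A + wL2sq \<rho> (\<lambda>k. A k - B k))"
proof -
  have "wL2sq \<rho> B = wL2sq \<rho> (\<lambda>k. A k + - (A k - B k))" by simp
  also have "\<dots> \<le> 2 * (wL2sq \<rho> A + wL2sq \<rho> (\<lambda>k. - (A k - B k)))" by (intro wL2sq_add_le) measurable
  also have "wL2sq \<rho> (\<lambda>k. - (A k - B k)) = wL2sq \<rho> (\<lambda>k. A k - B k)"
    unfolding wL2sq_def norm_minus_cancel ..
  finally show ?thesis .
qed

lemma wL1_cmult:
  assumes [measurable]: "p \<in> borel_measurable freq_space" "A \<in> borel_measurable freq_space"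
    and "C \<ge> 0" "\<And>k. 0 \<le> p k"
  shows "wL1 (\<lambda>k. C * p k) A = ennreal C * wL1 p A"
  unfolding wL1_def using assms(3,4)
  by (subst nn_integral_cmult[symmetric]) (auto simp: ennreal_mult[symmetric] mult.assoc)

text \<open>The sum of the weights in the first two terms of \<open>normW\<close>;
  \<open>freq_max\<close> is the denominator in \<open>normH\<close>.\<close>

definition freq_weight :: "int \<times> real \<Rightarrow> real" where
  "freq_weight k = \<bar>of_int (fst k)\<bar> + \<bar>snd k\<bar>"

definition freq_max :: "int \<times> real \<Rightarrow> real" where
  "freq_max k = max (max \<bar>of_int (fst k)\<bar> \<bar>snd k\<bar>) 1"

lemma freq_weight_measurable [measurable]: "freq_weight \<in> borel_measurable freq_space"
  unfolding freq_weight_def[abs_def] by measurable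

lemma freq_max_measurable [measurable]: "freq_max \<in> borel_measurable freq_space"
  unfolding freq_max_def[abs_def] by measurable

lemma freq_weight_nonneg: "0 \<le> freq_weight k"
  by (simp add: freq_weight_def)

lemma freq_max_ge_1: "1 \<le> freq_max k"
  by (simp add: freq_max_def)

lemma freq_weight_le_freq_max: "freq_weight k \<le> 2 * freq_max k"
  unfolding freq_weight_def freq_max_def by linarith

section \<open>Comparison of the norms\<close>

lemma wL2sq_dominated:
  assumes [measurable]: "A \<in> borel_measurable freq_space" "B \<in> borel_measurable freq_space"
    and le: "\<And>k. \<rho> k * cmod (E k) \<le> c * cmod (A k) + d * cmod (B k)"
    and nonneg: "\<And>k. 0 \<le> \<rho> k" "0 \<le> c" "0 \<le> d"
  shows "wL2sq \<rho> E \<le> ennreal (2 * c\<^sup>2) * wL2sq (\<lambda>_. 1) A + ennreal (2 * d\<^sup>2) * wL2sq (\<lambda>_. 1) B"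
proof -
  have "(\<rho> k * cmod (E k))\<^sup>2 \<le> (2 * c\<^sup>2) * (cmod (A k))\<^sup>2 + (2 * d\<^sup>2) * (cmod (B k))\<^sup>2" for k
  proof -
    have "(\<rho> k * cmod (E k))\<^sup>2 \<le> (c * cmod (A k) + d * cmod (B k))\<^sup>2"
      by (intro power_mono le) (simp add: nonneg)
    also have "\<dots> \<le> 2 * (c * cmod (A k))\<^sup>2 + 2 * (d * cmod (B k))\<^sup>2"
      using sum_squares_bound[of "c * cmod (A k)" "d * cmod (B k)"] by (simp add: power2_sum)
    finally show ?thesis by (simp add: power_mult_distrib)
  qed
  hence "wL2sq \<rho> E \<le> (\<integral>\<^sup>+k. ennreal ((2 * c\<^sup>2) * (cmod (A k))\<^sup>2 + (2 * d\<^sup>2) * (cmod (B k))\<^sup>2) \<partial>freq_space)"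
    unfolding wL2sq_def by (intro nn_integral_mono ennreal_leI)
  also have "\<dots> = (\<integral>\<^sup>+k. ennreal (2 * c\<^sup>2) * ennreal ((1 * cmod (A k))\<^sup>2) + ennreal (2 * d\<^sup>2) * ennreal ((1 * cmod (B k))\<^sup>2) \<partial>freq_space)"
    by (intro nn_integral_cong) (subst ennreal_plus, simp, simp, subst (1 2) ennreal_mult, simp_all)
  also have "\<dots> = ennreal (2 * c\<^sup>2) * wL2sq (\<lambda>_. 1) A + ennreal (2 * d\<^sup>2) * wL2sq (\<lambda>_. 1) B"
    unfolding wL2sq_def by (subst nn_integral_add, measurable, subst (1 2) nn_integral_cmult, measurable)
  finally show ?thesis .
qed

lemma fiber_Wplus_pair:
  "fiber (Wplus_pair M a f F) r \<theta> k = of_real (1 / vfun M a r) *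
     (fiber F r \<theta> k - \<i> * of_real (snd k - omega_r a (fst k) r) * fiber f r \<theta> k)"
  by (simp add: fiber_def Wplus_pair_def)

lemma fiber_Wzero:
  "fiber (Wzero M a h0 f F) r \<theta> k = of_real (1 / vfun M a r) *
     (fiber F r \<theta> k - \<i> * of_real (h0 r * (snd k - omega_r a (fst k) r)) * fiber f r \<theta> k)"
  by (simp add: fiber_def Wzero_def)

lemma fiber_Wplus_pair_measurable [measurable]:
  assumes [measurable]: "fiber f r \<theta> \<in> borel_measurable freq_space" "fiber F r \<theta> \<in> borel_measurable freq_space"
  shows "fiber (Wplus_pair M a f F) r \<theta> \<in> borel_measurable freq_space"
  unfolding fiber_Wplus_pair[abs_def] omega_r_def by measurable

lemma fiber_Wzero_measurable [measurable]:
  assumes [measurable]: "fiber f r \<theta> \<in> borel_measurable freq_space" "fiber F r \<theta> \<in> borel_measurable freq_space"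
  shows "fiber (Wzero M a h0 f F) r \<theta> \<in> borel_measurable freq_space"
  unfolding fiber_Wzero[abs_def] omega_r_def by measurable

lemma normW_eq:
  assumes [measurable]: "fiber f r \<theta> \<in> borel_measurable freq_space" "fiber F r \<theta> \<in> borel_measurable freq_space"
  shows "normW M a h0 q f F r \<theta> = wL1 freq_weight (fiber f r \<theta>) +
    wL1 (\<lambda>_. 1) (\<lambda>k. of_real (vfun M a r powr (- q)) * fiber (Wzero M a h0 f F) r \<theta> k)"
proof -
  have "wL1 freq_weight (fiber f r \<theta>) = (\<integral>\<^sup>+k. ennreal (cmod (of_real (snd k) * fiber f r \<theta> k)) +
      ennreal (cmod (of_int (fst k) * fiber f r \<theta> k)) \<partial>freq_space)"
    unfolding wL1_def freq_weight_def
    by (intro nn_integral_cong) (simp add: norm_mult distrib_right add.commute flip: ennreal_plus)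
  also have "\<dots> = (\<integral>\<^sup>+k. ennreal (cmod (of_real (snd k) * fiber f r \<theta> k)) \<partial>freq_space) +
      (\<integral>\<^sup>+k. ennreal (cmod (of_int (fst k) * fiber f r \<theta> k)) \<partial>freq_space)"
    by (rule nn_integral_add) measurable
  also have "\<dots> = l1L1 (\<lambda>\<omega> m. of_real \<omega> * f \<omega> m r \<theta>) + l1L1 (\<lambda>\<omega> m. of_int m * f \<omega> m r \<theta>)"
    unfolding fiber_def
    by (subst (1 2) l1L1_eq) (simp_all add: fiber_def[symmetric])
  finally show ?thesis
    unfolding normW_def by (subst (3) l1L1_eq) (simp_all add: fiber_def[symmetric] wL1_def)
qed

lemma normH_eq:
  assumes [measurable]: "fiber f r \<theta> \<in> borel_measurable freq_space" "fiber F r \<theta> \<in> borel_measurable freq_space"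
  shows "normH M a h0 D q f F r \<theta> =
    ennsqrt (wL2sq (\<lambda>_. 1) (\<lambda>k. of_real (vfun M a r powr q) * fiber f r \<theta> k)) +
    ennsqrt (wL2sq (\<lambda>_. 1) (\<lambda>k. of_real (sqrt (chi_hi D r)) * fiber (Wzero M a h0 f F) r \<theta> k / of_real (freq_max k)))"
  unfolding normH_def
  by (subst (1 2) l2L2_eq) (simp_all add: fiber_def[symmetric] freq_max_def[symmetric])

lemma normH_ge:
  assumes "fiber f r \<theta> \<in> borel_measurable freq_space" "fiber F r \<theta> \<in> borel_measurable freq_space"
  shows "wL2sq (\<lambda>_. 1) (\<lambda>k. of_real (vfun M a r powr q) * fiber f r \<theta> k) \<le> (normH M a h0 D q f F r \<theta>)\<^sup>2"
    and "wL2sq (\<lambda>_. 1) (\<lambda>k. of_real (sqrt (chi_hi D r)) * fiber (Wzero M a h0 f F) r \<theta> k / of_real (freq_max k))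
      \<le> (normH M a h0 D q f F r \<theta>)\<^sup>2"
proof -
  have "x \<le> (ennsqrt x + ennsqrt y)\<^sup>2" "y \<le> (ennsqrt x + ennsqrt y)\<^sup>2" for x y
    using power_mono[of "ennsqrt x" "ennsqrt x + ennsqrt y" 2] power_mono[of "ennsqrt y" "ennsqrt x + ennsqrt y" 2]
    by simp_all
  thus "wL2sq (\<lambda>_. 1) (\<lambda>k. of_real (vfun M a r powr q) * fiber f r \<theta> k) \<le> (normH M a h0 D q f F r \<theta>)\<^sup>2"
    "wL2sq (\<lambda>_. 1) (\<lambda>k. of_real (sqrt (chi_hi D r)) * fiber (Wzero M a h0 f F) r \<theta> k / of_real (freq_max k))
      \<le> (normH M a h0 D q f F r \<theta>)\<^sup>2"
    unfolding normH_eq[OF assms] by blast+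
qed

text \<open>Makes the constants independent of \<open>q\<close>: since \<open>c\<close> is at least
  1 and \<open>q\<close> at most 1, \<open>c powr q\<close> is at most \<open>c\<close>, and
  \<open>c\<close> bounds both \<open>v\<close> and its inverse.\<close>

lemma powr_le_of_bounds:
  fixes v c q :: real
  assumes "0 < v" "v \<le> c" "1 / v \<le> c" "1 \<le> c" "0 \<le> q" "q \<le> 1"
  shows "v powr q \<le> c" "v powr (- q) \<le> c"
proof -
  have cq: "c powr q \<le> c" using powr_mono[of q 1 c] assms by simp
  have "v powr q \<le> c powr q" using assms by (intro powr_mono2) auto
  thus "v powr q \<le> c" using cq by simp
  have "v powr (- q) = (1 / v) powr q" using assms by (simp add: powr_minus_divide powr_divide)
  also have "\<dots> \<le> c powr q" using assms by (intro powr_mono2) auto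
  finally show "v powr (- q) \<le> c" using cq by simp
qed

context sharp_setting begin

lemma r_supp_props:
  assumes "r \<in> r_supp"
  shows "rplus M a < r" "1 \<le> chi_hi D r" "chi_lohi D r = 1"
proof -
  have r: "r_lo D + delta D / 8 \<le> r" "r \<le> r_hi D + (7/8) * delta D" and d: "delta D > 0" "rplus M a < r_lo D"
    using assms ok by (auto simp: r_supp_def sharp_data_ok_def)
  show rp: "rplus M a < r" using r(1) d by linarith
  with r ok show lohi: "chi_lohi D r = 1" by (auto simp: sharp_data_ok_def)
  have "chi_lohi D r \<le> chi_hi D r" using ok rp by (auto simp: sharp_data_ok_def)
  with lohi show "1 \<le> chi_hi D r" by simp
qed

lemma Delta_pos: "rplus M a < r \<Longrightarrow> 0 < Delta M a r"
proof -
  assume r: "rplus M a < r"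
  have "a\<^sup>2 \<le> M\<^sup>2" using a_pos a_less_M by (intro power_mono) auto
  hence s: "(sqrt (M\<^sup>2 - a\<^sup>2))\<^sup>2 = M\<^sup>2 - a\<^sup>2" by simp
  have "(sqrt (M\<^sup>2 - a\<^sup>2))\<^sup>2 < (r - M)\<^sup>2"
    using r \<open>a\<^sup>2 \<le> M\<^sup>2\<close> unfolding rplus_def by (intro power_strict_mono) auto
  thus ?thesis unfolding s Delta_def by (simp add: power2_diff algebra_simps)
qed

lemma vfun_pos: "rplus M a < r \<Longrightarrow> 0 < vfun M a r"
  using Delta_pos[of r] a_pos by (simp add: vfun_def add_nonneg_pos)

lemma vfun_r_supp_bounds:
  obtains c where "c \<ge> 1" "\<And>r. r \<in> r_supp \<Longrightarrow> vfun M a r \<le> c" "\<And>r. r \<in> r_supp \<Longrightarrow> 1 / vfun M a r \<le> c"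
proof -
  have sq: "r\<^sup>2 + a\<^sup>2 \<noteq> 0" for r using a_pos by (simp add: add_nonneg_eq_0_iff)
  have v: "continuous_on r_supp (vfun M a)"
    unfolding vfun_def Delta_def by (intro continuous_intros) (use sq in auto)
  have comp: "compact r_supp" by (simp add: r_supp_def)
  have nz: "vfun M a r \<noteq> 0" if "r \<in> r_supp" for r
    using vfun_pos[OF r_supp_props(1)[OF that]] by simp
  have "compact (vfun M a ` r_supp)" "compact ((\<lambda>r. 1 / vfun M a r) ` r_supp)"
    using nz by (intro compact_continuous_image comp v continuous_intros; simp)+
  then obtain b c where "\<And>x. x \<in> vfun M a ` r_supp \<Longrightarrow> norm x \<le> b" "\<And>x. x \<in> (\<lambda>r. 1 / vfun M a r) ` r_supp \<Longrightarrow> norm x \<le> c"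
    using compact_imp_bounded bounded_iff by metis
  hence bc: "\<bar>vfun M a r\<bar> \<le> b" "\<bar>1 / vfun M a r\<bar> \<le> c" if "r \<in> r_supp" for r
    using that by fastforce+
  show ?thesis
  proof (rule that[of "max 1 (max b c)"])
    show "vfun M a r \<le> max 1 (max b c)" "1 / vfun M a r \<le> max 1 (max b c)" if "r \<in> r_supp" for r
      using bc[OF that] by linarith+
  qed simp
qed

lemma abs_h0_le_1: "rplus M a < r \<Longrightarrow> \<bar>h0 r\<bar> \<le> 1"
proof -
  assume "rplus M a < r"
  hence "(h0 r)\<^sup>2 \<le> 1" using h0 by (simp add: is_h0_def)
  thus ?thesis by (simp add: abs_square_le_1)
qed

text \<open>Dropping \<open>r\<^sup>2\<close> from the denominator bounds the coefficient of
  \<open>m\<close> by \<open>1 / a\<close>, uniformly in \<open>r\<close>.\<close>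

lemma omega_minus_omega_r_le: "\<bar>snd k - omega_r a (fst k) r\<bar> \<le> (1 + 1 / a) * freq_weight k"
proof -
  have "\<bar>omega_r a (fst k) r\<bar> = a * \<bar>of_int (fst k)\<bar> / (r\<^sup>2 + a\<^sup>2)"
    using a_pos by (simp add: omega_r_def abs_mult)
  also have "\<dots> \<le> a * \<bar>of_int (fst k)\<bar> / a\<^sup>2"
    using a_pos by (intro divide_left_mono) (auto simp: add_nonneg_pos)
  also have "\<dots> = (1 / a) * \<bar>of_int (fst k)\<bar>" using a_pos by (simp add: power2_eq_square)
  finally have "\<bar>snd k - omega_r a (fst k) r\<bar> \<le> \<bar>snd k\<bar> + (1 / a) * \<bar>of_int (fst k)\<bar>"
    using abs_triangle_ineq4[of "snd k" "omega_r a (fst k) r"] by linarith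
  also have "\<dots> \<le> (1 + 1 / a) * freq_weight k"
    using a_pos by (simp add: freq_weight_def algebra_simps)
  finally show ?thesis .
qed

text \<open>The two operators have the same derivative term. Their difference is multiplication by
  \<open>(1 - h0 r) * (\<omega> - omega_r) / v\<close>, of first order in the frequencies, where
  \<open>1 - h0 r\<close> is at most 2 in size.\<close>

lemma Wplus_pair_le_Wzero:
  assumes r: "rplus M a < r" and c: "1 / vfun M a r \<le> c"
  shows "cmod (fiber (Wplus_pair M a f F) r \<theta> k) \<le> cmod (fiber (Wzero M a h0 f F) r \<theta> k) +
    2 * c * (1 + 1 / a) * (freq_weight k * cmod (fiber f r \<theta> k))"
proof -
  let ?z = "snd k - omega_r a (fst k) r" and ?v = "vfun M a r"
  have v: "0 < 1 / ?v" using vfun_pos[OF r] by simp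
  have eq: "fiber (Wplus_pair M a f F) r \<theta> k = fiber (Wzero M a h0 f F) r \<theta> k -
      \<i> * of_real (1 / ?v * ((1 - h0 r) * ?z)) * fiber f r \<theta> k"
    by (simp only: fiber_Wplus_pair fiber_Wzero) (simp add: algebra_simps)
  have c0: "0 \<le> c" using v c by linarith
  have "\<bar>1 / ?v * ((1 - h0 r) * ?z)\<bar> = 1 / ?v * (\<bar>1 - h0 r\<bar> * \<bar>?z\<bar>)"
    using v by (simp add: abs_mult)
  also have "\<dots> \<le> c * (2 * ((1 + 1 / a) * freq_weight k))"
    using abs_h0_le_1[OF r] v c c0 by (intro mult_mono omega_minus_omega_r_le) auto
  finally have "cmod (\<i> * of_real (1 / ?v * ((1 - h0 r) * ?z)) * fiber f r \<theta> k) \<le>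
      c * (2 * ((1 + 1 / a) * freq_weight k)) * cmod (fiber f r \<theta> k)"
    unfolding norm_mult norm_of_real norm_ii mult_1 by (rule mult_right_mono) simp
  with norm_triangle_ineq4[of "fiber (Wzero M a h0 f F) r \<theta> k"
      "\<i> * of_real (1 / ?v * ((1 - h0 r) * ?z)) * fiber f r \<theta> k"]
  show ?thesis unfolding eq by (simp add: mult_ac)
qed

text \<open>Collects the four quantities that the kernel bounds consume: two norms of the first
  factor and two of the second, with one constant for all \<open>q\<close>, all \<open>r\<close> in
  \<open>r_supp\<close> and all functions.\<close>

definition norm_const :: "real \<Rightarrow> bool" where
  "norm_const C \<longleftrightarrow> 0 \<le> C \<and> (\<forall>q r \<theta> f F. 0 \<le> q \<longrightarrow> q \<le> 1 \<longrightarrow> r \<in> r_supp \<longrightarrow>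
     fiber f r \<theta> \<in> borel_measurable freq_space \<longrightarrow> fiber F r \<theta> \<in> borel_measurable freq_space \<longrightarrow>
      wL1 freq_weight (fiber f r \<theta>) \<le> ennreal C * normW M a h0 q f F r \<theta> \<and>
      wL1 (\<lambda>_. 1) (fiber (Wplus_pair M a f F) r \<theta>) \<le> ennreal C * normW M a h0 q f F r \<theta> \<and>
      wL2sq (\<lambda>_. 1) (fiber f r \<theta>) \<le> ennreal C * (normH M a h0 D q f F r \<theta>)\<^sup>2 \<and>
      wL2sq (\<lambda>k. 1 / freq_max k) (fiber (Wplus_pair M a f F) r \<theta>) \<le> ennreal C * (normH M a h0 D q f F r \<theta>)\<^sup>2)"

lemma norm_constD:
  assumes "norm_const C" "0 \<le> q" "q \<le> 1" "r \<in> r_supp"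
    "fiber f r \<theta> \<in> borel_measurable freq_space" "fiber F r \<theta> \<in> borel_measurable freq_space"
  shows "wL1 freq_weight (fiber f r \<theta>) \<le> ennreal C * normW M a h0 q f F r \<theta>"
    "wL1 (\<lambda>_. 1) (fiber (Wplus_pair M a f F) r \<theta>) \<le> ennreal C * normW M a h0 q f F r \<theta>"
    "wL2sq (\<lambda>_. 1) (fiber f r \<theta>) \<le> ennreal C * (normH M a h0 D q f F r \<theta>)\<^sup>2"
    "wL2sq (\<lambda>k. 1 / freq_max k) (fiber (Wplus_pair M a f F) r \<theta>) \<le> ennreal C * (normH M a h0 D q f F r \<theta>)\<^sup>2"
  using assms unfolding norm_const_def by blast+

lemma ex_norm_const: "\<exists>C. norm_const C"
proof -
  obtain c where c: "c \<ge> 1" "\<And>r. r \<in> r_supp \<Longrightarrow> vfun M a r \<le> c" "\<And>r. r \<in> r_supp \<Longrightarrow> 1 / vfun M a r \<le> c"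
    by (rule vfun_r_supp_bounds) (rule that, assumption+)
  define c2 where "c2 = 2 * c * (1 + 1 / a)"
  have c2: "c2 \<ge> 0" using c(1) a_pos by (simp add: c2_def)
  \<comment> \<open>The summands are the constants of the four comparisons in turn. \<open>c\<close>
    bounds the powers of \<open>v\<close>, \<open>c2\<close> is the constant of
    \<open>Wplus_pair_le_Wzero\<close>, and the factor 2 in \<open>2 * c2 * c\<close> comes from
    \<open>freq_weight_le_freq_max\<close>; the other factors 2 come from squaring a sum.\<close>
  define C where "C = 1 + (c + c2) + 2 * c\<^sup>2 + (2 * 1\<^sup>2 + 2 * (2 * c2 * c)\<^sup>2)"
  have C: "C \<ge> 1" "C \<ge> c + c2" "C \<ge> 2 * c\<^sup>2" "C \<ge> 2 * 1\<^sup>2 + 2 * (2 * c2 * c)\<^sup>2"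
    using c(1) c2 by (auto simp: C_def)
  have "norm_const C"
    unfolding norm_const_def
  proof (intro conjI[OF order_trans[OF zero_le_one C(1)]] allI impI)
    fix q r \<theta> :: real and f F :: freqfun
    assume q: "0 \<le> q" "q \<le> 1" and r: "r \<in> r_supp" and
      m [measurable]: "fiber f r \<theta> \<in> borel_measurable freq_space" "fiber F r \<theta> \<in> borel_measurable freq_space"
    let ?v = "vfun M a r" and ?N = "normW M a h0 q f F r \<theta>" and ?H = "(normH M a h0 D q f F r \<theta>)\<^sup>2"
    let ?W = "fiber (Wzero M a h0 f F) r \<theta>" and ?P = "fiber (Wplus_pair M a f F) r \<theta>" and ?f = "fiber f r \<theta>"
    let ?vW = "\<lambda>k. of_real (?v powr (- q)) * ?W k" and ?vf = "\<lambda>k. of_real (?v powr q) * ?f k"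
    let ?cW = "\<lambda>k. of_real (sqrt (chi_hi D r)) * ?W k / of_real (freq_max k)"
    note rp = r_supp_props[OF r]
    have v: "?v > 0" by (rule vfun_pos[OF rp(1)])
    note pw = powr_le_of_bounds[OF v c(2)[OF r] c(3)[OF r] c(1) q]
    have W: "cmod (?W k) \<le> c * cmod (?vW k)" for k
    proof -
      have "cmod (?W k) = ?v powr q * cmod (?vW k)"
        using v by (simp add: norm_mult powr_minus norm_inverse)
      also have "\<dots> \<le> c * cmod (?vW k)" by (intro mult_right_mono pw) simp
      finally show ?thesis .
    qed
    have f: "cmod (?f k) \<le> c * cmod (?vf k)" for k
    proof -
      have "cmod (?f k) = ?v powr (- q) * cmod (?vf k)"
        using v by (simp add: norm_mult powr_minus norm_inverse)
      also have "\<dots> \<le> c * cmod (?vf k)" by (intro mult_right_mono pw) simp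
      finally show ?thesis .
    qed
    have P: "cmod (?P k) \<le> cmod (?W k) + c2 * (freq_weight k * cmod (?f k))" for k
      unfolding c2_def by (rule Wplus_pair_le_Wzero[OF rp(1) c(3)[OF r]])
    have N: "?N = wL1 freq_weight ?f + wL1 (\<lambda>_. 1) ?vW" by (rule normW_eq[OF m])
    have C1: "x \<le> ennreal C * x" for x
      using mult_right_mono[of 1 "ennreal C" x] C(1) by simp
    have 1: "wL1 freq_weight ?f \<le> ennreal C * ?N"
      by (rule order_trans[OF _ C1]) (simp add: N)
    have "wL1 (\<lambda>_. 1) ?P \<le> (\<integral>\<^sup>+k. ennreal (c * (1 * cmod (?vW k)) + c2 * (freq_weight k * cmod (?f k))) \<partial>freq_space)"
      unfolding wL1_def
    proof (intro nn_integral_mono ennreal_leI)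
      show "1 * cmod (?P k) \<le> c * (1 * cmod (?vW k)) + c2 * (freq_weight k * cmod (?f k))" for k
        using P[of k] W[of k] by linarith
    qed
    also have "\<dots> = (\<integral>\<^sup>+k. ennreal c * ennreal (1 * cmod (?vW k)) + ennreal c2 * ennreal (freq_weight k * cmod (?f k)) \<partial>freq_space)"
      using c(1) c2 by (intro nn_integral_cong)
        (subst ennreal_plus, simp, simp add: freq_weight_nonneg, subst (1 2) ennreal_mult, simp_all add: freq_weight_nonneg)
    also have "\<dots> = ennreal c * wL1 (\<lambda>_. 1) ?vW + ennreal c2 * wL1 freq_weight ?f"
    proof -
      have *: "(\<lambda>k. ennreal (1 * cmod (?vW k))) \<in> borel_measurable freq_space"
        "(\<lambda>k. ennreal (freq_weight k * cmod (?f k))) \<in> borel_measurable freq_space" by measurable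
      show ?thesis
        unfolding wL1_def nn_integral_cmult[OF *(1), symmetric] nn_integral_cmult[OF *(2), symmetric]
        by (rule nn_integral_add) (intro borel_measurable_times_ennreal borel_measurable_const *)+
    qed
    also have "\<dots> \<le> ennreal c * ?N + ennreal c2 * ?N"
      unfolding N by (intro add_mono mult_left_mono) auto
    also have "\<dots> = ennreal (c + c2) * ?N" using c(1) c2 by (simp add: distrib_right)
    also have "\<dots> \<le> ennreal C * ?N" by (intro mult_right_mono ennreal_leI C) simp
    finally have 2: "wL1 (\<lambda>_. 1) ?P \<le> ennreal C * ?N" .
    have H: "wL2sq (\<lambda>_. 1) ?vf \<le> ?H" "wL2sq (\<lambda>_. 1) ?cW \<le> ?H" by (rule normH_ge[OF m])+
    have "wL2sq (\<lambda>_. 1) ?f \<le> ennreal (2 * c\<^sup>2) * wL2sq (\<lambda>_. 1) ?vf + ennreal (2 * 0\<^sup>2) * wL2sq (\<lambda>_. 1) ?vf"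
      by (intro wL2sq_dominated) (use f c(1) in auto)
    also have "\<dots> = ennreal (2 * c\<^sup>2) * wL2sq (\<lambda>_. 1) ?vf" by simp
    also have "\<dots> \<le> ennreal C * ?H" by (intro mult_mono ennreal_leI C H) auto
    finally have 3: "wL2sq (\<lambda>_. 1) ?f \<le> ennreal C * ?H" .
    have "wL2sq (\<lambda>k. 1 / freq_max k) ?P \<le>
        ennreal (2 * 1\<^sup>2) * wL2sq (\<lambda>_. 1) ?cW + ennreal (2 * (2 * c2 * c)\<^sup>2) * wL2sq (\<lambda>_. 1) ?vf"
    proof (rule wL2sq_dominated)
      fix k
      have mx: "freq_max k > 0" using freq_max_ge_1[of k] by linarith
      have "1 / freq_max k * cmod (?P k) \<le> 1 / freq_max k * (cmod (?W k) + c2 * (freq_weight k * cmod (?f k)))"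
        using mx by (intro mult_left_mono P) simp
      also have "\<dots> = cmod (?W k) / freq_max k + c2 * (freq_weight k / freq_max k * cmod (?f k))"
        by (simp add: distrib_left)
      also have "cmod (?W k) / freq_max k \<le> cmod (?cW k)"
        using mx rp(2) mult_right_mono[of 1 "sqrt (chi_hi D r)" "cmod (?W k)"]
        by (simp add: norm_mult norm_divide divide_right_mono)
      also have "cmod (?cW k) + c2 * (freq_weight k / freq_max k * cmod (?f k)) \<le>
          cmod (?cW k) + c2 * (2 * (c * cmod (?vf k)))"
        using mx freq_weight_le_freq_max[of k] f[of k] freq_weight_nonneg[of k] c2
        by (intro add_left_mono mult_left_mono mult_mono) (auto simp: divide_le_eq)
      finally show "1 / freq_max k * cmod (?P k) \<le> 1 * cmod (?cW k) + (2 * c2 * c) * cmod (?vf k)"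
        by (simp add: mult_ac)
      show "0 \<le> 1 / freq_max k" using mx by simp
    qed (use c(1) c2 in simp_all)
    also have "\<dots> \<le> ennreal (2 * 1\<^sup>2) * ?H + ennreal (2 * (2 * c2 * c)\<^sup>2) * ?H"
      by (intro add_mono mult_left_mono H) auto
    also have "\<dots> = ennreal (2 * 1\<^sup>2 + 2 * (2 * c2 * c)\<^sup>2) * ?H"
      by (simp add: distrib_right)
    also have "\<dots> \<le> ennreal C * ?H" by (intro mult_right_mono ennreal_leI C) simp
    finally have 4: "wL2sq (\<lambda>k. 1 / freq_max k) ?P \<le> ennreal C * ?H" .
    show "wL1 freq_weight (fiber f r \<theta>) \<le> ennreal C * normW M a h0 q f F r \<theta> \<and>
      wL1 (\<lambda>_. 1) (fiber (Wplus_pair M a f F) r \<theta>) \<le> ennreal C * normW M a h0 q f F r \<theta> \<and>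
      wL2sq (\<lambda>_. 1) (fiber f r \<theta>) \<le> ennreal C * (normH M a h0 D q f F r \<theta>)\<^sup>2 \<and>
      wL2sq (\<lambda>k. 1 / freq_max k) (fiber (Wplus_pair M a f F) r \<theta>) \<le> ennreal C * (normH M a h0 D q f F r \<theta>)\<^sup>2"
      using 1 2 3 4 by blast
  qed
  thus ?thesis by blast
qed

end

section \<open>The kernel operator on the closures\<close>

text \<open>\<open>freq_measurable\<close> says nothing about the values outside \<open>rtheta\<close>.\<close>

definition restrict_freq :: "real \<Rightarrow> real \<Rightarrow> freqfun \<Rightarrow> freqfun" where
  "restrict_freq M a f \<omega> m r \<theta> = (if (r, \<theta>) \<in> rtheta M a then f \<omega> m r \<theta> else 0)"

lemma restrict_freq_eq: "(r, \<theta>) \<in> rtheta M a \<Longrightarrow> fiber (restrict_freq M a f) r \<theta> = fiber f r \<theta>"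
  by (rule ext) (simp add: fiber_def restrict_freq_def)

lemma rtheta_borel [measurable]: "rtheta M a \<in> sets borel"
  unfolding rtheta_def by (intro borel_open open_Times) auto

text \<open>\<open>freq_measurable\<close> fixes \<open>m\<close> and speaks of
  \<open>rtheta\<close> only, while integrals with parameters and Tonelli ask for joint
  measurability. Extension by 0 off the Borel set \<open>rtheta\<close> and countability of
  \<open>m\<close> make the two equivalent.\<close>

lemma freq_measurable_iff:
  "freq_measurable M a f \<longleftrightarrow>
    (\<lambda>(p, k). fiber (restrict_freq M a f) (fst p) (snd p) k) \<in> borel_measurable (borel \<Otimes>\<^sub>M freq_space)"
proof -
  let ?g = "\<lambda>m. (\<lambda>(\<omega>, r, \<theta>). restrict_freq M a f \<omega> m r \<theta>)"
  have eq: "(\<lambda>x. indicator (UNIV \<times> rtheta M a) x *\<^sub>R (\<lambda>(\<omega>, r, \<theta>). f \<omega> m r \<theta>) x) = ?g m" for m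
    by (auto simp: restrict_freq_def indicator_def fun_eq_iff)
  have "freq_measurable M a f \<longleftrightarrow> (\<forall>m. ?g m \<in> borel_measurable borel)"
    unfolding freq_measurable_def set_borel_measurable_def eq ..
  also have "\<dots> \<longleftrightarrow> (\<lambda>(p, k). fiber (restrict_freq M a f) (fst p) (snd p) k) \<in> borel_measurable (borel \<Otimes>\<^sub>M freq_space)"
  proof
    assume g: "\<forall>m. ?g m \<in> borel_measurable borel"
    show "(\<lambda>(p, k). fiber (restrict_freq M a f) (fst p) (snd p) k) \<in> borel_measurable (borel \<Otimes>\<^sub>M freq_space)"
    proof (rule measurable_pair_freq_space)
      fix m
      have "(\<lambda>(p, \<omega>). (\<omega>, fst p, snd p)) \<in> measurable (borel \<Otimes>\<^sub>M borel) (borel :: (real \<times> real \<times> real) measure)"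
        unfolding borel_prod[symmetric] by measurable
      from measurable_compose[OF this g[rule_format, of m]]
      show "(\<lambda>(p, \<omega>). case (p, (m, \<omega>)) of (p, k) \<Rightarrow> fiber (restrict_freq M a f) (fst p) (snd p) k) \<in> borel_measurable (borel \<Otimes>\<^sub>M borel)"
        by (simp add: split_def fiber_def)
    qed
  next
    assume f: "(\<lambda>(p, k). fiber (restrict_freq M a f) (fst p) (snd p) k) \<in> borel_measurable (borel \<Otimes>\<^sub>M freq_space)"
    show "\<forall>m. ?g m \<in> borel_measurable borel"
    proof
      fix m
      have "(\<lambda>(\<omega>, r, \<theta>). ((r, \<theta>), (m, \<omega>))) \<in> measurable (borel :: (real \<times> real \<times> real) measure) (borel \<Otimes>\<^sub>M freq_space)"
        unfolding borel_prod[symmetric] freq_space_def by measurable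
      from measurable_compose[OF this f] show "?g m \<in> borel_measurable borel"
        by (simp add: split_def fiber_def)
    qed
  qed
  finally show ?thesis .
qed

lemma freq_measurable_fiber:
  assumes "freq_measurable M a f" "(r, \<theta>) \<in> rtheta M a"
  shows "fiber f r \<theta> \<in> borel_measurable freq_space"
proof -
  have "(\<lambda>k. ((r, \<theta>), k)) \<in> measurable freq_space (borel \<Otimes>\<^sub>M freq_space)" by simp
  from measurable_compose[OF this assms(1)[unfolded freq_measurable_iff]]
  show ?thesis by (simp add: restrict_freq_eq[OF assms(2)])
qed

lemma freq_measurable_restrict:
  assumes "freq_measurable M a f" "g \<in> measurable N borel" "k \<in> measurable N freq_space"
  shows "(\<lambda>x. fiber (restrict_freq M a f) (fst (g x)) (snd (g x)) (k x)) \<in> borel_measurable N"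
  using measurable_compose[OF measurable_Pair[OF assms(2,3)] assms(1)[unfolded freq_measurable_iff]] by simp

lemma kconv_zero: "(\<And>k k'. \<kappa> k k' = 0) \<Longrightarrow> kconv \<kappa> A B k = 0"
  by (simp add: kconv_def)

lemma Wplus_pair_restrict:
  "(r, \<theta>) \<in> rtheta M a \<Longrightarrow>
    fiber (Wplus_pair M a (restrict_freq M a f) (restrict_freq M a F)) r \<theta> = fiber (Wplus_pair M a f F) r \<theta>"
  by (rule ext) (simp add: fiber_Wplus_pair restrict_freq_eq)

text \<open>The kernel formula has to be measurable jointly in \<open>(r, \<theta>)\<close> and the
  frequency for the extension of the commutator to be \<open>freq_measurable\<close>; this is
  measurability of an integral with parameters.\<close>

lemma kconv_measurable_param:
  fixes \<kappa> :: "real \<Rightarrow> int \<times> real \<Rightarrow> int \<times> real \<Rightarrow> complex"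
  assumes \<kappa>: "(\<lambda>(r, k, k'). \<kappa> r k k') \<in> borel_measurable (borel \<Otimes>\<^sub>M freq_space \<Otimes>\<^sub>M freq_space)"
    and A: "(\<lambda>(p, k). A p k) \<in> borel_measurable (borel \<Otimes>\<^sub>M freq_space)"
    and B: "(\<lambda>(p, k). B p k) \<in> borel_measurable (borel \<Otimes>\<^sub>M freq_space)"
  shows "(\<lambda>(p, k). kconv (\<kappa> (fst p)) (A p) (B p) k) \<in> borel_measurable ((borel :: (real \<times> real) measure) \<Otimes>\<^sub>M freq_space)"
proof -
  let ?N = "((borel :: (real \<times> real) measure) \<Otimes>\<^sub>M freq_space) \<Otimes>\<^sub>M freq_space"
  have [measurable]: "fst \<in> borel_measurable (borel :: (real \<times> real) measure)"
    unfolding borel_prod[symmetric] by measurable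
  have m: "(\<lambda>x. (fst (fst (fst x)), snd (fst x), snd x)) \<in> measurable ?N (borel \<Otimes>\<^sub>M freq_space \<Otimes>\<^sub>M freq_space)"
    "(\<lambda>x. (fst (fst x), snd x)) \<in> measurable ?N (borel \<Otimes>\<^sub>M freq_space)"
    "(\<lambda>x. (fst (fst x), snd (fst x) - snd x)) \<in> measurable ?N (borel \<Otimes>\<^sub>M freq_space)"
    by measurable
  have "(\<lambda>x. \<kappa> (fst (fst (fst x))) (snd (fst x)) (snd x) *
      (A (fst (fst x)) (snd x) * B (fst (fst x)) (snd (fst x) - snd x))) \<in> borel_measurable ?N"
    using measurable_compose[OF m(1) \<kappa>] measurable_compose[OF m(2) A] measurable_compose[OF m(3) B]
    by (intro borel_measurable_times) simp_all
  hence "(\<lambda>z. LINT k'|freq_space. \<kappa> (fst (fst z)) (snd z) k' * (A (fst z) k' * B (fst z) (snd z - k'))) \<in>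
      borel_measurable ((borel :: (real \<times> real) measure) \<Otimes>\<^sub>M freq_space)"
    by (intro sigma_finite_measure.borel_measurable_lebesgue_integral[OF sigma_finite_freq_space])
      (simp add: split_def)
  thus ?thesis by (simp add: kconv_def split_def)
qed

lemma fiber_measurable_param:
  "freq_measurable M a f \<Longrightarrow> (\<lambda>(p, k). fiber (restrict_freq M a f) (fst p) (snd p) k) \<in> borel_measurable (borel \<Otimes>\<^sub>M freq_space)"
  by (simp add: freq_measurable_iff)

lemma Wplus_pair_measurable_param:
  assumes "freq_measurable M a f" "freq_measurable M a F"
  shows "(\<lambda>(p, k). fiber (Wplus_pair M a (restrict_freq M a f) (restrict_freq M a F)) (fst p) (snd p) k) \<in>
    borel_measurable ((borel :: (real \<times> real) measure) \<Otimes>\<^sub>M freq_space)"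
proof -
  have [measurable]: "fst \<in> borel_measurable (borel :: (real \<times> real) measure)"
    unfolding borel_prod[symmetric] by measurable
  note [measurable] = assms[THEN fiber_measurable_param]
  show ?thesis
    unfolding fiber_Wplus_pair omega_r_def vfun_def Delta_def split_def
    using assms[THEN fiber_measurable_param] unfolding split_def by measurable
qed

text \<open>The first kernel serves the multiplications \<open>X_T\<close> and \<open>X_phi\<close>, the other two the operator \<open>X_Wplus\<close>,
  whose commutator has a term in which \<open>W\<^sub>+\<close> falls on each of the factors.\<close>

locale comm_kernels = sharp_setting +
  fixes X :: "freqfun \<Rightarrow> freqfun" and \<kappa>1 \<kappa>2 \<kappa>3 :: "real \<Rightarrow> int \<times> real \<Rightarrow> int \<times> real \<Rightarrow> complex" and C0 :: real
  assumes C0: "0 \<le> C0"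
    and k1: "\<And>r. freq_kernel (\<kappa>1 r) (\<lambda>k. C0 * freq_weight k) (\<lambda>_. 1)"
    and k2: "\<And>r. freq_kernel (\<kappa>2 r) (\<lambda>k. C0 * 1) (\<lambda>_. 1)"
    and k3: "\<And>r. freq_kernel (\<kappa>3 r) (\<lambda>k. C0 * freq_weight k) (\<lambda>k. 1 / freq_max k)"
    and kernels_measurable:
      "(\<lambda>(r, k, k'). \<kappa>1 r k k') \<in> borel_measurable (borel \<Otimes>\<^sub>M freq_space \<Otimes>\<^sub>M freq_space)"
      "(\<lambda>(r, k, k'). \<kappa>2 r k k') \<in> borel_measurable (borel \<Otimes>\<^sub>M freq_space \<Otimes>\<^sub>M freq_space)"
      "(\<lambda>(r, k, k'). \<kappa>3 r k k') \<in> borel_measurable (borel \<Otimes>\<^sub>M freq_space \<Otimes>\<^sub>M freq_space)"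
    and support: "\<And>r k k'. r \<notin> r_supp \<Longrightarrow> \<kappa>1 r k k' = 0 \<and> \<kappa>2 r k k' = 0 \<and> \<kappa>3 r k k' = 0"
    and commutator_hat: "\<And>U V \<omega> m r \<theta>. smooth_supp U \<Longrightarrow> smooth_supp V \<Longrightarrow> r > 0 \<Longrightarrow>
      commutator X (hat V) (hat U) \<omega> m r \<theta> =
        kconv (\<kappa>1 r) (fiber (hat V) r \<theta>) (fiber (hat U) r \<theta>) (m, \<omega>) +
        (kconv (\<kappa>2 r) (fiber (Wplus M a (hat V)) r \<theta>) (fiber (hat U) r \<theta>) (m, \<omega>) +
         kconv (\<kappa>3 r) (fiber (hat V) r \<theta>) (fiber (Wplus M a (hat U)) r \<theta>) (m, \<omega>))"
begin

text \<open>The explicit candidate for the continuous extension. On transforms of test functions it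
  is the commutator itself, by \<open>commutator_hat\<close>; on the closures each of the three
  integrals converges for almost every frequency when \<open>r\<close> is in \<open>r_supp\<close>,
  for almost every \<open>(r, \<theta>)\<close>.\<close>

definition comm_op :: "freqfun \<Rightarrow> freqfun \<Rightarrow> freqfun \<Rightarrow> freqfun \<Rightarrow> freqfun" where
  "comm_op f F g G \<omega> m r \<theta> =
     kconv (\<kappa>1 r) (fiber f r \<theta>) (fiber g r \<theta>) (m, \<omega>) +
     (kconv (\<kappa>2 r) (fiber (Wplus_pair M a f F) r \<theta>) (fiber g r \<theta>) (m, \<omega>) +
      kconv (\<kappa>3 r) (fiber f r \<theta>) (fiber (Wplus_pair M a g G) r \<theta>) (m, \<omega>))"

lemma fiber_comm_op:
  "fiber (comm_op f F g G) r \<theta> = (\<lambda>k.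
     kconv (\<kappa>1 r) (fiber f r \<theta>) (fiber g r \<theta>) k +
     (kconv (\<kappa>2 r) (fiber (Wplus_pair M a f F) r \<theta>) (fiber g r \<theta>) k +
      kconv (\<kappa>3 r) (fiber f r \<theta>) (fiber (Wplus_pair M a g G) r \<theta>) k))"
  by (rule ext) (simp add: fiber_def[of "comm_op f F g G"] comm_op_def)

lemma fiber_commutator_hat:
  assumes "smooth_supp U" "smooth_supp V" "r > 0"
  shows "fiber (commutator X (hat V) (hat U)) r \<theta> =
    fiber (comm_op (hat V) (Rstar M a (hat V)) (hat U) (Rstar M a (hat U))) r \<theta>"
  by (rule ext) (simp add: fiber_def[of "commutator _ _ _"] fiber_def[of "comm_op _ _ _ _"]
      commutator_hat[OF assms] comm_op_def Wplus_eq_Wplus_pair)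

lemma fiber_comm_op_outside: "r \<notin> r_supp \<Longrightarrow> fiber (comm_op f F g G) r \<theta> = (\<lambda>_. 0)"
  using support[of r] by (simp add: fiber_comm_op kconv_zero)

lemma comm_op_restrict:
  assumes "(r, \<theta>) \<in> rtheta M a"
  shows "fiber (comm_op (restrict_freq M a f) (restrict_freq M a F) (restrict_freq M a g) (restrict_freq M a G)) r \<theta> =
    fiber (comm_op f F g G) r \<theta>"
  unfolding fiber_comm_op Wplus_pair_restrict[OF assms] restrict_freq_eq[OF assms] ..

lemma freq_measurable_comm_op:
  assumes "freq_measurable M a f" "freq_measurable M a F" "freq_measurable M a g" "freq_measurable M a G"
  shows "freq_measurable M a (comm_op f F g G)"
proof -
  let ?K = "comm_op (restrict_freq M a f) (restrict_freq M a F) (restrict_freq M a g) (restrict_freq M a G)"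
  have K: "(\<lambda>(p, k). fiber ?K (fst p) (snd p) k) \<in> borel_measurable (borel \<Otimes>\<^sub>M freq_space)"
    unfolding fiber_comm_op split_def
    using kconv_measurable_param[OF kernels_measurable(1) fiber_measurable_param[OF assms(1)] fiber_measurable_param[OF assms(3)]]
      kconv_measurable_param[OF kernels_measurable(2) Wplus_pair_measurable_param[OF assms(1,2)] fiber_measurable_param[OF assms(3)]]
      kconv_measurable_param[OF kernels_measurable(3) fiber_measurable_param[OF assms(1)] Wplus_pair_measurable_param[OF assms(3,4)]]
    unfolding split_def by (intro borel_measurable_add)
  have [measurable]: "{x \<in> space (borel \<Otimes>\<^sub>M freq_space). fst x \<in> rtheta M a} \<in> sets (borel \<Otimes>\<^sub>M freq_space)"
    by measurable
  have "(\<lambda>(p, k). fiber (restrict_freq M a (comm_op f F g G)) (fst p) (snd p) k) =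
      (\<lambda>x. if fst x \<in> rtheta M a then (\<lambda>(p, k). fiber ?K (fst p) (snd p) k) x else 0)"
  proof (rule ext)
    fix x :: "(real \<times> real) \<times> int \<times> real"
    obtain r \<theta> k where x: "x = ((r, \<theta>), k)" by (metis surj_pair)
    show "(\<lambda>(p, k). fiber (restrict_freq M a (comm_op f F g G)) (fst p) (snd p) k) x =
      (if fst x \<in> rtheta M a then (\<lambda>(p, k). fiber ?K (fst p) (snd p) k) x else 0)"
    proof (cases "(r, \<theta>) \<in> rtheta M a")
      case True
      thus ?thesis by (simp add: x comm_op_restrict restrict_freq_eq)
    qed (simp add: x fiber_def[of "restrict_freq _ _ _"] restrict_freq_def)
  qed
  also have "\<dots> \<in> borel_measurable (borel \<Otimes>\<^sub>M freq_space)"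
    by (intro measurable_If K) auto
  finally show ?thesis unfolding freq_measurable_iff .
qed

lemma comm_op_measurable:
  assumes [measurable]: "fiber f r \<theta> \<in> borel_measurable freq_space" "fiber F r \<theta> \<in> borel_measurable freq_space"
    "fiber g r \<theta> \<in> borel_measurable freq_space" "fiber G r \<theta> \<in> borel_measurable freq_space"
  shows "fiber (comm_op f F g G) r \<theta> \<in> borel_measurable freq_space"
  unfolding fiber_comm_op
  by (intro borel_measurable_add freq_kernel.kconv_measurable[OF k1] freq_kernel.kconv_measurable[OF k2]
      freq_kernel.kconv_measurable[OF k3] fiber_Wplus_pair_measurable assms)

text \<open>In each of the three terms the weights of the kernel bound are ones that
  \<open>norm_const\<close> controls: first factor by \<open>normW\<close>, second factor by
  \<open>normH\<close>.\<close>

lemma comm_op_bound: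
  obtains C where "C > 0"
    "\<And>q r \<theta> f F g G. 0 \<le> q \<Longrightarrow> q \<le> 1 \<Longrightarrow> r \<in> r_supp \<Longrightarrow>
      fiber f r \<theta> \<in> borel_measurable freq_space \<Longrightarrow> fiber F r \<theta> \<in> borel_measurable freq_space \<Longrightarrow>
      fiber g r \<theta> \<in> borel_measurable freq_space \<Longrightarrow> fiber G r \<theta> \<in> borel_measurable freq_space \<Longrightarrow>
      wL2sq (\<lambda>_. 1) (fiber (comm_op f F g G) r \<theta>) \<le>
        ennreal C * ((normW M a h0 q f F r \<theta>)\<^sup>2 * (normH M a h0 D q g G r \<theta>)\<^sup>2)"
proof -
  obtain c where nc: "norm_const c" using ex_norm_const by blast
  hence c: "c \<ge> 0" unfolding norm_const_def by blast
  \<comment> \<open>\<open>10 = 2 * (1 + 2 * (1 + 1))\<close> from splitting a sum of three terms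
    twice; \<open>C0\<close> and one \<open>c\<close> belong to the first factor and are squared,
    the other \<open>c\<close> to the second, whose norm is already squared. The added 1 makes
    \<open>C\<close> positive.\<close>
  define C where "C = 10 * ((C0 * c)\<^sup>2 * c) + 1"
  have "wL2sq (\<lambda>_. 1) (fiber (comm_op f F g G) r \<theta>) \<le>
        ennreal C * ((normW M a h0 q f F r \<theta>)\<^sup>2 * (normH M a h0 D q g G r \<theta>)\<^sup>2)"
    if q: "0 \<le> q" "q \<le> 1" and r: "r \<in> r_supp" and
      m [measurable]: "fiber f r \<theta> \<in> borel_measurable freq_space" "fiber F r \<theta> \<in> borel_measurable freq_space"
      "fiber g r \<theta> \<in> borel_measurable freq_space" "fiber G r \<theta> \<in> borel_measurable freq_space"
    for q r \<theta> f F g G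
  proof -
    let ?N = "normW M a h0 q f F r \<theta>" and ?H = "(normH M a h0 D q g G r \<theta>)\<^sup>2"
    let ?f = "fiber f r \<theta>" and ?g = "fiber g r \<theta>"
    let ?Wf = "fiber (Wplus_pair M a f F) r \<theta>" and ?Wg = "fiber (Wplus_pair M a g G) r \<theta>"
    note Wm = fiber_Wplus_pair_measurable[OF m(1,2), of M a] fiber_Wplus_pair_measurable[OF m(3,4), of M a]
    note nf = norm_constD[OF nc q r m(1,2)] and ng = norm_constD[OF nc q r m(3,4)]
    let ?T = "(ennreal (C0 * c) * ?N)\<^sup>2 * (ennreal c * ?H)"
    \<comment> \<open>One bound for all three kernels, with \<open>p\<close> either
      \<open>freq_weight\<close> or 1 and \<open>\<rho>\<close> either 1 or
      \<open>1 / freq_max\<close>.\<close>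
    have kernel_le: "wL2sq (\<lambda>_. 1) (kconv \<kappa> A B) \<le> ?T"
      if "freq_kernel \<kappa> (\<lambda>k. C0 * p k) \<rho>" "A \<in> borel_measurable freq_space" "B \<in> borel_measurable freq_space"
        "wL1 p A \<le> ennreal c * ?N" "wL2sq \<rho> B \<le> ennreal c * ?H" "p \<in> borel_measurable freq_space" "\<And>k. 0 \<le> p k"
      for \<kappa> p \<rho> A B
    proof -
      have "wL1 (\<lambda>k. C0 * p k) A = ennreal C0 * wL1 p A"
        by (rule wL1_cmult) (use that C0 in auto)
      also have "\<dots> \<le> ennreal C0 * (ennreal c * ?N)" by (intro mult_left_mono that) simp
      also have "\<dots> = ennreal (C0 * c) * ?N" using C0 c by (simp add: ennreal_mult mult.assoc)
      finally have le: "wL1 (\<lambda>k. C0 * p k) A \<le> ennreal (C0 * c) * ?N" .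
      have "wL2sq (\<lambda>_. 1) (kconv \<kappa> A B) \<le> (wL1 (\<lambda>k. C0 * p k) A)\<^sup>2 * wL2sq \<rho> B"
        by (rule freq_kernel.kconv_bound[OF that(1-3)])
      also have "\<dots> \<le> ?T" by (intro mult_mono power_mono le that) auto
      finally show ?thesis .
    qed
    have t1: "wL2sq (\<lambda>_. 1) (kconv (\<kappa>1 r) ?f ?g) \<le> ?T"
      by (rule kernel_le[OF k1 m(1,3)]) (use nf ng freq_weight_nonneg in auto)
    have t2: "wL2sq (\<lambda>_. 1) (kconv (\<kappa>2 r) ?Wf ?g) \<le> ?T"
      by (rule kernel_le[OF k2 Wm(1) m(3)]) (use nf ng in auto)
    have t3: "wL2sq (\<lambda>_. 1) (kconv (\<kappa>3 r) ?f ?Wg) \<le> ?T"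
      by (rule kernel_le[OF k3 m(1) Wm(2)]) (use nf ng freq_weight_nonneg in auto)
    have km: "kconv (\<kappa>1 r) ?f ?g \<in> borel_measurable freq_space" "kconv (\<kappa>2 r) ?Wf ?g \<in> borel_measurable freq_space"
      "kconv (\<kappa>3 r) ?f ?Wg \<in> borel_measurable freq_space"
      by (intro freq_kernel.kconv_measurable[OF k1] freq_kernel.kconv_measurable[OF k2]
         freq_kernel.kconv_measurable[OF k3] m Wm)+
    have "wL2sq (\<lambda>_. 1) (fiber (comm_op f F g G) r \<theta>) \<le> 2 * (wL2sq (\<lambda>_. 1) (kconv (\<kappa>1 r) ?f ?g) +
        wL2sq (\<lambda>_. 1) (\<lambda>k. kconv (\<kappa>2 r) ?Wf ?g k + kconv (\<kappa>3 r) ?f ?Wg k))"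
      unfolding fiber_comm_op by (intro wL2sq_add_le borel_measurable_add km borel_measurable_const)
    also have "\<dots> \<le> 2 * (?T + 2 * (?T + ?T))"
    proof -
      have "wL2sq (\<lambda>_. 1) (\<lambda>k. kconv (\<kappa>2 r) ?Wf ?g k + kconv (\<kappa>3 r) ?f ?Wg k) \<le>
          2 * (wL2sq (\<lambda>_. 1) (kconv (\<kappa>2 r) ?Wf ?g) + wL2sq (\<lambda>_. 1) (kconv (\<kappa>3 r) ?f ?Wg))"
        by (intro wL2sq_add_le km borel_measurable_const)
      also have "\<dots> \<le> 2 * (?T + ?T)" by (intro mult_left_mono add_mono t2 t3) simp
      finally show ?thesis by (intro mult_left_mono add_mono t1) simp_all
    qed
    also have "\<dots> = 10 * ?T" by (simp add: mult_2[symmetric] distrib_right[symmetric] mult.assoc[symmetric])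
    also have "\<dots> = ennreal (10 * ((C0 * c)\<^sup>2 * c)) * (?N\<^sup>2 * ?H)"
    proof -
      have e: "ennreal (10 * ((C0 * c)\<^sup>2 * c)) = 10 * ((ennreal (C0 * c))\<^sup>2 * ennreal c)"
      proof -
        have "(ennreal (C0 * c))\<^sup>2 = ennreal ((C0 * c)\<^sup>2)" using c C0 by (intro ennreal_power) simp
        thus ?thesis using c by (simp only:) (simp add: ennreal_mult)
      qed
      show ?thesis unfolding e power_mult_distrib[of "ennreal (C0 * c)"] by (simp only: mult_ac)
    qed
    also have "\<dots> \<le> ennreal C * (?N\<^sup>2 * ?H)"
      by (intro mult_right_mono ennreal_leI) (simp_all add: C_def)
    finally show ?thesis .
  qed
  moreover have "C > 0" unfolding C_def using c by (simp add: add_nonneg_pos)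
  ultimately show ?thesis by (intro that[of C]) auto
qed

end

section \<open>Passage to the limit along approximating sequences\<close>

lemma wL1_finite_of_tendsto:
  assumes "p \<in> borel_measurable freq_space" "\<And>n. A n \<in> borel_measurable freq_space" "B \<in> borel_measurable freq_space"
    "\<And>k. 0 \<le> p k" and fin: "\<And>n. wL1 p (A n) < \<infinity>" and lim: "(\<lambda>n. wL1 p (\<lambda>k. A n k - B k)) \<longlonglongrightarrow> 0"
  shows "wL1 p B < \<infinity>"
proof -
  obtain n where n: "wL1 p (\<lambda>k. A n k - B k) < 1"
    using order_tendstoD(2)[OF lim, of 1] by (auto simp: eventually_sequentially)
  have "wL1 p B \<le> wL1 p (A n) + wL1 p (\<lambda>k. A n k - B k)" by (rule wL1_triangle) fact+
  also have "\<dots> < \<infinity>" using fin[of n] order.strict_trans[OF n, of \<infinity>] by simp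
  finally show ?thesis .
qed

lemma wL2sq_finite_of_tendsto:
  assumes "\<rho> \<in> borel_measurable freq_space" "\<And>n. A n \<in> borel_measurable freq_space" "B \<in> borel_measurable freq_space"
    and fin: "\<And>n. wL2sq \<rho> (A n) < \<infinity>" and lim: "(\<lambda>n. wL2sq \<rho> (\<lambda>k. A n k - B k)) \<longlonglongrightarrow> 0"
  shows "wL2sq \<rho> B < \<infinity>"
proof -
  obtain n where n: "wL2sq \<rho> (\<lambda>k. A n k - B k) < 1"
    using order_tendstoD(2)[OF lim, of 1] by (auto simp: eventually_sequentially)
  have "wL2sq \<rho> B \<le> 2 * (wL2sq \<rho> (A n) + wL2sq \<rho> (\<lambda>k. A n k - B k))" by (rule wL2sq_triangle) fact+
  also have "\<dots> < \<infinity>" using fin[of n] order.strict_trans[OF n, of \<infinity>] by (simp add: ennreal_mult_less_top)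
  finally show ?thesis .
qed

lemma wL1_freq_weight_hat_finite:
  assumes U: "smooth_supp U" shows "wL1 freq_weight (fiber (hat U) r \<theta>) < \<infinity>"
proof -
  let ?A = "fiber (hat U) r \<theta>"
  have "integrable freq_space (\<lambda>k. cmod (of_real (snd k) * ?A k) + cmod (of_int (fst k) * ?A k))"
    by (intro Bochner_Integration.integrable_add integrable_norm decaying_integrable decaying_times_omega decaying_times_m U)
  hence "(\<integral>\<^sup>+k. ennreal (norm (cmod (of_real (snd k) * ?A k) + cmod (of_int (fst k) * ?A k))) \<partial>freq_space) < \<infinity>"
    by (simp only: integrable_iff_bounded)
  also have "(\<integral>\<^sup>+k. ennreal (norm (cmod (of_real (snd k) * ?A k) + cmod (of_int (fst k) * ?A k))) \<partial>freq_space) =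
      wL1 freq_weight ?A"
    unfolding wL1_def freq_weight_def
    by (intro nn_integral_cong arg_cong[of _ _ ennreal]) (simp add: norm_mult distrib_right add.commute)
  finally show ?thesis .
qed

lemma wL2sq_mono_weight:
  assumes "\<And>k. 0 \<le> \<rho> k" "\<And>k. \<rho> k \<le> 1"
  shows "wL2sq \<rho> A \<le> wL2sq (\<lambda>_. 1) A"
  unfolding wL2sq_def
  by (intro nn_integral_mono ennreal_leI power_mono mult_right_mono assms mult_nonneg_nonneg) simp_all

lemma fiber_diff: "fiber (\<lambda>\<omega> m r \<theta>. f \<omega> m r \<theta> - g \<omega> m r \<theta>) r \<theta> = (\<lambda>k. fiber f r \<theta> k - fiber g r \<theta> k)"
  by (rule ext) (simp add: fiber_def)

lemma fiber_Wplus_pair_diff: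
  "fiber (Wplus_pair M a (\<lambda>\<omega> m r \<theta>. f \<omega> m r \<theta> - g \<omega> m r \<theta>) (\<lambda>\<omega> m r \<theta>. F \<omega> m r \<theta> - G \<omega> m r \<theta>)) r \<theta> =
    (\<lambda>k. fiber (Wplus_pair M a f F) r \<theta> k - fiber (Wplus_pair M a g G) r \<theta> k)"
  by (rule ext) (simp add: fiber_Wplus_pair fiber_diff right_diff_distrib)

interpretation freq_lborel: pair_sigma_finite freq_space "lborel :: real measure"
  by (intro pair_sigma_finite.intro sigma_finite_freq_space lborel.sigma_finite_measure_axioms)

lemma nn_integral_freq_space_swap:
  fixes \<Phi> :: "real \<times> real \<Rightarrow> int \<times> real \<Rightarrow> ennreal"
  assumes "(\<lambda>(p, k). \<Phi> p k) \<in> borel_measurable (borel \<Otimes>\<^sub>M freq_space)"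
  shows "(\<integral>\<^sup>+m. (\<integral>\<^sup>+\<omega>. (\<integral>\<^sup>+\<theta>. (\<integral>\<^sup>+r. \<Phi> (r, \<theta>) (m, \<omega>) \<partial>lborel) \<partial>lborel) \<partial>lborel) \<partial>count_space UNIV) =
    (\<integral>\<^sup>+\<theta>. (\<integral>\<^sup>+r. (\<integral>\<^sup>+k. \<Phi> (r, \<theta>) k \<partial>freq_space) \<partial>lborel) \<partial>lborel)"
proof -
  have comp: "(\<lambda>x. \<Phi> (f x, g x) (h x)) \<in> borel_measurable N"
    if [measurable]: "f \<in> borel_measurable N" "g \<in> borel_measurable N" "h \<in> measurable N freq_space" for f g h N
  proof -
    have "(\<lambda>x. ((f x, g x), h x)) \<in> measurable N (borel \<Otimes>\<^sub>M freq_space)"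
      unfolding borel_prod[symmetric] by measurable
    from measurable_compose[OF this assms] show ?thesis by simp
  qed
  have "(\<lambda>k. \<integral>\<^sup>+\<theta>. (\<integral>\<^sup>+r. \<Phi> (r, \<theta>) k \<partial>lborel) \<partial>lborel) \<in> borel_measurable freq_space"
    unfolding split_def by (intro lborel.borel_measurable_nn_integral) (auto intro!: lborel.borel_measurable_nn_integral comp simp: split_def)
  hence "(\<integral>\<^sup>+m. (\<integral>\<^sup>+\<omega>. (\<integral>\<^sup>+\<theta>. (\<integral>\<^sup>+r. \<Phi> (r, \<theta>) (m, \<omega>) \<partial>lborel) \<partial>lborel) \<partial>lborel) \<partial>count_space UNIV) =
      (\<integral>\<^sup>+k. (\<integral>\<^sup>+\<theta>. (\<integral>\<^sup>+r. \<Phi> (r, \<theta>) k \<partial>lborel) \<partial>lborel) \<partial>freq_space)"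
    by (subst nn_integral_freq_space) auto
  also have "\<dots> = (\<integral>\<^sup>+\<theta>. (\<integral>\<^sup>+k. (\<integral>\<^sup>+r. \<Phi> (r, \<theta>) k \<partial>lborel) \<partial>freq_space) \<partial>lborel)"
    by (rule freq_lborel.Fubini'[symmetric])
      (auto intro!: lborel.borel_measurable_nn_integral comp simp: split_def)
  also have "\<dots> = (\<integral>\<^sup>+\<theta>. (\<integral>\<^sup>+r. (\<integral>\<^sup>+k. \<Phi> (r, \<theta>) k \<partial>freq_space) \<partial>lborel) \<partial>lborel)"
    by (intro nn_integral_cong freq_lborel.Fubini'[symmetric]) (auto intro!: comp simp: split_def)
  finally show ?thesis .
qed

context comm_kernels begin

text \<open>At one \<open>(r, \<theta>)\<close>, convergence in \<open>normW\<close> and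
  \<open>normH\<close> gives, through \<open>norm_const\<close>, convergence of the weighted
  quantities in each kernel bound; then \<open>kconv_tendsto\<close> applies to the three
  terms.\<close>

lemma comm_op_tendsto:
  assumes p: "(r, \<theta>) \<in> rtheta M a" and q: "0 \<le> q" "q \<le> 1"
    and meas: "freq_measurable M a f" "freq_measurable M a F" "freq_measurable M a g" "freq_measurable M a G"
    and VU: "\<And>n. smooth_supp (V n)" "\<And>n. smooth_supp (U n)"
    and limW: "(\<lambda>n. normW M a h0 q (\<lambda>\<omega> m r \<theta>. hat (V n) \<omega> m r \<theta> - f \<omega> m r \<theta>)
        (\<lambda>\<omega> m r \<theta>. Rstar M a (hat (V n)) \<omega> m r \<theta> - F \<omega> m r \<theta>) r \<theta>) \<longlonglongrightarrow> 0"
    and limH: "(\<lambda>n. normH M a h0 D q (\<lambda>\<omega> m r \<theta>. hat (U n) \<omega> m r \<theta> - g \<omega> m r \<theta>)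
        (\<lambda>\<omega> m r \<theta>. Rstar M a (hat (U n)) \<omega> m r \<theta> - G \<omega> m r \<theta>) r \<theta>) \<longlonglongrightarrow> 0"
  shows "(\<lambda>n. l2L2 (\<lambda>\<omega> m. commutator X (hat (V n)) (hat (U n)) \<omega> m r \<theta> - comm_op f F g G \<omega> m r \<theta>)) \<longlonglongrightarrow> 0"
proof -
  have r: "r > 0" using p rplus_pos by (auto simp: rtheta_def)
  let ?V = "\<lambda>n. hat (V n)" and ?V' = "\<lambda>n. Rstar M a (hat (V n))"
  let ?U = "\<lambda>n. hat (U n)" and ?U' = "\<lambda>n. Rstar M a (hat (U n))"
  have m0: "fiber f r \<theta> \<in> borel_measurable freq_space" "fiber F r \<theta> \<in> borel_measurable freq_space"
    "fiber g r \<theta> \<in> borel_measurable freq_space" "fiber G r \<theta> \<in> borel_measurable freq_space"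
    by (intro freq_measurable_fiber[OF _ p] meas)+
  have mn: "fiber (?V n) r \<theta> \<in> borel_measurable freq_space" "fiber (?V' n) r \<theta> \<in> borel_measurable freq_space"
    "fiber (?U n) r \<theta> \<in> borel_measurable freq_space" "fiber (?U' n) r \<theta> \<in> borel_measurable freq_space" for n
    by (intro borel_measurable_integrable decaying_integrable decaying_fiber_hat decaying_fiber_Rstar_hat VU r)+
  note km0 = comm_op_measurable[OF m0] and kmn = comm_op_measurable[OF mn(1,2,3,4)]
  let ?d = "\<lambda>n. wL2sq (\<lambda>_. 1) (\<lambda>k. fiber (comm_op (?V n) (?V' n) (?U n) (?U' n)) r \<theta> k - fiber (comm_op f F g G) r \<theta> k)"
  have l2: "l2L2 (\<lambda>\<omega> m. commutator X (hat (V n)) (hat (U n)) \<omega> m r \<theta> - comm_op f F g G \<omega> m r \<theta>) = ennsqrt (?d n)" for n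
  proof -
    have eq: "commutator X (hat (V n)) (hat (U n)) (snd k) (fst k) r \<theta> - comm_op f F g G (snd k) (fst k) r \<theta> =
        fiber (comm_op (?V n) (?V' n) (?U n) (?U' n)) r \<theta> k - fiber (comm_op f F g G) r \<theta> k" for k
      unfolding fiber_commutator_hat[OF VU(2) VU(1) r, symmetric] by (simp add: fiber_def)
    show ?thesis by (subst l2L2_eq) (simp_all only: eq borel_measurable_diff kmn km0)
  qed
  have "?d \<longlonglongrightarrow> 0"
  proof (cases "r \<in> r_supp")
    \<comment> \<open>Off \<open>r_supp\<close> the kernels vanish, so the commutators and the
      candidate limit are both 0.\<close>
    case False
    thus ?thesis by (simp add: fiber_comm_op_outside wL2sq_def)
  next
    case True
    obtain c where nc: "norm_const c" using ex_norm_const by blast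
    let ?W = "\<lambda>n. fiber (Wplus_pair M a (?V n) (?V' n)) r \<theta>" and ?w = "fiber (Wplus_pair M a f F) r \<theta>"
    let ?Y = "\<lambda>n. fiber (Wplus_pair M a (?U n) (?U' n)) r \<theta>" and ?y = "fiber (Wplus_pair M a g G) r \<theta>"
    have Wm: "?W n \<in> borel_measurable freq_space" "?Y n \<in> borel_measurable freq_space" for n
      by (intro fiber_Wplus_pair_measurable mn)+
    have wm: "?w \<in> borel_measurable freq_space" "?y \<in> borel_measurable freq_space"
      by (intro fiber_Wplus_pair_measurable m0)+
    have rhoM: "(\<lambda>k. 1 / freq_max k) \<in> borel_measurable freq_space" by measurable
    have rho: "0 \<le> 1 / freq_max k" "1 / freq_max k \<le> 1" for k
      using freq_max_ge_1[of k] by auto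
    let ?dV = "\<lambda>n \<omega> m r \<theta>. hat (V n) \<omega> m r \<theta> - f \<omega> m r \<theta>"
      and ?dV' = "\<lambda>n \<omega> m r \<theta>. Rstar M a (hat (V n)) \<omega> m r \<theta> - F \<omega> m r \<theta>"
      and ?dU = "\<lambda>n \<omega> m r \<theta>. hat (U n) \<omega> m r \<theta> - g \<omega> m r \<theta>"
      and ?dU' = "\<lambda>n \<omega> m r \<theta>. Rstar M a (hat (U n)) \<omega> m r \<theta> - G \<omega> m r \<theta>"
    let ?nW = "\<lambda>n. normW M a h0 q (?dV n) (?dV' n) r \<theta>"
      and ?nH = "\<lambda>n. normH M a h0 D q (?dU n) (?dU' n) r \<theta>"
    have dm: "fiber (?dV n) r \<theta> \<in> borel_measurable freq_space" "fiber (?dV' n) r \<theta> \<in> borel_measurable freq_space"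
      "fiber (?dU n) r \<theta> \<in> borel_measurable freq_space" "fiber (?dU' n) r \<theta> \<in> borel_measurable freq_space" for n
      unfolding fiber_diff by (intro borel_measurable_diff mn m0)+
    have b: "wL1 freq_weight (\<lambda>k. fiber (?V n) r \<theta> k - fiber f r \<theta> k) \<le> ennreal c * ?nW n"
      "wL1 (\<lambda>_. 1) (\<lambda>k. ?W n k - ?w k) \<le> ennreal c * ?nW n" for n
      using norm_constD(1,2)[OF nc q True dm(1,2)[of n]] unfolding fiber_diff fiber_Wplus_pair_diff .
    have b': "wL2sq (\<lambda>_. 1) (\<lambda>k. fiber (?U n) r \<theta> k - fiber g r \<theta> k) \<le> ennreal c * (?nH n)\<^sup>2"
      "wL2sq (\<lambda>k. 1 / freq_max k) (\<lambda>k. ?Y n k - ?y k) \<le> ennreal c * (?nH n)\<^sup>2" for n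
      using norm_constD(3,4)[OF nc q True dm(3,4)[of n]] unfolding fiber_diff fiber_Wplus_pair_diff .
    have limW': "(\<lambda>n. ennreal c * ?nW n) \<longlonglongrightarrow> 0"
      using ennreal_tendsto_cmult[OF _ limW, of "ennreal c"] by simp
    have limH': "(\<lambda>n. ennreal c * (?nH n)\<^sup>2) \<longlonglongrightarrow> 0"
      unfolding power2_eq_square
      using ennreal_tendsto_cmult[OF _ tendsto_mult_ennreal[OF limH limH], of "ennreal c"] by simp
    have l: "(\<lambda>n. wL1 freq_weight (\<lambda>k. fiber (?V n) r \<theta> k - fiber f r \<theta> k)) \<longlonglongrightarrow> 0"
        "(\<lambda>n. wL1 (\<lambda>_. 1) (\<lambda>k. ?W n k - ?w k)) \<longlonglongrightarrow> 0"
      by (rule tendsto_sandwich[OF _ always_eventually[OF allI] tendsto_const limW'], simp, rule b)+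
    have l': "(\<lambda>n. wL2sq (\<lambda>_. 1) (\<lambda>k. fiber (?U n) r \<theta> k - fiber g r \<theta> k)) \<longlonglongrightarrow> 0"
        "(\<lambda>n. wL2sq (\<lambda>k. 1 / freq_max k) (\<lambda>k. ?Y n k - ?y k)) \<longlonglongrightarrow> 0"
      by (rule tendsto_sandwich[OF _ always_eventually[OF allI] tendsto_const limH'], simp, rule b')+
    have WYdec: "decaying (?W n)" "decaying (?Y n)" for n
      unfolding Wplus_eq_Wplus_pair[symmetric] by (intro decaying_fiber_Wplus_hat VU r)+
    \<comment> \<open>The closures carry no explicit finiteness condition; the limits inherit it
      from the transforms, which decay, through an approximant at distance less than 1.\<close>
    have fin: "wL1 freq_weight (fiber f r \<theta>) < \<infinity>" "wL1 (\<lambda>_. 1) ?w < \<infinity>"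
      "wL2sq (\<lambda>_. 1) (fiber g r \<theta>) < \<infinity>" "wL2sq (\<lambda>k. 1 / freq_max k) ?y < \<infinity>"
    proof -
      show "wL1 freq_weight (fiber f r \<theta>) < \<infinity>"
        by (rule wL1_finite_of_tendsto[OF _ mn(1) m0(1) freq_weight_nonneg wL1_freq_weight_hat_finite[OF VU(1)] l(1)]) measurable
      show "wL1 (\<lambda>_. 1) ?w < \<infinity>"
        by (rule wL1_finite_of_tendsto[OF _ Wm(1) wm(1) _ decaying_wL1_finite[OF WYdec(1)] l(2)]) simp_all
      show "wL2sq (\<lambda>_. 1) (fiber g r \<theta>) < \<infinity>"
        by (rule wL2sq_finite_of_tendsto[OF _ mn(3) m0(3) decaying_wL2sq_finite[OF decaying_fiber_hat[OF VU(2)]] l'(1)]) simp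
      show "wL2sq (\<lambda>k. 1 / freq_max k) ?y < \<infinity>"
        by (rule wL2sq_finite_of_tendsto[OF rhoM Wm(2) wm(2)
            order.strict_trans1[OF wL2sq_mono_weight[OF rho] decaying_wL2sq_finite[OF WYdec(2)]] l'(2)])
    qed
    have sc: "wL1 (\<lambda>k. C0 * p k) A = ennreal C0 * wL1 p A"
      if "p \<in> borel_measurable freq_space" "A \<in> borel_measurable freq_space" "\<And>k. 0 \<le> p k" for p A
      using that C0 by (intro wL1_cmult) auto
    have scl: "(\<lambda>n. wL1 (\<lambda>k. C0 * p k) (\<lambda>k. A n k - B k)) \<longlonglongrightarrow> 0"
      if "p \<in> borel_measurable freq_space" "\<And>n. A n \<in> borel_measurable freq_space" "B \<in> borel_measurable freq_space"
        "\<And>k. 0 \<le> p k" "(\<lambda>n. wL1 p (\<lambda>k. A n k - B k)) \<longlonglongrightarrow> 0" for p A B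
      using ennreal_tendsto_cmult[OF _ that(5), of "ennreal C0"] that by (simp add: sc borel_measurable_diff)
    have scf: "wL1 (\<lambda>k. C0 * p k) A < \<infinity>"
      if "p \<in> borel_measurable freq_space" "A \<in> borel_measurable freq_space" "\<And>k. 0 \<le> p k" "wL1 p A < \<infinity>" for p A
      using that by (simp add: sc ennreal_mult_less_top)
    let ?k1 = "\<lambda>n k. kconv (\<kappa>1 r) (fiber (?V n) r \<theta>) (fiber (?U n) r \<theta>) k - kconv (\<kappa>1 r) (fiber f r \<theta>) (fiber g r \<theta>) k"
    let ?k2 = "\<lambda>n k. kconv (\<kappa>2 r) (?W n) (fiber (?U n) r \<theta>) k - kconv (\<kappa>2 r) ?w (fiber g r \<theta>) k"
    let ?k3 = "\<lambda>n k. kconv (\<kappa>3 r) (fiber (?V n) r \<theta>) (?Y n) k - kconv (\<kappa>3 r) (fiber f r \<theta>) ?y k"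
    have t1: "(\<lambda>n. wL2sq (\<lambda>_. 1) (?k1 n)) \<longlonglongrightarrow> 0"
      by (rule freq_kernel.kconv_tendsto[OF k1 mn(1) mn(3) m0(1) m0(3) scf fin(3) scl l'(1)])
        (use m0 mn fin l freq_weight_nonneg in auto)
    have t2: "(\<lambda>n. wL2sq (\<lambda>_. 1) (?k2 n)) \<longlonglongrightarrow> 0"
      by (rule freq_kernel.kconv_tendsto[OF k2 Wm(1) mn(3) wm(1) m0(3) scf fin(3) scl l'(1)])
        (use wm Wm fin l in auto)
    have t3: "(\<lambda>n. wL2sq (\<lambda>_. 1) (?k3 n)) \<longlonglongrightarrow> 0"
      by (rule freq_kernel.kconv_tendsto[OF k3 mn(1) Wm(2) m0(1) wm(2) scf fin(4) scl l'(2)])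
        (use m0 mn fin l freq_weight_nonneg in auto)
    have km: "?k1 n \<in> borel_measurable freq_space" "?k2 n \<in> borel_measurable freq_space"
      "?k3 n \<in> borel_measurable freq_space" for n
      by (intro borel_measurable_diff freq_kernel.kconv_measurable[OF k1] freq_kernel.kconv_measurable[OF k2]
         freq_kernel.kconv_measurable[OF k3] m0 mn Wm wm)+
    have le: "?d n \<le> 2 * (wL2sq (\<lambda>_. 1) (?k1 n) + 2 * (wL2sq (\<lambda>_. 1) (?k2 n) + wL2sq (\<lambda>_. 1) (?k3 n)))" for n
    proof -
      have "?d n = wL2sq (\<lambda>_. 1) (\<lambda>k. ?k1 n k + (?k2 n k + ?k3 n k))"
        unfolding fiber_comm_op by (intro arg_cong[of _ _ "wL2sq _"] ext) simp
      also have "\<dots> \<le> 2 * (wL2sq (\<lambda>_. 1) (?k1 n) + wL2sq (\<lambda>_. 1) (\<lambda>k. ?k2 n k + ?k3 n k))"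
        by (intro wL2sq_add_le borel_measurable_add km borel_measurable_const)
      also have "\<dots> \<le> 2 * (wL2sq (\<lambda>_. 1) (?k1 n) + 2 * (wL2sq (\<lambda>_. 1) (?k2 n) + wL2sq (\<lambda>_. 1) (?k3 n)))"
        by (rule mult_left_mono[OF add_left_mono[OF wL2sq_add_le[OF borel_measurable_const km(2,3)]]]) simp
      finally show ?thesis .
    qed
    have "(\<lambda>n. 2 * (wL2sq (\<lambda>_. 1) (?k1 n) + 2 * (wL2sq (\<lambda>_. 1) (?k2 n) + wL2sq (\<lambda>_. 1) (?k3 n)))) \<longlonglongrightarrow> 2 * (0 + 2 * (0 + 0))"
      by (intro ennreal_tendsto_cmult tendsto_add t1 t2 t3) simp_all
    hence lim: "(\<lambda>n. 2 * (wL2sq (\<lambda>_. 1) (?k1 n) + 2 * (wL2sq (\<lambda>_. 1) (?k2 n) + wL2sq (\<lambda>_. 1) (?k3 n)))) \<longlonglongrightarrow> 0"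
      by simp
    show ?thesis
      by (rule tendsto_sandwich[OF _ always_eventually[OF allI] tendsto_const lim]) (simp, rule le)
  qed
  thus ?thesis unfolding l2 by (rule tendsto_ennsqrt_zero)
qed

text \<open>The convergence at a point uses the two norms at that point only, so the exceptional set
  is contained in the union of the null sets of the two approximating sequences.\<close>

lemma is_commutator_comm_op:
  assumes q: "0 \<le> q" "q \<le> 1" and w: "w \<in> spaceW M a h0 q" and u: "u \<in> spaceH M a h0 D q"
  shows "is_commutator M a h0 D q X w u (comm_op (fst w) (snd w) (fst u) (snd u))"
  unfolding is_commutator_def
proof (intro conjI allI impI)
  have m: "freq_measurable M a (fst w)" "freq_measurable M a (snd w)"
    "freq_measurable M a (fst u)" "freq_measurable M a (snd u)"
    using w u unfolding closure_space_def by auto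
  show "freq_measurable M a (comm_op (fst w) (snd w) (fst u) (snd u))"
    by (rule freq_measurable_comm_op[OF m])
  fix V U
  assume V: "approximates M a (normW M a h0 q) V (fst w) (snd w)"
    and U: "approximates M a (normH M a h0 D q) U (fst u) (snd u)"
  have VU: "smooth_supp (V n)" "smooth_supp (U n)" for n
    using V U unfolding approximates_def by (auto intro: test_fun_smooth_supp)
  from V[unfolded approximates_def, THEN conjunct2] U[unfolded approximates_def, THEN conjunct2]
  show "AE (r, \<theta>) in lborel. (r, \<theta>) \<in> rtheta M a \<longrightarrow>
     ((\<lambda>n. l2L2 (\<lambda>\<omega> m. commutator X (hat (V n)) (hat (U n)) \<omega> m r \<theta> -
        comm_op (fst w) (snd w) (fst u) (snd u) \<omega> m r \<theta>)) \<longlongrightarrow> 0) sequentially"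
  proof eventually_elim
    case (elim p)
    thus ?case using comm_op_tendsto[OF _ q m VU] by (auto split: prod.splits)
  qed
qed

end

section \<open>The weighted estimate\<close>

definition restrict2 :: "real \<Rightarrow> real \<Rightarrow> (real \<Rightarrow> real \<Rightarrow> real) \<Rightarrow> real \<times> real \<Rightarrow> real" where
  "restrict2 M a b p = indicator (rtheta M a) p * b (fst p) (snd p)"

lemma restrict2_measurable:
  "set_borel_measurable borel (rtheta M a) (\<lambda>(r, \<theta>). b r \<theta>) \<Longrightarrow> restrict2 M a b \<in> borel_measurable borel"
  unfolding set_borel_measurable_def restrict2_def[abs_def] by (simp add: split_def)

lemma rtheta_iff: "(r, \<theta>) \<in> rtheta M a \<longleftrightarrow> rplus M a < r \<and> 0 < \<theta> \<and> \<theta> < pi"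
  by (auto simp: rtheta_def)

lemma real_pair_fst_snd_measurable [measurable]:
  "fst \<in> borel_measurable (borel :: (real \<times> real) measure)"
  "snd \<in> borel_measurable (borel :: (real \<times> real) measure)"
  unfolding borel_prod[symmetric] by measurable

context sharp_setting begin

definition admissible_weights :: "(real \<Rightarrow> real \<Rightarrow> real) \<Rightarrow> (real \<Rightarrow> real \<Rightarrow> real) \<Rightarrow> (real \<Rightarrow> real \<Rightarrow> real) \<Rightarrow> bool" where
  "admissible_weights b b1 b2 \<longleftrightarrow>
    (\<forall>(r, \<theta>)\<in>rtheta M a. 0 \<le> b r \<theta> \<and> 0 \<le> b1 r \<theta> \<and> 0 \<le> b2 r \<theta> \<and> b r \<theta> = b1 r \<theta> * b2 r \<theta>) \<and>
    set_borel_measurable borel (rtheta M a) (\<lambda>(r, \<theta>). b1 r \<theta>) \<and>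
    set_borel_measurable borel (rtheta M a) (\<lambda>(r, \<theta>). b2 r \<theta>)"

definition weighted_L2sq :: "(real \<Rightarrow> real \<Rightarrow> real) \<Rightarrow> freqfun \<Rightarrow> ennreal" where
  "weighted_L2sq b K = (\<integral>\<^sup>+m. (\<integral>\<^sup>+\<omega>. (\<integral>\<^sup>+\<theta>\<in>{0<..<pi}. (\<integral>\<^sup>+r\<in>{rplus M a<..}.
     ennreal ((b r \<theta>)\<^sup>2 * (cmod (K \<omega> m r \<theta>))\<^sup>2 * sin \<theta>)
     \<partial>lborel) \<partial>lborel) \<partial>lborel) \<partial>count_space UNIV)"

definition weighted_sup_W :: "real \<Rightarrow> freqfun \<times> freqfun \<Rightarrow> (real \<Rightarrow> real \<Rightarrow> real) \<Rightarrow> ennreal" where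
  "weighted_sup_W q w b1 = (SUP (r, \<theta>)\<in>rtheta M a. ennreal ((b1 r \<theta>)\<^sup>2) *
     (normW M a h0 q (fst w) (snd w) r \<theta>)\<^sup>2 * ennreal (chi_lohi D r))"

definition weighted_integral_H :: "real \<Rightarrow> freqfun \<times> freqfun \<Rightarrow> (real \<Rightarrow> real \<Rightarrow> real) \<Rightarrow> ennreal" where
  "weighted_integral_H q u b2 = (\<integral>\<^sup>+\<theta>\<in>{0<..<pi}. (\<integral>\<^sup>+r\<in>{rplus M a<..}. ennreal ((b2 r \<theta>)\<^sup>2) *
     (normH M a h0 D q (fst u) (snd u) r \<theta>)\<^sup>2 * ennreal (chi_lohi D r) * ennreal (sin \<theta>) \<partial>lborel) \<partial>lborel)"

text \<open>One \<open>K\<close> serves all weights, since the extension is fixed before any weight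
  is chosen.\<close>

definition commutator_estimate :: "real \<Rightarrow> (freqfun \<Rightarrow> freqfun) \<Rightarrow> bool" where
  "commutator_estimate C X \<longleftrightarrow> (\<forall>q w u. 0 \<le> q \<longrightarrow> q \<le> 1 \<longrightarrow>
     w \<in> spaceW M a h0 q \<longrightarrow> u \<in> spaceH M a h0 D q \<longrightarrow>
     (\<exists>K. is_commutator M a h0 D q X w u K \<and> (\<forall>b b1 b2. admissible_weights b b1 b2 \<longrightarrow>
        weighted_L2sq b K \<le> ennreal C * (weighted_sup_W q w b1 * weighted_integral_H q u b2))))"

lemma commutator_estimate_mono:
  assumes "commutator_estimate C X" "C \<le> C'"
  shows "commutator_estimate C' X"
proof -
  have le: "ennreal C * x \<le> ennreal C' * x" for x
    using assms(2) by (intro mult_right_mono ennreal_leI) simp_all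
  show ?thesis
    using assms(1) unfolding commutator_estimate_def by (meson order_trans[OF _ le])
qed

text \<open>Allows a constant to be pulled out of the integral of the norm over
  \<open>(r, \<theta>)\<close>. For \<open>h0\<close> measurability comes from monotonicity, for
  \<open>chi_hi\<close> from continuity on the open half line.\<close>

lemma normH_measurable:
  assumes g: "freq_measurable M a g" "freq_measurable M a G"
  obtains \<nu> :: "real \<times> real \<Rightarrow> ennreal" where "\<nu> \<in> borel_measurable borel"
    "\<And>r \<theta>. (r, \<theta>) \<in> rtheta M a \<Longrightarrow> normH M a h0 D q g G r \<theta> = \<nu> (r, \<theta>)"
proof -
  let ?I = "{rplus M a<..}"
  have "mono_on ?I h0" using h0 by (simp add: is_h0_def)
  hence "h0 \<in> borel_measurable (restrict_space borel ?I)" by (rule borel_measurable_mono_on_fnc)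
  hence h: "(\<lambda>r. indicator ?I r *\<^sub>R h0 r) \<in> borel_measurable borel"
    by (simp add: borel_measurable_restrict_space_iff)
  have "Ck_on 0 ?I (chi_hi D)" using ok unfolding sharp_data_ok_def smooth_on_def by blast
  hence chi: "(\<lambda>r. indicator ?I r *\<^sub>R chi_hi D r) \<in> borel_measurable borel"
    by (intro borel_measurable_continuous_on_indicator) auto
  define h where "h r = indicator ?I r *\<^sub>R h0 r" for r
  define c where "c r = indicator ?I r *\<^sub>R chi_hi D r" for r
  have [measurable]: "h \<in> borel_measurable borel" "c \<in> borel_measurable borel"
    unfolding h_def[abs_def] c_def[abs_def] by fact+
  let ?g = "restrict_freq M a g" and ?G = "restrict_freq M a G"
  let ?A = "\<lambda>p k. of_real (vfun M a (fst p) powr q) * fiber ?g (fst p) (snd p) k"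
  let ?B = "\<lambda>p k. of_real (sqrt (c (fst p))) * (of_real (1 / vfun M a (fst p)) *
     (fiber ?G (fst p) (snd p) k - \<i> * of_real (h (fst p) * (snd k - omega_r a (fst k) (fst p))) * fiber ?g (fst p) (snd p) k)) / of_real (freq_max k)"
  note [measurable] = freq_measurable_restrict[OF g(1)] freq_measurable_restrict[OF g(2)]
  have [measurable]: "(\<lambda>(p, k). ?A p k) \<in> borel_measurable (borel \<Otimes>\<^sub>M freq_space)"
    unfolding vfun_def Delta_def split_def by measurable
  have [measurable]: "(\<lambda>(p, k). ?B p k) \<in> borel_measurable (borel \<Otimes>\<^sub>M freq_space)"
    unfolding vfun_def Delta_def split_def omega_r_def by measurable
  define \<nu> where "\<nu> p = ennsqrt (wL2sq (\<lambda>_. 1) (?A p)) + ennsqrt (wL2sq (\<lambda>_. 1) (?B p))" for p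
  have m: "(\<lambda>p. wL2sq (\<lambda>_. 1) (E p)) \<in> borel_measurable borel"
    if [measurable]: "(\<lambda>(p, k). E p k) \<in> borel_measurable (borel \<Otimes>\<^sub>M freq_space)" for E :: "real \<times> real \<Rightarrow> int \<times> real \<Rightarrow> complex"
    unfolding wL2sq_def
    by (rule sigma_finite_measure.borel_measurable_nn_integral[OF sigma_finite_freq_space]) measurable
  have "\<nu> \<in> borel_measurable borel"
    unfolding \<nu>_def by (intro borel_measurable_add measurable_compose[OF m measurable_ennsqrt]) fact+
  moreover have "normH M a h0 D q g G r \<theta> = \<nu> (r, \<theta>)" if p: "(r, \<theta>) \<in> rtheta M a" for r \<theta>
  proof -
    have "h r = h0 r" "c r = chi_hi D r" using p by (auto simp: h_def c_def rtheta_iff)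
    thus ?thesis
      unfolding \<nu>_def by (subst normH_eq) (simp_all add: freq_measurable_fiber[OF _ p] g restrict_freq_eq[OF p] fiber_Wzero)
  qed
  ultimately show ?thesis by (rule that)
qed

end

context comm_kernels begin

text \<open>After Tonelli the bound of \<open>comm_op_bound\<close> is used at each
  \<open>(r, \<theta>)\<close>. The weight splits as \<open>b1 * b2\<close>, one factor going with
  each norm, and the factor in \<open>w\<close> is replaced by its supremum.\<close>

lemma ex_commutator_estimate: "\<exists>C>0. commutator_estimate C X"
proof -
  obtain C where C: "C > 0"
    "\<And>q r \<theta> f F g G. 0 \<le> q \<Longrightarrow> q \<le> 1 \<Longrightarrow> r \<in> r_supp \<Longrightarrow>
      fiber f r \<theta> \<in> borel_measurable freq_space \<Longrightarrow> fiber F r \<theta> \<in> borel_measurable freq_space \<Longrightarrow>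
      fiber g r \<theta> \<in> borel_measurable freq_space \<Longrightarrow> fiber G r \<theta> \<in> borel_measurable freq_space \<Longrightarrow>
      wL2sq (\<lambda>_. 1) (fiber (comm_op f F g G) r \<theta>) \<le>
        ennreal C * ((normW M a h0 q f F r \<theta>)\<^sup>2 * (normH M a h0 D q g G r \<theta>)\<^sup>2)"
    by (rule comm_op_bound) (rule that, assumption+)
  have "weighted_L2sq b (comm_op (fst w) (snd w) (fst u) (snd u)) \<le>
      ennreal C * (weighted_sup_W q w b1 * weighted_integral_H q u b2)"
    if q: "0 \<le> q" "q \<le> 1" and "freq_measurable M a (fst w)" "freq_measurable M a (snd w)"
      "freq_measurable M a (fst u)" "freq_measurable M a (snd u)" and adm: "admissible_weights b b1 b2"
    for q w u b b1 b2
  proof -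
    obtain f F g G where wu: "w = (f, F)" "u = (g, G)" by (cases w, cases u)
    have meas: "freq_measurable M a f" "freq_measurable M a F" "freq_measurable M a g" "freq_measurable M a G"
      using that by (simp_all add: wu)
    note b = adm[unfolded admissible_weights_def, THEN conjunct1]
      and bm = adm[unfolded admissible_weights_def, THEN conjunct2]
    let ?K = "comm_op f F g G"
    let ?h = "\<lambda>\<theta> r. ennreal ((b2 r \<theta>)\<^sup>2) * (normH M a h0 D q g G r \<theta>)\<^sup>2 * ennreal (chi_lohi D r) *
      ennreal (sin \<theta>) * indicator {rplus M a<..} r * indicator {0<..<pi} \<theta>"
    let ?\<beta>1 = "restrict2 M a b1" and ?\<beta>2 = "restrict2 M a b2"
    note [measurable] = restrict2_measurable[OF bm[THEN conjunct1]] restrict2_measurable[OF bm[THEN conjunct2]]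
    define S where "S = weighted_sup_W q w b1"
    \<comment> \<open>The integrand extended by 0 off \<open>rtheta\<close>, with \<open>b\<close>
      written as \<open>b1 * b2\<close>: measurability is assumed of these two factors.\<close>
    define \<Phi> where "\<Phi> p k = ennreal ((?\<beta>1 p * ?\<beta>2 p)\<^sup>2 * (cmod (fiber (restrict_freq M a ?K) (fst p) (snd p) k))\<^sup>2 * sin (snd p))" for p k
    note Kmeas = freq_measurable_comm_op[OF meas]
    note [measurable] = freq_measurable_restrict[OF Kmeas]
    have \<Phi>m: "(\<lambda>(p, k). \<Phi> p k) \<in> borel_measurable (borel \<Otimes>\<^sub>M freq_space)"
      unfolding \<Phi>_def split_def by measurable
    have \<Phi>_in: "\<Phi> (r, \<theta>) (m, \<omega>) = ennreal ((b r \<theta>)\<^sup>2 * (cmod (?K \<omega> m r \<theta>))\<^sup>2 * sin \<theta>)"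
      if "(r, \<theta>) \<in> rtheta M a" for r \<theta> m \<omega>
      using that b by (auto simp: \<Phi>_def restrict2_def fiber_def restrict_freq_def)
    have \<Phi>_out: "\<Phi> (r, \<theta>) k = 0" if "(r, \<theta>) \<notin> rtheta M a" for r \<theta> k
      using that by (simp add: \<Phi>_def restrict2_def)
    have "weighted_L2sq b ?K =
      (\<integral>\<^sup>+m. (\<integral>\<^sup>+\<omega>. (\<integral>\<^sup>+\<theta>. (\<integral>\<^sup>+r. \<Phi> (r, \<theta>) (m, \<omega>) \<partial>lborel) \<partial>lborel) \<partial>lborel) \<partial>count_space UNIV)"
      unfolding weighted_L2sq_def
    proof (intro nn_integral_cong)
      fix m \<omega> \<theta>
      show "(\<integral>\<^sup>+r\<in>{rplus M a<..}. ennreal ((b r \<theta>)\<^sup>2 * (cmod (?K \<omega> m r \<theta>))\<^sup>2 * sin \<theta>) \<partial>lborel) * indicator {0<..<pi} \<theta> =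
        (\<integral>\<^sup>+r. \<Phi> (r, \<theta>) (m, \<omega>) \<partial>lborel)"
      proof (cases "\<theta> \<in> {0<..<pi}")
        case True
        have "ennreal ((b r \<theta>)\<^sup>2 * (cmod (?K \<omega> m r \<theta>))\<^sup>2 * sin \<theta>) * indicator {rplus M a<..} r = \<Phi> (r, \<theta>) (m, \<omega>)" for r
          using True by (cases "rplus M a < r") (simp_all add: \<Phi>_in \<Phi>_out rtheta_iff)
        thus ?thesis using True by simp
      next
        case False
        hence "\<Phi> (r, \<theta>) (m, \<omega>) = 0" for r by (intro \<Phi>_out) (auto simp: rtheta_iff)
        thus ?thesis using False by simp
      qed
    qed
    also have "\<dots> = (\<integral>\<^sup>+\<theta>. (\<integral>\<^sup>+r. (\<integral>\<^sup>+k. \<Phi> (r, \<theta>) k \<partial>freq_space) \<partial>lborel) \<partial>lborel)"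
      by (rule nn_integral_freq_space_swap[OF \<Phi>m])
    also have "\<dots> \<le> (\<integral>\<^sup>+\<theta>. (\<integral>\<^sup>+r. (ennreal C * S) * ?h \<theta> r \<partial>lborel) \<partial>lborel)"
    proof (intro nn_integral_mono)
      fix \<theta> r :: real
      let ?R = "(ennreal C * S) * ?h \<theta> r"
      show "(\<integral>\<^sup>+k. \<Phi> (r, \<theta>) k \<partial>freq_space) \<le> ?R"
      proof (cases "(r, \<theta>) \<in> rtheta M a")
        case p: True
        hence sin: "sin \<theta> \<ge> 0" by (intro less_imp_le sin_gt_zero) (auto simp: rtheta_iff)
        have km: "fiber ?K r \<theta> \<in> borel_measurable freq_space" by (rule freq_measurable_fiber[OF Kmeas p])
        have "(\<integral>\<^sup>+k. \<Phi> (r, \<theta>) k \<partial>freq_space) =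
            (\<integral>\<^sup>+k. ennreal ((b1 r \<theta> * b2 r \<theta>)\<^sup>2 * sin \<theta>) * ennreal ((1 * cmod (fiber ?K r \<theta> k))\<^sup>2) \<partial>freq_space)"
          using p sin by (intro nn_integral_cong)
            (simp add: \<Phi>_def restrict2_def restrict_freq_eq[OF p] ennreal_mult[symmetric] mult_ac)
        also have "\<dots> = ennreal ((b1 r \<theta> * b2 r \<theta>)\<^sup>2 * sin \<theta>) * wL2sq (\<lambda>_. 1) (fiber ?K r \<theta>)"
          unfolding wL2sq_def using km by (intro nn_integral_cmult) simp
        also have "\<dots> \<le> ?R"
        proof (cases "r \<in> r_supp")
          case False
          thus ?thesis by (simp add: fiber_comm_op_outside wL2sq_def)
        next
          case True
          let ?N = "(normW M a h0 q f F r \<theta>)\<^sup>2" and ?H = "(normH M a h0 D q g G r \<theta>)\<^sup>2"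
          \<comment> \<open>\<open>chi_lohi\<close> equals 1 on \<open>r_supp\<close>, so the
            cut-off may be inserted without loss, here and in the integral of the norm of
            \<open>u\<close>.\<close>
          have le: "ennreal ((b1 r \<theta>)\<^sup>2) * ?N \<le> S"
            unfolding S_def weighted_sup_W_def wu using p r_supp_props(3)[OF True]
            by (intro SUP_upper2[of "(r, \<theta>)"]) auto
          have e: "ennreal ((b1 r \<theta> * b2 r \<theta>)\<^sup>2 * sin \<theta>) = ennreal ((b1 r \<theta>)\<^sup>2) * ennreal ((b2 r \<theta>)\<^sup>2) * ennreal (sin \<theta>)"
            using sin by (simp add: power_mult_distrib ennreal_mult)
          have "ennreal ((b1 r \<theta> * b2 r \<theta>)\<^sup>2 * sin \<theta>) * wL2sq (\<lambda>_. 1) (fiber ?K r \<theta>) \<le>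
              ennreal ((b1 r \<theta> * b2 r \<theta>)\<^sup>2 * sin \<theta>) * (ennreal C * (?N * ?H))"
            by (intro mult_left_mono C(2)[OF q True] freq_measurable_fiber[OF _ p] meas) simp
          also have "\<dots> =
              ennreal C * (ennreal ((b1 r \<theta>)\<^sup>2) * ?N) * (ennreal ((b2 r \<theta>)\<^sup>2) * ?H * ennreal (sin \<theta>))"
            unfolding e by (simp only: mult_ac)
          also have "\<dots> \<le> ennreal C * S * (ennreal ((b2 r \<theta>)\<^sup>2) * ?H * ennreal (sin \<theta>))"
            by (intro mult_right_mono mult_left_mono le) simp_all
          also have "\<dots> = ?R" using p r_supp_props(3)[OF True] by (simp add: rtheta_iff)
          finally show ?thesis .
        qed
        finally show ?thesis .
      qed (simp add: \<Phi>_out)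
    qed
    \<comment> \<open>Taking the constant out of the iterated integral requires a measurable
      integrand, so the norm is replaced by a Borel function that agrees with it on
      \<open>rtheta\<close>.\<close>
    also have "\<dots> = ennreal C * S * (\<integral>\<^sup>+\<theta>. (\<integral>\<^sup>+r. ?h \<theta> r \<partial>lborel) \<partial>lborel)"
    proof -
      obtain \<nu> :: "real \<times> real \<Rightarrow> ennreal" where \<nu> [measurable]: "\<nu> \<in> borel_measurable borel"
        and \<nu>_eq: "\<And>r \<theta>. (r, \<theta>) \<in> rtheta M a \<Longrightarrow> normH M a h0 D q g G r \<theta> = \<nu> (r, \<theta>)"
        by (rule normH_measurable[OF meas(3,4), of q]) (rule that, assumption+)
      have "Ck_on 0 {rplus M a<..} (chi_lohi D)" using ok unfolding sharp_data_ok_def smooth_on_def by blast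
      hence [measurable]: "(\<lambda>r. indicator {rplus M a<..} r *\<^sub>R chi_lohi D r) \<in> borel_measurable borel"
        by (intro borel_measurable_continuous_on_indicator) auto
      define \<Psi> where "\<Psi> = (\<lambda>(\<theta>, r). ennreal ((?\<beta>2 (r, \<theta>))\<^sup>2) * (\<nu> (r, \<theta>))\<^sup>2 *
          ennreal (indicator {rplus M a<..} r *\<^sub>R chi_lohi D r) * ennreal (sin \<theta>))"
      have [measurable]: "(\<lambda>x. (snd x, fst x)) \<in> measurable (borel \<Otimes>\<^sub>M borel) (borel :: (real \<times> real) measure)"
        unfolding borel_prod[symmetric] by measurable
      have \<Psi>m [measurable]: "\<Psi> \<in> borel_measurable (borel \<Otimes>\<^sub>M borel)"
        unfolding \<Psi>_def split_def by measurable
      have eq: "?h \<theta> r = \<Psi> (\<theta>, r)" for r \<theta>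
      proof (cases "(r, \<theta>) \<in> rtheta M a")
        case True
        thus ?thesis by (simp add: \<Psi>_def restrict2_def \<nu>_eq rtheta_iff[symmetric]) (simp add: rtheta_iff)
      next
        case False
        thus ?thesis by (auto simp: \<Psi>_def restrict2_def rtheta_iff indicator_def)
      qed
      have "(\<integral>\<^sup>+\<theta>. (\<integral>\<^sup>+r. (ennreal C * S) * \<Psi> (\<theta>, r) \<partial>lborel) \<partial>lborel) =
          (\<integral>\<^sup>+\<theta>. (ennreal C * S) * (\<integral>\<^sup>+r. \<Psi> (\<theta>, r) \<partial>lborel) \<partial>lborel)"
        by (intro nn_integral_cong nn_integral_cmult) measurable
      also have "\<dots> = (ennreal C * S) * (\<integral>\<^sup>+\<theta>. (\<integral>\<^sup>+r. \<Psi> (\<theta>, r) \<partial>lborel) \<partial>lborel)"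
        by (intro nn_integral_cmult) measurable
      finally show ?thesis unfolding eq .
    qed
    also have "(\<integral>\<^sup>+\<theta>. (\<integral>\<^sup>+r. ?h \<theta> r \<partial>lborel) \<partial>lborel) = weighted_integral_H q u b2"
      unfolding weighted_integral_H_def wu by (intro nn_integral_cong) (simp split: split_indicator)
    finally show ?thesis
      by (simp only: S_def wu fst_conv snd_conv mult.assoc)
  qed
  note bound = this
  have m: "freq_measurable M a (fst z)" "freq_measurable M a (snd z)" if "z \<in> closure_space M a N" for z N
    using that unfolding closure_space_def by auto
  have "commutator_estimate C X"
    unfolding commutator_estimate_def
  proof (intro allI impI)
    fix q w u
    assume q: "0 \<le> q" "q \<le> 1" and w: "w \<in> spaceW M a h0 q" and u: "u \<in> spaceH M a h0 D q"
    show "\<exists>K. is_commutator M a h0 D q X w u K \<and> (\<forall>b b1 b2. admissible_weights b b1 b2 \<longrightarrow>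
        weighted_L2sq b K \<le> ennreal C * (weighted_sup_W q w b1 * weighted_integral_H q u b2))"
      by (intro exI[of _ "comm_op (fst w) (snd w) (fst u) (snd u)"] conjI allI impI
          is_commutator_comm_op bound q w u m[OF w] m[OF u])
  qed
  with C(1) show ?thesis by blast
qed

end

section \<open>The kernels of the three commutators\<close>

lemma freq_kernel_zero:
  assumes [measurable]: "p \<in> borel_measurable freq_space" "\<rho> \<in> borel_measurable freq_space"
    and "\<And>k. 0 \<le> p k" "\<And>k. 0 \<le> \<rho> k"
  shows "freq_kernel (\<lambda>_ _. 0) p \<rho>"
  by unfold_locales (use assms in auto)

context sharp_setting begin

text \<open>Common to \<open>X_T\<close> and \<open>X_phi\<close>: a constant of modulus 1 times a
  real multiplier. Such a commutator needs no product rule, so only the first kernel is nonzero and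
  the Lipschitz bound of the multiplier is its kernel bound.\<close>

lemma multiplier_comm_kernels:
  fixes s :: "real \<Rightarrow> int \<times> real \<Rightarrow> real" and c :: complex
  assumes C: "0 \<le> C" and c: "cmod c = 1"
    and Lip: "\<And>r k k'. \<bar>s r k - s r (k - k')\<bar> \<le> C * freq_weight k'"
    and meas: "(\<lambda>(r, k). s r k) \<in> borel_measurable (borel \<Otimes>\<^sub>M freq_space)"
    and supp: "\<And>r k. r \<notin> r_supp \<Longrightarrow> s r k = 0"
    and X: "\<And>f \<omega> m r \<theta>. X f \<omega> m r \<theta> = c * of_real (s r (m, \<omega>)) * f \<omega> m r \<theta>"
    and dec: "\<And>U r \<theta>. smooth_supp U \<Longrightarrow> decaying (\<lambda>k. of_real (s r k) * fiber (hat U) r \<theta> k)"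
  shows "comm_kernels M a h0 D X (\<lambda>r k k'. c * of_real (s r k - s r (k - k'))) (\<lambda>_ _ _. 0) (\<lambda>_ _ _. 0) C"
proof (intro comm_kernels.intro comm_kernels_axioms.intro sharp_setting_axioms)
  have sm: "(\<lambda>x. s (f x) (g x)) \<in> borel_measurable N"
    if "f \<in> borel_measurable N" "g \<in> measurable N freq_space" for f g N
    using measurable_compose[OF measurable_Pair[OF that] meas] by simp
  have joint: "(\<lambda>x. c * of_real (s (f x) (g x) - s (f x) (g x - h x)) :: complex) \<in> borel_measurable N"
    if [measurable]: "f \<in> borel_measurable N" "g \<in> measurable N freq_space" "h \<in> measurable N freq_space" for f g h N
  proof -
    note [measurable] = borel_measurable_diff[OF sm[OF that(1,2)] sm[OF that(1) measurable_freq_diff[OF that(2,3)]]]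
    show ?thesis by measurable
  qed
  show "freq_kernel (\<lambda>k k'. c * of_real (s r k - s r (k - k'))) (\<lambda>k. C * freq_weight k) (\<lambda>_. 1)" for r
  proof unfold_locales
    show "(\<lambda>(k, k'). c * of_real (s r k - s r (k - k'))) \<in> borel_measurable (freq_space \<Otimes>\<^sub>M freq_space)"
      unfolding split_def by (intro joint) measurable
    show "cmod (c * of_real (s r k - s r (k - k'))) \<le> C * freq_weight k' * 1" for k k'
      unfolding norm_mult c norm_of_real mult_1 mult_1_right by (rule Lip)
  qed (use C freq_weight_nonneg in auto)
  show "(\<lambda>(r, k, k'). c * of_real (s r k - s r (k - k'))) \<in> borel_measurable (borel \<Otimes>\<^sub>M freq_space \<Otimes>\<^sub>M freq_space)"
    unfolding split_def by (intro joint) measurable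
  show "freq_kernel (\<lambda>k k'. 0) (\<lambda>k. C * 1) (\<lambda>_. 1)"
    using C by (intro freq_kernel_zero) auto
  show "freq_kernel (\<lambda>k k'. 0) (\<lambda>k. C * freq_weight k) (\<lambda>k. 1 / freq_max k)"
    by (rule freq_kernel_zero) (use C freq_weight_nonneg order_trans[OF zero_le_one freq_max_ge_1] in auto)
  fix U V \<omega> m r \<theta>
  assume UV: "smooth_supp U" "smooth_supp V"
  have "commutator X (hat V) (hat U) \<omega> m r \<theta> = kconv (\<lambda>k k'. c * of_real (s r k) - c * of_real (s r (k - k')))
      (fiber (hat V) r \<theta>) (fiber (hat U) r \<theta>) (m, \<omega>)"
    using decaying_cmult[OF dec[OF UV(1)], of c r \<theta>]
    by (intro commutator_multiplier_hat UV) (simp_all only: X mult.assoc)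
  thus "commutator X (hat V) (hat U) \<omega> m r \<theta> =
      kconv (\<lambda>k k'. c * of_real (s r k - s r (k - k'))) (fiber (hat V) r \<theta>) (fiber (hat U) r \<theta>) (m, \<omega>) +
      (kconv (\<lambda>_ _. 0) (fiber (Wplus M a (hat V)) r \<theta>) (fiber (hat U) r \<theta>) (m, \<omega>) +
       kconv (\<lambda>_ _. 0) (fiber (hat V) r \<theta>) (fiber (Wplus M a (hat U)) r \<theta>) (m, \<omega>))"
    by (simp only: kconv_zero of_real_diff right_diff_distrib add_0_right)
qed (use C supp in auto)

lemma comm_kernels_X_T:
  assumes C: "0 \<le> C" and Lip: "\<And>\<omega>1 \<omega>2 m1 m2 r. \<bar>gsharp_cut D \<omega>1 m1 r * \<omega>1 - gsharp_cut D \<omega>2 m2 r * \<omega>2\<bar>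
       \<le> C * (\<bar>\<omega>1 - \<omega>2\<bar> + \<bar>real_of_int m1 - real_of_int m2\<bar>)"
  shows "\<exists>\<kappa>. comm_kernels M a h0 D (X_T D) \<kappa> (\<lambda>_ _ _. 0) (\<lambda>_ _ _. 0) C"
proof (rule exI, rule multiplier_comm_kernels[where c = "- \<i>" and s = "\<lambda>r k. gsharp_cut D (snd k) (fst k) r * snd k"])
  show "\<bar>gsharp_cut D (snd k) (fst k) r * snd k - gsharp_cut D (snd (k - k')) (fst (k - k')) r * snd (k - k')\<bar>
      \<le> C * freq_weight k'" for r k k'
    using Lip[of "snd k" "fst k" r "snd (k - k')" "fst (k - k')"] by (simp add: freq_weight_def add.commute)
  show "decaying (\<lambda>k. of_real (gsharp_cut D (snd k) (fst k) r * snd k) * fiber (hat U) r \<theta> k)"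
    if "smooth_supp U" for U r \<theta>
    unfolding of_real_mult mult.assoc by (intro decaying_gsym decaying_times_omega that)
qed (use C gsharp_cut_support in \<open>auto simp: X_T_def split_def\<close>)

lemma comm_kernels_X_phi:
  assumes C: "0 \<le> C" and Lip: "\<And>\<omega>1 \<omega>2 m1 m2 r. \<bar>gsharp_cut D \<omega>1 m1 r * of_int m1 - gsharp_cut D \<omega>2 m2 r * of_int m2\<bar>
       \<le> C * (\<bar>\<omega>1 - \<omega>2\<bar> + \<bar>real_of_int m1 - real_of_int m2\<bar>)"
  shows "\<exists>\<kappa>. comm_kernels M a h0 D (X_phi D) \<kappa> (\<lambda>_ _ _. 0) (\<lambda>_ _ _. 0) C"
proof (rule exI, rule multiplier_comm_kernels[where c = "\<i>" and s = "\<lambda>r k. gsharp_cut D (snd k) (fst k) r * of_int (fst k)"])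
  show "\<bar>gsharp_cut D (snd k) (fst k) r * of_int (fst k) - gsharp_cut D (snd (k - k')) (fst (k - k')) r * of_int (fst (k - k'))\<bar>
      \<le> C * freq_weight k'" for r k k'
    using Lip[of "snd k" "fst k" r "snd (k - k')" "fst (k - k')"] by (simp add: freq_weight_def add.commute)
  show "decaying (\<lambda>k. of_real (gsharp_cut D (snd k) (fst k) r * of_int (fst k)) * fiber (hat U) r \<theta> k)"
    if "smooth_supp U" for U r \<theta>
    unfolding of_real_mult of_real_of_int_eq mult.assoc by (intro decaying_gsym decaying_times_m that)
qed (use C gsharp_cut_support in \<open>auto simp: X_phi_def split_def\<close>)

text \<open>The kernel in front of \<open>Wplus\<close> of the first factor is the symbol itself and
  only has to be bounded. The difference kernel is paired with \<open>Wplus\<close> of the second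
  factor and requires the gain \<open>1 / freq_max\<close>, taken at \<open>k - k'\<close>, the
  frequency of that factor.\<close>

lemma comm_kernels_X_Wplus:
  assumes C: "0 \<le> C" and bd: "\<And>\<omega> m r. \<bar>gsharp_cut D \<omega> m r\<bar> \<le> C"
    and Lip: "\<And>\<omega>1 \<omega>2 m1 m2 r. \<bar>gsharp_cut D \<omega>1 m1 r - gsharp_cut D \<omega>2 m2 r\<bar> * max (max \<bar>of_int m2\<bar> \<bar>\<omega>2\<bar>) 1
       \<le> C * (\<bar>\<omega>1 - \<omega>2\<bar> + \<bar>real_of_int m1 - real_of_int m2\<bar>)"
  shows "comm_kernels M a h0 D (X_Wplus M a D) (\<lambda>_ _ _. 0) (\<lambda>r k _. gsym r k) (\<lambda>r k k'. gsym r k - gsym r (k - k')) C"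
proof (intro comm_kernels.intro comm_kernels_axioms.intro sharp_setting_axioms)
  show "freq_kernel (\<lambda>k k'. 0) (\<lambda>k. C * freq_weight k) (\<lambda>_. 1)"
    by (rule freq_kernel_zero) (use C freq_weight_nonneg in auto)
  show "freq_kernel (\<lambda>k k'. gsym r k) (\<lambda>k. C * 1) (\<lambda>_. 1)" for r
    by unfold_locales (use C bd in \<open>simp_all add: split_def\<close>)
  show "freq_kernel (\<lambda>k k'. gsym r k - gsym r (k - k')) (\<lambda>k. C * freq_weight k) (\<lambda>k. 1 / freq_max k)" for r
  proof unfold_locales
    show "(\<lambda>(k, k'). gsym r k - gsym r (k - k')) \<in> borel_measurable (freq_space \<Otimes>\<^sub>M freq_space)"
      unfolding split_def by measurable
    show "cmod (gsym r k - gsym r (k - k')) \<le> C * freq_weight k' * (1 / freq_max (k - k'))" for k k'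
    proof -
      have mx: "freq_max (k - k') > 0" using freq_max_ge_1[of "k - k'"] by linarith
      have "\<bar>gsharp_cut D (snd k) (fst k) r - gsharp_cut D (snd (k - k')) (fst (k - k')) r\<bar> * freq_max (k - k') \<le> C * freq_weight k'"
        using Lip[of "snd k" "fst k" r "snd (k - k')" "fst (k - k')"]
        by (simp add: freq_weight_def freq_max_def add.commute)
      thus ?thesis using mx by (simp add: pos_le_divide_eq flip: of_real_diff del: fst_diff snd_diff)
    qed
    show "0 \<le> 1 / freq_max k" for k using freq_max_ge_1[of k] by simp
  qed (use C freq_weight_nonneg in auto)
  show "(\<lambda>(r, k, k'). gsym r k - gsym r (k - k')) \<in> borel_measurable (borel \<Otimes>\<^sub>M freq_space \<Otimes>\<^sub>M freq_space)"
    unfolding split_def by measurable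
qed (use C gsharp_cut_support commutator_X_Wplus_hat in \<open>auto simp: kconv_def[of "\<lambda>_ _. 0"]\<close>)

lemma ex_uniform_commutator_estimate:
  "\<exists>C>0. \<forall>X\<in>{X_T D, X_phi D, X_Wplus M a D}. commutator_estimate C X"
proof (rule gsharp_symbol_bounds)
  fix C assume C: "C \<ge> 0"
    "\<And>\<omega> m r. \<bar>gsharp_cut D \<omega> m r\<bar> \<le> C"
    "\<And>\<omega>1 \<omega>2 m1 m2 r. \<bar>gsharp_cut D \<omega>1 m1 r * \<omega>1 - gsharp_cut D \<omega>2 m2 r * \<omega>2\<bar>
       \<le> C * (\<bar>\<omega>1 - \<omega>2\<bar> + \<bar>real_of_int m1 - real_of_int m2\<bar>)"
    "\<And>\<omega>1 \<omega>2 m1 m2 r. \<bar>gsharp_cut D \<omega>1 m1 r * of_int m1 - gsharp_cut D \<omega>2 m2 r * of_int m2\<bar>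
       \<le> C * (\<bar>\<omega>1 - \<omega>2\<bar> + \<bar>real_of_int m1 - real_of_int m2\<bar>)"
    "\<And>\<omega>1 \<omega>2 m1 m2 r. \<bar>gsharp_cut D \<omega>1 m1 r - gsharp_cut D \<omega>2 m2 r\<bar> *
          max (max \<bar>of_int m2\<bar> \<bar>\<omega>2\<bar>) 1
       \<le> C * (\<bar>\<omega>1 - \<omega>2\<bar> + \<bar>real_of_int m1 - real_of_int m2\<bar>)"
  obtain \<kappa> \<kappa>' where k: "comm_kernels M a h0 D (X_T D) \<kappa> (\<lambda>_ _ _. 0) (\<lambda>_ _ _. 0) C"
    "comm_kernels M a h0 D (X_phi D) \<kappa>' (\<lambda>_ _ _. 0) (\<lambda>_ _ _. 0) C"
    using comm_kernels_X_T[OF C(1,3)] comm_kernels_X_phi[OF C(1,4)] by blast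
  obtain C1 C2 C3 where C123: "C1 > 0" "commutator_estimate C1 (X_T D)" "C2 > 0" "commutator_estimate C2 (X_phi D)"
    "C3 > 0" "commutator_estimate C3 (X_Wplus M a D)"
    using comm_kernels.ex_commutator_estimate[OF k(1)]
      comm_kernels.ex_commutator_estimate[OF k(2)]
      comm_kernels.ex_commutator_estimate[OF comm_kernels_X_Wplus[OF C(1,2,5)]] by metis
  show ?thesis
  proof (intro exI[of _ "C1 + C2 + C3"] conjI ballI)
    fix X assume "X \<in> {X_T D, X_phi D, X_Wplus M a D}"
    then consider "X = X_T D" | "X = X_phi D" | "X = X_Wplus M a D" by blast
    thus "commutator_estimate (C1 + C2 + C3) X"
      using C123 by cases (auto intro: commutator_estimate_mono)
  qed (use C123 in simp)
qed

end

theorem proposition6p2: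
  fixes M a :: real and h0 :: "real \<Rightarrow> real" and D :: sharp_data
  assumes "0 < a" and "a < M"
    and "is_h0 M a h0"
    and "sharp_data_ok M a D"
  shows "\<exists>C>0. \<forall>q w u X. 0 \<le> q \<longrightarrow> q \<le> 1 \<longrightarrow>
     w \<in> spaceW M a h0 q \<longrightarrow> u \<in> spaceH M a h0 D q \<longrightarrow> X \<in> {X_T D, X_phi D, X_Wplus M a D} \<longrightarrow>
     (\<exists>K. is_commutator M a h0 D q X w u K \<and>
       (\<forall>b b1 b2 :: real \<Rightarrow> real \<Rightarrow> real.
          (\<forall>(r, \<theta>)\<in>rtheta M a. 0 \<le> b r \<theta> \<and> 0 \<le> b1 r \<theta> \<and> 0 \<le> b2 r \<theta> \<and> b r \<theta> = b1 r \<theta> * b2 r \<theta>) \<longrightarrow>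
          set_borel_measurable borel (rtheta M a) (\<lambda>(r, \<theta>). b1 r \<theta>) \<longrightarrow>
          set_borel_measurable borel (rtheta M a) (\<lambda>(r, \<theta>). b2 r \<theta>) \<longrightarrow>
          (let RHS =
             (SUP (r, \<theta>)\<in>rtheta M a. ennreal ((b1 r \<theta>)\<^sup>2) *
                (normW M a h0 q (fst w) (snd w) r \<theta>)\<^sup>2 * ennreal (chi_lohi D r)) *
             (\<integral>\<^sup>+\<theta>\<in>{0<..<pi}. (\<integral>\<^sup>+r\<in>{rplus M a<..}. ennreal ((b2 r \<theta>)\<^sup>2) *
                (normH M a h0 D q (fst u) (snd u) r \<theta>)\<^sup>2 * ennreal (chi_lohi D r) *
                ennreal (sin \<theta>) \<partial>lborel) \<partial>lborel)
           in RHS < \<infinity> \<longrightarrow>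
             (\<integral>\<^sup>+m. (\<integral>\<^sup>+\<omega>. (\<integral>\<^sup>+\<theta>\<in>{0<..<pi}. (\<integral>\<^sup>+r\<in>{rplus M a<..}.
                ennreal ((b r \<theta>)\<^sup>2 * (cmod (K \<omega> m r \<theta>))\<^sup>2 * sin \<theta>)
                \<partial>lborel) \<partial>lborel) \<partial>lborel) \<partial>count_space UNIV)
             \<le> ennreal C * RHS)))"
proof -
  interpret sharp_setting M a h0 D
    by unfold_locales fact+
  obtain C where C: "C > 0" "\<And>X. X \<in> {X_T D, X_phi D, X_Wplus M a D} \<Longrightarrow> commutator_estimate C X"
    using ex_uniform_commutator_estimate by metis
  show ?thesis
  proof (intro exI[of _ C] conjI allI impI, goal_cases)
    case (2 q w u X)
    then obtain K where K: "is_commutator M a h0 D q X w u K" and est: "\<And>b b1 b2. admissible_weights b b1 b2 \<Longrightarrow>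
        weighted_L2sq b K \<le> ennreal C * (weighted_sup_W q w b1 * weighted_integral_H q u b2)"
      using C(2)[of X] unfolding commutator_estimate_def by blast
    show ?case
      unfolding Let_def
      by (intro exI[of _ K] conjI K allI impI est[unfolded admissible_weights_def weighted_L2sq_def
            weighted_sup_W_def weighted_integral_H_def]) simp_all
  qed (fact C(1))
qed

end
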